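(* Let $p$ be a prime, let $(\mathcal L_1,\Delta_1,S_1)$ and $(\mathcal L_2,\Delta_2,S_2)$ be localities, and let $(\mathcal L,\Delta,S)=(\mathcal L_1\times\mathcal L_2,\Delta_1*\Delta_2,S_1\times S_2)$ be their external direct product (which is a locality). Then $(\mathcal L,\Delta,S)$ is a linking locality if and only if $(\mathcal L_i,\Delta_i,S_i)$ is a linking locality for each $i=1,2$.
   Context: Partial groups. For a set $X$, $\mathbf W(X)$ is the set of finite words in $X$ (including the empty word $\emptyset$), $\circ$ is concatenation, and $x\in X$ is identified with the word $(x)$. A partial group is a nonempty set $\mathcal L$ with an involutory bijection $f\mapsto f^{-1}$ (extended to words by $(f_1,\dots,f_n)^{-1}=(f_n^{-1},\dots,f_1^{-1})$), a domain $\mathbf D\subseteq\mathbf W(\mathcal L)$ and a product $\Pi:\mathbf D\to\mathcal L$ such that: (1) $\mathcal L\subseteq\mathbf D$, and $u\circ v\in\mathbf D$ implies $u,v\in\mathbf D$; (2) $\Pi$ restricts to the identity on $\mathcal L$; (3) if $u\circ v\circ w\in\mathbf D$ then $u\circ(\Pi(v))\circ w\in\mathbf D$ and $\Pi(u\circ v\circ w)=\Pi(u\circ(\Pi(v))\circ w)$; (4) if $w\in\mathbf D$ then $w^{-1}\circ w\in\mathbf D$ and $\Pi(w^{-1}\circ w)=\mathbf 1:=\Pi(\emptyset)$. A partial subgroup is a subset $\mathcal H$ closed under inversion and with $\Pi(w)\in\mathcal H$ for all $w\in\mathbf W(\mathcal H)\cap\mathbf D$; it is a subgroup if moreover $\mathbf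 W(\mathcal H)\subseteq\mathbf D$ (then it is a group), and a $p$-subgroup if its order is a power of $p$. For $g\in\mathcal L$, $\mathbf D(g)=\{x\in\mathcal L:(g^{-1},x,g)\in\mathbf D\}$, $x^g=\Pi(g^{-1},x,g)$ for $x\in\mathbf D(g)$, and $X^g=\{x^g:x\in X\}$ for $X\subseteq\mathbf D(g)$. For $X\subseteq\mathcal L$, $N_{\mathcal L}(X)=\{g\in\mathcal L: X\subseteq\mathbf D(g),\ X^g=X\}$. Localities. For a set $\Delta$ of subgroups of $\mathcal L$, $\mathbf D_\Delta$ is the set of words $(f_1,\dots,f_n)\in\mathbf W(\mathcal L)$ for which there are $P_0,\dots,P_n\in\Delta$ with $P_{i-1}\subseteq\mathbf D(f_i)$ and $P_{i-1}^{f_i}=P_i$ for all $i$. $(\mathcal L,\Delta,S)$ is a locality if $\mathcal L$ is a partial group that is finite as a set, $S$ is a $p$-subgroup of $\mathcal L$, $\Delta$ is a nonempty set of subgroups of $S$, and (L1) $S$ is maximal under inclusion among the $p$-subgroups of $\mathcal L$; (L2) $\mathbf D=\mathbf D_\Delta$; (L3) every subgroup $Q\le S$ for which there are $P\in\Delta$ and $g\in\mathcal L$ with $P\subseteq\mathbf D(g)$ and $P^g\le Q$ lies in $\Delta$. Then $N_{\mathcal L}(P)$ is a finite group for $P\in\Delta$. $\mathcal F_S(\mathcal L)$ is the fusion system over $S$ generated by the conjugation maps $c_g:P\to P^g$, $x\mapsto x^g$, with $P\in\Delta$, $g\in\mathcal L$, $P\subseteq\mathbf D(g)$ and $P^g\subseteq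 S$. Linking localities. A finite group $G$ is of characteristic $p$ if $C_G(O_p(G))\le O_p(G)$. A locality $(\mathcal L,\Delta,S)$ is of objective characteristic $p$ if $N_{\mathcal L}(P)$ is of characteristic $p$ for all $P\in\Delta$. For a fusion system $\mathcal F$ over $S$, $P\le S$ is centric if $C_S(Q)\le Q$ for all $\mathcal F$-conjugates $Q$ of $P$, and radical if $O_p(\mathrm{Aut}_{\mathcal F}(P))=\mathrm{Inn}(P)$; $\mathcal F^{cr}$ is the set of centric radical subgroups. $(\mathcal L,\Delta,S)$ is a linking locality if $\mathcal F_S(\mathcal L)^{cr}\subseteq\Delta$ and it is of objective characteristic $p$. External direct product. For partial groups $\mathcal L_1,\mathcal L_2$ with products $\Pi_i:\mathbf D_i\to\mathcal L_i$, the external direct product $\mathcal L=\mathcal L_1\times\mathcal L_2$ is the set of pairs; for $u=((f_1,g_1),\dots,(f_n,g_n))\in\mathbf W(\mathcal L)$ put $u_1=(f_1,\dots,f_n)$, $u_2=(g_1,\dots,g_n)$; then $\mathbf D=\{u:u_1\in\mathbf D_1,u_2\in\mathbf D_2\}$, $\Pi(u)=(\Pi_1(u_1),\Pi_2(u_2))$, $(f,g)^{-1}=(f^{-1},g^{-1})$. This is a partial group. For localities $(\mathcal L_i,\Delta_i,S_i)$, $\Delta_1*\Delta_2$ is the set of subgroups of $S_1\times S_2$ containing a subgroup of the form $P_1\times P_2$ with $P_i\in\Delta_i$ for $i=1,2$. *)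

theory Defs
  imports "HOL-Algebra.Generated_Groups" "HOL-Algebra.Bij" "HOL-Computational_Algebra.Primes"
begin

section \<open>Partial groups\<close>

text \<open>Words are lists. The fields \<open>pinv\<close> and \<open>pprod\<close> are total HOL functions, whose values matter
  only on \<open>carrier L\<close> and on \<open>pdom L\<close>, respectively.\<close>

record 'a partial_group = "'a partial_object" +
  pinv :: "'a \<Rightarrow> 'a"
  pdom :: "'a list set"
  pprod :: "'a list \<Rightarrow> 'a"

definition winv :: "('a, 'm) partial_group_scheme \<Rightarrow> 'a list \<Rightarrow> 'a list" where
  "winv L w = rev (map (pinv L) w)"

locale partial_group =
  fixes L :: "('a, 'm) partial_group_scheme"
  assumes nonempty: "carrier L \<noteq> {}"
    and inv_closed: "f \<in> carrier L \<Longrightarrow> pinv L f \<in> carrier L"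
    and inv_inv: "f \<in> carrier L \<Longrightarrow> pinv L (pinv L f) = f"
    and dom_words: "pdom L \<subseteq> lists (carrier L)"
    and prod_closed: "w \<in> pdom L \<Longrightarrow> pprod L w \<in> carrier L"
    and single_dom: "f \<in> carrier L \<Longrightarrow> [f] \<in> pdom L"
    and dom_append: "u @ v \<in> pdom L \<Longrightarrow> u \<in> pdom L \<and> v \<in> pdom L"
    and prod_single: "f \<in> carrier L \<Longrightarrow> pprod L [f] = f"
    and assoc_dom: "u @ v @ w \<in> pdom L \<Longrightarrow> u @ [pprod L v] @ w \<in> pdom L"
    and assoc_prod: "u @ v @ w \<in> pdom L \<Longrightarrow> pprod L (u @ v @ w) = pprod L (u @ [pprod L v] @ w)"
    and winv_dom: "w \<in> pdom L \<Longrightarrow> winv L w @ w \<in> pdom L"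
    and winv_prod: "w \<in> pdom L \<Longrightarrow> pprod L (winv L w @ w) = pprod L []"

definition partial_subgroup :: "('a, 'm) partial_group_scheme \<Rightarrow> 'a set \<Rightarrow> bool" where
  "partial_subgroup L H \<longleftrightarrow>
     H \<subseteq> carrier L \<and> (\<forall>h\<in>H. pinv L h \<in> H) \<and> (\<forall>w \<in> lists H \<inter> pdom L. pprod L w \<in> H)"

definition pg_subgroup :: "('a, 'm) partial_group_scheme \<Rightarrow> 'a set \<Rightarrow> bool" where
  "pg_subgroup L H \<longleftrightarrow> partial_subgroup L H \<and> lists H \<subseteq> pdom L"

text \<open>For prime \<open>p\<close> the cardinality condition forces finiteness, since infinite sets have
  cardinality \<open>0\<close>.\<close>

definition pg_p_subgroup :: "nat \<Rightarrow> ('a, 'm) partial_group_scheme \<Rightarrow> 'a set \<Rightarrow> bool" where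
  "pg_p_subgroup p L H \<longleftrightarrow> pg_subgroup L H \<and> (\<exists>n. card H = p ^ n)"

definition group_of :: "('a, 'm) partial_group_scheme \<Rightarrow> 'a set \<Rightarrow> 'a monoid" where
  "group_of L H = \<lparr>carrier = H, monoid.mult = (\<lambda>x y. pprod L [x, y]), one = pprod L []\<rparr>"

definition conj_dom :: "('a, 'm) partial_group_scheme \<Rightarrow> 'a \<Rightarrow> 'a set" where
  "conj_dom L g = {x \<in> carrier L. [pinv L g, x, g] \<in> pdom L}"

definition pconj :: "('a, 'm) partial_group_scheme \<Rightarrow> 'a \<Rightarrow> 'a \<Rightarrow> 'a" where
  "pconj L g x = pprod L [pinv L g, x, g]"

definition pg_normalizer :: "('a, 'm) partial_group_scheme \<Rightarrow> 'a set \<Rightarrow> 'a set" where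
  "pg_normalizer L X = {g \<in> carrier L. X \<subseteq> conj_dom L g \<and> pconj L g ` X = X}"


section \<open>Localities\<close>

definition dom_of_objects :: "('a, 'm) partial_group_scheme \<Rightarrow> 'a set set \<Rightarrow> 'a list set" where
  "dom_of_objects L \<Delta> = {w \<in> lists (carrier L).
     \<exists>Ps. length Ps = Suc (length w) \<and> set Ps \<subseteq> \<Delta> \<and>
       (\<forall>i<length w. Ps ! i \<subseteq> conj_dom L (w ! i) \<and> pconj L (w ! i) ` (Ps ! i) = Ps ! Suc i)}"

locale locality = partial_group L
  for p :: nat and L :: "('a, 'm) partial_group_scheme" and \<Delta> :: "'a set set" and S :: "'a set" +
  assumes finite_carrier: "finite (carrier L)"
    and S_p_subgroup: "pg_p_subgroup p L S"
    and objects_nonempty: "\<Delta> \<noteq> {}"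
    and objects_subgroups: "P \<in> \<Delta> \<Longrightarrow> pg_subgroup L P \<and> P \<subseteq> S"
    and S_maximal: "pg_p_subgroup p L T \<Longrightarrow> S \<subseteq> T \<Longrightarrow> T = S"
    and dom_eq: "pdom L = dom_of_objects L \<Delta>"
    and objects_closed: "\<lbrakk>pg_subgroup L Q; Q \<subseteq> S; P \<in> \<Delta>; g \<in> carrier L; P \<subseteq> conj_dom L g;
          pg_subgroup L (pconj L g ` P); pconj L g ` P \<subseteq> Q\<rbrakk> \<Longrightarrow> Q \<in> \<Delta>"


section \<open>Finite groups of characteristic p\<close>

definition centralizer :: "('a, 'm) monoid_scheme \<Rightarrow> 'a set \<Rightarrow> 'a set" where
  "centralizer G X = {g \<in> carrier G. \<forall>x\<in>X. g \<otimes>\<^bsub>G\<^esub> x = x \<otimes>\<^bsub>G\<^esub> g}"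

text \<open>The largest normal \<open>p\<close>-subgroup of a finite group \<open>G\<close>, as the join of all of them.\<close>

definition p_core :: "nat \<Rightarrow> ('a, 'm) monoid_scheme \<Rightarrow> 'a set" where
  "p_core p G = generate G (\<Union>{N. N \<lhd> G \<and> (\<exists>n. card N = p ^ n)})"

definition characteristic_p :: "nat \<Rightarrow> ('a, 'm) monoid_scheme \<Rightarrow> bool" where
  "characteristic_p p G \<longleftrightarrow> centralizer G (p_core p G) \<subseteq> p_core p G"


section \<open>Fusion systems\<close>

text \<open>A category on the subgroups of a finite \<open>p\<close>-group \<open>G\<close> is encoded by its morphism sets
  \<open>F P Q\<close>, morphisms being extensional functions on \<open>P\<close>. Conjugation is from the right,
  \<open>x\<^sup>g = g\<^sup>-\<^sup>1 x g\<close>, as in partial groups.\<close>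

type_synonym 'a hom_sets = "'a set \<Rightarrow> 'a set \<Rightarrow> ('a \<Rightarrow> 'a) set"

definition conj_map :: "('a, 'm) monoid_scheme \<Rightarrow> 'a set \<Rightarrow> 'a \<Rightarrow> 'a \<Rightarrow> 'a" where
  "conj_map G P g = (\<lambda>x\<in>P. inv\<^bsub>G\<^esub> g \<otimes>\<^bsub>G\<^esub> x \<otimes>\<^bsub>G\<^esub> g)"

definition conj_homs :: "('a, 'm) monoid_scheme \<Rightarrow> 'a hom_sets" where
  "conj_homs G P Q = {conj_map G P g | g. g \<in> carrier G \<and> conj_map G P g ` P \<subseteq> Q}"

definition inj_homs :: "('a, 'm) monoid_scheme \<Rightarrow> 'a hom_sets" where
  "inj_homs G P Q = mon (G\<lparr>carrier := P\<rparr>) (G\<lparr>carrier := Q\<rparr>) \<inter> extensional P"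

text \<open>The last condition says that each morphism is an isomorphism of the category followed by
  an inclusion.\<close>

definition fusion_system :: "('a, 'm) monoid_scheme \<Rightarrow> 'a hom_sets \<Rightarrow> bool" where
  "fusion_system G F \<longleftrightarrow>
     (\<forall>P Q. F P Q \<noteq> {} \<longrightarrow> subgroup P G \<and> subgroup Q G) \<and>
     (\<forall>P Q. subgroup P G \<longrightarrow> subgroup Q G \<longrightarrow> conj_homs G P Q \<subseteq> F P Q \<and> F P Q \<subseteq> inj_homs G P Q) \<and>
     (\<forall>P Q R. \<forall>\<phi> \<in> F P Q. \<forall>\<psi> \<in> F Q R. compose P \<psi> \<phi> \<in> F P R) \<and>
     (\<forall>P Q. \<forall>\<phi> \<in> F P Q. \<phi> \<in> F P (\<phi> ` P) \<and> restrict (inv_into P \<phi>) (\<phi> ` P) \<in> F (\<phi> ` P) P)"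

definition locality_fusion :: "('a, 'm) partial_group_scheme \<Rightarrow> 'a set set \<Rightarrow> 'a set \<Rightarrow> 'a hom_sets" where
  "locality_fusion L \<Delta> S P Q = \<Inter>{F P Q | F.
     fusion_system (group_of L S) F \<and>
     (\<forall>R\<in>\<Delta>. \<forall>g\<in>carrier L. R \<subseteq> conj_dom L g \<and> pconj L g ` R \<subseteq> S
        \<longrightarrow> restrict (pconj L g) R \<in> F R (pconj L g ` R))}"

definition conjugates :: "'a hom_sets \<Rightarrow> 'a set \<Rightarrow> 'a set set" where
  "conjugates F P = {Q. \<exists>\<phi> \<in> F P Q. \<phi> ` P = Q}"

definition centric :: "('a, 'm) monoid_scheme \<Rightarrow> 'a hom_sets \<Rightarrow> 'a set \<Rightarrow> bool" where
  "centric G F P \<longleftrightarrow> subgroup P G \<and> (\<forall>Q \<in> conjugates F P. centralizer G Q \<subseteq> Q)"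

text \<open>Morphism sets being extensional, \<open>F P P\<close> is a set of elements of \<open>BijGroup P\<close>, whose product
  is composition.\<close>

definition Aut_group :: "'a hom_sets \<Rightarrow> 'a set \<Rightarrow> ('a \<Rightarrow> 'a) monoid" where
  "Aut_group F P = BijGroup P\<lparr>carrier := F P P\<rparr>"

definition Inn :: "('a, 'm) monoid_scheme \<Rightarrow> 'a set \<Rightarrow> ('a \<Rightarrow> 'a) set" where
  "Inn G P = conj_map G P ` P"

definition radical :: "nat \<Rightarrow> ('a, 'm) monoid_scheme \<Rightarrow> 'a hom_sets \<Rightarrow> 'a set \<Rightarrow> bool" where
  "radical p G F P \<longleftrightarrow> subgroup P G \<and> p_core p (Aut_group F P) = Inn G P"

definition centric_radicals :: "nat \<Rightarrow> ('a, 'm) monoid_scheme \<Rightarrow> 'a hom_sets \<Rightarrow> 'a set set" where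
  "centric_radicals p G F = {P. centric G F P \<and> radical p G F P}"


section \<open>Linking localities\<close>

definition objective_char_p :: "nat \<Rightarrow> ('a, 'm) partial_group_scheme \<Rightarrow> 'a set set \<Rightarrow> bool" where
  "objective_char_p p L \<Delta> \<longleftrightarrow> (\<forall>P\<in>\<Delta>. characteristic_p p (group_of L (pg_normalizer L P)))"

definition linking_locality ::
    "nat \<Rightarrow> ('a, 'm) partial_group_scheme \<Rightarrow> 'a set set \<Rightarrow> 'a set \<Rightarrow> bool" where
  "linking_locality p L \<Delta> S \<longleftrightarrow>
     locality p L \<Delta> S \<and>
     centric_radicals p (group_of L S) (locality_fusion L \<Delta> S) \<subseteq> \<Delta> \<and>
     objective_char_p p L \<Delta>"


section \<open>External direct products\<close>

definition pg_prod ::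
    "('a, 'm) partial_group_scheme \<Rightarrow> ('b, 'n) partial_group_scheme \<Rightarrow> ('a \<times> 'b) partial_group" where
  "pg_prod L1 L2 =
     \<lparr>carrier = carrier L1 \<times> carrier L2,
      pinv = map_prod (pinv L1) (pinv L2),
      pdom = {u. map fst u \<in> pdom L1 \<and> map snd u \<in> pdom L2},
      pprod = (\<lambda>u. (pprod L1 (map fst u), pprod L2 (map snd u)))\<rparr>"

text \<open>The objects \<open>\<Delta>\<^sub>1 * \<Delta>\<^sub>2\<close> of the external direct product of two localities.\<close>

definition prod_objects ::
    "('a, 'm) partial_group_scheme \<Rightarrow> 'a set set \<Rightarrow> 'a set \<Rightarrow>
     ('b, 'n) partial_group_scheme \<Rightarrow> 'b set set \<Rightarrow> 'b set \<Rightarrow> ('a \<times> 'b) set set" where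
  "prod_objects L1 \<Delta>1 S1 L2 \<Delta>2 S2 =
     {Q. pg_subgroup (pg_prod L1 L2) Q \<and> Q \<subseteq> S1 \<times> S2 \<and> (\<exists>P1\<in>\<Delta>1. \<exists>P2\<in>\<Delta>2. P1 \<times> P2 \<subseteq> Q)}"

end

theory Submission
  imports Defs "HOL-Algebra.Sylow" "HOL-Algebra.Group_Action" "HOL-Algebra.Multiplicative_Group"
    "HOL-Algebra.SndIsomorphismGrp"
begin

text \<open>The fusion system of the product is the product fusion system: the morphisms \<open>P \<rightarrow> Q\<close> are the
  restrictions of pairs \<open>\<phi>\<^sub>1 \<times> \<phi>\<^sub>2\<close> with \<open>\<phi>\<^sub>i\<close> a morphism between the projections of \<open>P\<close> and \<open>Q\<close>.
  If \<open>P\<close> with projections \<open>P\<^sub>1\<close>, \<open>P\<^sub>2\<close> is centric radical, then the normalizer of \<open>P\<close> in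
  \<open>P\<^sub>1 \<times> P\<^sub>2\<close> induces a normal p-subgroup of \<open>Aut(P)\<close>, hence only inner automorphisms, so that it is
  contained in \<open>P\<close>; as normalizers grow in p-groups, \<open>P = P\<^sub>1 \<times> P\<^sub>2\<close>. For such products, being centric
  radical can be checked componentwise. The converse inclusion uses that \<open>S\<^sub>i\<close> itself is centric
  radical.

  For the characteristic, \<open>N(P)\<close> embeds into \<open>N(P\<^sub>1) \<times> N(P\<^sub>2)\<close>. An element \<open>x\<close> of order prime to \<open>p\<close>
  centralizing \<open>O\<^sub>p(N(P))\<close> has components \<open>x\<^sub>i\<close> that centralize \<open>P\<^sub>i\<close> and its centralizer in
  \<open>Q\<^sub>i = O\<^sub>p(N(P\<^sub>i))\<close>, and a special case of Thompson's \<open>A \<times> B\<close> lemma shows that \<open>x\<^sub>i\<close> centralizes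
  \<open>Q\<^sub>i\<close>, so \<open>x = 1\<close>.\<close>

section \<open>Finite p-groups\<close>

lemma prime_power_natI:
  fixes n p :: nat
  assumes p: "prime p" and pos: "n > 0" and q: "\<And>q. prime q \<Longrightarrow> q dvd n \<Longrightarrow> q = p"
  shows "\<exists>k. n = p ^ k"
proof -
  obtain m where m: "n = p ^ multiplicity p n * m" "\<not> p dvd m"
    using multiplicity_decompose'[of n p] pos p by (metis not_prime_unit neq0_conv)
  then have "m = 1" using q prime_factor_nat by (metis dvd_mult)
  then show ?thesis using m(1) by auto
qed

lemma (in group) prime_power_card_iff:
  assumes fin: "finite (carrier G)" and p: "prime p" and H: "subgroup H G"
  shows "(\<exists>n. card H = p ^ n) \<longleftrightarrow> (\<forall>h\<in>H. \<exists>k::nat. h [^] (p ^ k) = \<one>)"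
proof
  interpret H: group "G\<lparr>carrier := H\<rparr>" using H by (rule subgroup_imp_group)
  assume "\<exists>n. card H = p ^ n"
  then obtain n where "card H = p ^ n" by blast
  then have "h [^] (p ^ n) = \<one>" if "h \<in> H" for h
    using H.pow_order_eq_1[of h] that by (simp add: order_def flip: nat_pow_consistent)
  then show "\<forall>h\<in>H. \<exists>k::nat. h [^] (p ^ k) = \<one>" by blast
next
  interpret H: group "G\<lparr>carrier := H\<rparr>" using H by (rule subgroup_imp_group)
  assume el: "\<forall>h\<in>H. \<exists>k::nat. h [^] (p ^ k) = \<one>"
  have finH: "finite H" using fin H finite_subset subgroup.subset by blast
  have pos: "card H > 0" using H fin by (rule subgroup.finite_imp_card_positive)
  have "q = p" if q: "prime q" "q dvd card H" for q
  proof (rule ccontr)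
    assume "q \<noteq> p"
    obtain m where "card H = q ^ 1 * m" using q(2) by auto
    then have "order (G\<lparr>carrier := H\<rparr>) = q ^ 1 * m" by (simp add: order_def)
    from sylow_thm[OF q(1) H.is_group this] obtain K where
      K: "subgroup K (G\<lparr>carrier := H\<rparr>)" "card K = q" using finH by auto
    have KG: "subgroup K G" using K(1) H incl_subgroup by blast
    have "K \<noteq> {\<one>}" using K(2) q(1) not_prime_1 by auto
    then obtain x where x: "x \<in> K" "x \<noteq> \<one>" using subgroup.one_closed[OF KG] by blast
    have xG: "x \<in> carrier G" and xH: "x \<in> H"
      using x KG subgroup.subset K(1) by fastforce+
    interpret K: group "G\<lparr>carrier := K\<rparr>" using KG by (rule subgroup_imp_group)
    have "x [^] q = \<one>"
      using K.pow_order_eq_1[of x] x(1) K(2) nat_pow_consistent by (simp add: order_def)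
    moreover obtain k :: nat where "x [^] (p ^ k) = \<one>" using el xH by blast
    ultimately have "ord x dvd q" "ord x dvd p ^ k" using xG by (simp_all add: pow_eq_id)
    moreover have "coprime q (p ^ k)"
      using q(1) p \<open>q \<noteq> p\<close> by (simp add: primes_coprime)
    ultimately have "ord x = 1" by (metis coprime_common_divisor_nat)
    then show False using xG x(2) ord_eq_1 by blast
  qed
  then show "\<exists>n. card H = p ^ n"
    using p pos by (intro prime_power_natI)
qed

lemma (in group) prime_power_card_subgroup:
  assumes "finite (carrier G)" "prime p" "subgroup H G" "subgroup K G" "K \<subseteq> H" "card H = p ^ n"
  shows "\<exists>n. card K = p ^ n"
  using prime_power_card_iff[OF assms(1-3)] prime_power_card_iff[OF assms(1,2,4)] assms(5,6) by blast

lemma prime_power_card_hom_image: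
  assumes "group G" "group H" "f \<in> hom G H" "finite (carrier G)" "finite (carrier H)" "prime p"
    and K: "subgroup K G" "card K = p ^ n"
  shows "\<exists>n. card (f ` K) = p ^ n"
proof -
  interpret f: group_hom G H f
    using assms(1-3) by (simp add: group_hom_def group_hom_axioms_def)
  have "\<forall>h\<in>K. \<exists>k::nat. h [^]\<^bsub>G\<^esub> (p ^ k) = \<one>\<^bsub>G\<^esub>"
    using f.G.prime_power_card_iff[OF assms(4,6) K(1)] K(2) by blast
  then have "\<forall>h\<in>f ` K. \<exists>k::nat. h [^]\<^bsub>H\<^esub> (p ^ k) = \<one>\<^bsub>H\<^esub>"
    using subgroup.subset[OF K(1)] by (metis (no_types, lifting) f.hom_nat_pow f.hom_one imageE subsetD)
  then show ?thesis
    using f.H.prime_power_card_iff[OF assms(5,6) f.subgroup_img_is_subgroup[OF K(1)]] by blast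
qed

lemma (in group) prime_power_card_set_mult:
  assumes fin: "finite (carrier G)" and p: "prime p" and N: "N \<lhd> G" "card N = p ^ m"
    and H: "subgroup H G" "card H = p ^ n"
  shows "subgroup (N <#> H) G \<and> (\<exists>n. card (N <#> H) = p ^ n)"
proof
  interpret second_isomorphism_grp N G H
    using N(1) H(1) by (simp add: second_isomorphism_grp_def second_isomorphism_grp_axioms_def)
  show NH: "subgroup (N <#> H) G" by (rule normal_set_mult_subgroup)
  have "\<exists>k::nat. g [^] (p ^ k) = \<one>" if g: "g \<in> N <#> H" for g
  proof -
    obtain x h where xh: "x \<in> N" "h \<in> H" "g = x \<otimes> h" using g by (auto simp: set_mult_def)
    have [simp]: "x \<in> carrier G" "h \<in> carrier G"
      using xh H(1) subgroup.mem_carrier by (fastforce simp: mem_carrier)+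
    have "\<exists>y\<in>N. g [^] k = y \<otimes> h [^] k" for k :: nat
    proof (induction k)
      case 0
      then show ?case using one_closed by auto
    next
      case (Suc k)
      then obtain y where y: "y \<in> N" "g [^] k = y \<otimes> h [^] k" by blast
      have c: "h [^] k \<otimes> x \<otimes> inv (h [^] k) \<in> N"
        using xh(1) by (intro inv_op_closed2) auto
      have "g [^] Suc k = (y \<otimes> (h [^] k \<otimes> x \<otimes> inv (h [^] k))) \<otimes> h [^] Suc k"
        using y mem_carrier[OF y(1)] xh by (simp add: m_assoc inv_solve_left)
      then show ?case using c y(1) by blast
    qed
    moreover obtain k :: nat where "h [^] (p ^ k) = \<one>"
      using prime_power_card_iff[OF fin p H(1)] H(2) xh(2) by blast
    ultimately obtain y where y: "y \<in> N" "g [^] (p ^ k) = y \<otimes> \<one>" by metis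
    then obtain l :: nat where "y [^] (p ^ l) = \<one>"
      using prime_power_card_iff[OF fin p is_subgroup] N(2) by blast
    then have "g [^] (p ^ (k + l)) = \<one>"
      using y mem_carrier[OF y(1)] xh(3) by (simp add: power_add flip: nat_pow_pow)
    then show ?thesis by blast
  qed
  then show "\<exists>n. card (N <#> H) = p ^ n"
    using prime_power_card_iff[OF fin p NH] by blast
qed

lemma (in group_action) p_group_second_fixed_point:
  assumes p: "prime p" and G: "order G = p ^ n" and E: "finite E" "p dvd card E"
    and e: "e \<in> E" "\<And>g. g \<in> carrier G \<Longrightarrow> \<phi> g e = e"
  shows "\<exists>e'\<in>E - {e}. \<forall>g\<in>carrier G. \<phi> g e' = e'"
proof (rule ccontr)
  assume neg: "\<not> ?thesis"
  interpret group G using group_hom by (simp add: group_hom_def)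
  have orb_e: "orbit G \<phi> e = {e}"
    unfolding orbit_def using e(2) one_closed by (auto intro!: exI[of _ "\<one>"])
  have "p dvd card (\<Union>(orbits G E \<phi> - {{e}}))"
  proof (rule dvd_partition)
    have "\<Union>(orbits G E \<phi> - {{e}}) \<subseteq> E" using orbits_coverture by blast
    then show "finite (\<Union>(orbits G E \<phi> - {{e}}))" using E(1) finite_subset by blast
    show "\<forall>c1\<in>orbits G E \<phi> - {{e}}. \<forall>c2\<in>orbits G E \<phi> - {{e}}. c1 \<noteq> c2 \<longrightarrow> c1 \<inter> c2 = {}"
      using disjoint_union by blast
    show "\<forall>c\<in>orbits G E \<phi> - {{e}}. p dvd card c"
    proof
      fix c assume c: "c \<in> orbits G E \<phi> - {{e}}"
      then obtain x where x: "x \<in> E" "c = orbit G \<phi> x" by (auto simp: orbits_def)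
      then have xe: "x \<noteq> e" using c orb_e by auto
      have "card c dvd p ^ n" using orbit_stabilizer_theorem[OF x(1)] G x(2) by (metis dvd_triv_left)
      then obtain i where i: "card c = p ^ i" using p divides_primepow_nat by blast
      have "i \<noteq> 0"
      proof
        assume "i = 0"
        then obtain y where "c = {y}" using i by (auto simp: card_1_singleton_iff)
        moreover have "x \<in> c" using x orbit_refl by blast
        ultimately have "orbit G \<phi> x = {x}" using x(2) by auto
        then have "\<forall>g\<in>carrier G. \<phi> g x = x" by (auto simp: orbit_def)
        then show False using neg x(1) xe by blast
      qed
      then show "p dvd card c" using i by simp
    qed
  qed
  moreover have "\<Union>(orbits G E \<phi> - {{e}}) = E - {e}"
  proof -
    have "{e} \<in> orbits G E \<phi>" using e(1) orb_e by (auto simp: orbits_def)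
    then have "\<And>c. c \<in> orbits G E \<phi> - {{e}} \<Longrightarrow> e \<notin> c" using disjoint_union by blast
    then show ?thesis using orbits_coverture by blast
  qed
  ultimately have "p dvd card E - 1" using e(1) E(1) by simp
  moreover have "card E \<ge> 1" using e(1) E(1) by (metis card_0_eq empty_iff not_less_eq_eq One_nat_def le0 le_antisym not_less_eq_eq le_zero_eq)
  ultimately have "p dvd 1" using E(2) by (metis dvd_diffD1)
  then show False using p by (simp add: prime_nat_iff)
qed

lemma (in group) normalizers_grow:
  assumes fin: "finite (carrier G)" and p: "prime p" and Q: "subgroup Q G" "card Q = p ^ n"
    and P: "subgroup P G" "P \<subset> Q"
  shows "\<exists>x\<in>Q - P. (\<lambda>y. inv x \<otimes> y \<otimes> x) ` P = P"
proof -
  interpret Q: group "G\<lparr>carrier := Q\<rparr>" using Q(1) by (rule subgroup_imp_group)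
  let ?E = "rcosets\<^bsub>G\<lparr>carrier := Q\<rparr>\<^esub> P"
  define \<phi> where "\<phi> = (\<lambda>g. \<lambda>C\<in>?E. C #> inv g)"
  have PQ: "subgroup P (G\<lparr>carrier := Q\<rparr>)" using P Q(1) by (simp add: subgroup_incl)
  have finQ: "finite Q" using fin Q(1) finite_subset subgroup.subset by blast
  have E: "?E = {P #> x |x. x \<in> Q}" by (auto simp: RCOSETS_def r_coset_def)
  have [simp]: "x \<in> carrier G" if "x \<in> Q" for x using that Q(1) subgroup.mem_carrier by fastforce
  have [simp]: "x \<in> carrier G" if "x \<in> P" for x using that P(1) subgroup.mem_carrier by fastforce
  have Psub: "P \<subseteq> carrier G" using P(1) subgroup.subset by blast
  have shift: "(P #> x) #> inv g = P #> (x \<otimes> inv g)" if "x \<in> Q" "g \<in> P" for x g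
    using that Psub by (simp add: coset_mult_assoc)
  have mem: "x \<otimes> inv g \<in> Q" if "x \<in> Q" "g \<in> P" for x g
    using that P Q(1) by (meson psubsetD subgroup.m_closed subgroup.m_inv_closed)
  have closed: "C #> inv g \<in> ?E" if "C \<in> ?E" "g \<in> P" for C g
    using that shift mem unfolding E by blast
  have inv_mem: "inv g \<in> P" if "g \<in> P" for g using that P(1) subgroup.m_inv_closed by fast
  have closed': "C #> g \<in> ?E" if "C \<in> ?E" "g \<in> P" for C g
    using closed[OF that(1) inv_mem[OF that(2)]] that(2) by simp
  have sub: "C \<subseteq> carrier G" if "C \<in> ?E" for C
    using that r_coset_subset_G[OF Psub] Q(1)[THEN subgroup.subset] unfolding E by blast
  have cancel: "(C #> inv g) #> g = C" "(C #> g) #> inv g = C" if "C \<in> ?E" "g \<in> P" for C g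
    using that sub by (simp_all add: coset_mult_assoc)
  have Bij: "\<phi> g \<in> Bij ?E" if g: "g \<in> P" for g
  proof -
    have "bij_betw (\<phi> g) ?E ?E"
      by (rule bij_betw_byWitness[where f' = "\<phi> (inv g)"])
        (use g in \<open>auto simp: \<phi>_def closed closed' cancel inv_mem\<close>)
    then show ?thesis by (simp add: Bij_def \<phi>_def)
  qed
  have "\<phi> \<in> hom (G\<lparr>carrier := P\<rparr>) (BijGroup ?E)"
  proof (rule homI)
    fix g h assume g: "g \<in> carrier (G\<lparr>carrier := P\<rparr>)" and h: "h \<in> carrier (G\<lparr>carrier := P\<rparr>)"
    have "\<phi> (g \<otimes> h) = compose ?E (\<phi> g) (\<phi> h)"
    proof
      fix C show "\<phi> (g \<otimes> h) C = compose ?E (\<phi> g) (\<phi> h) C"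
        using g h by (cases "C \<in> ?E") (auto simp: \<phi>_def compose_def closed sub coset_mult_assoc inv_mult_group)
    qed
    then show "\<phi> (g \<otimes>\<^bsub>G\<lparr>carrier := P\<rparr>\<^esub> h) = \<phi> g \<otimes>\<^bsub>BijGroup ?E\<^esub> \<phi> h"
      using g h Bij by (simp add: BijGroup_def)
  qed (simp add: BijGroup_def Bij)
  then interpret group_action "G\<lparr>carrier := P\<rparr>" ?E \<phi>
    using subgroup_imp_group[OF P(1)] group_BijGroup
    by (simp add: group_action_def group_hom_def group_hom_axioms_def)
  have lag: "card ?E * card P = p ^ n" using Q.lagrange[OF PQ] Q(2) by (simp add: order_def)
  then obtain i where i: "card ?E = p ^ i" using p by (metis divides_primepow_nat dvd_triv_left)
  obtain m where m: "card P = p ^ m" using lag p by (metis divides_primepow_nat dvd_triv_right)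
  have "i \<noteq> 0"
  proof
    assume "i = 0"
    then have "card P = card Q" using lag i Q(2) by simp
    then show False using P(2) finQ by (metis psubset_card_mono less_irrefl)
  qed
  then have dvd: "p dvd card ?E" using i by simp
  have finE: "finite ?E" using dvd i p by (metis card.infinite gr0I not_prime_0 power_not_zero)
  have PE: "P \<in> ?E" unfolding E using Q(1) Psub by (metis (mono_tags, lifting) coset_mult_one mem_Collect_eq subgroup.one_closed)
  have fixP: "\<phi> g P = P" if "g \<in> P" for g
    using that PE P(1) by (simp add: \<phi>_def coset_join2 inv_mem)
  have ordP: "order (G\<lparr>carrier := P\<rparr>) = p ^ m" using m by (simp add: order_def)
  obtain C where C: "C \<in> ?E - {P}" "\<forall>g\<in>P. \<phi> g C = C"
    using p_group_second_fixed_point[OF p ordP finE dvd PE] fixP by auto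
  then obtain x where x: "x \<in> Q" "C = P #> x" unfolding E by blast
  have xP: "x \<notin> P" using C(1) x coset_join2[of x P] P(1) by auto
  have conj: "x \<otimes> g \<otimes> inv x \<in> P" if g: "g \<in> P" for g
  proof -
    have "P #> (x \<otimes> g) = P #> x"
      using C(2) g x inv_mem[OF g] PE C(1) shift[OF x(1) inv_mem[OF g]] by (auto simp: \<phi>_def)
    then have "P #> (x \<otimes> g \<otimes> inv x) = P"
      using g x Psub by (metis (no_types, lifting) \<open>\<And>x. x \<in> P \<Longrightarrow> x \<in> carrier G\<close> \<open>\<And>x. x \<in> Q \<Longrightarrow> x \<in> carrier G\<close> coset_mult_assoc coset_mult_one inv_closed m_closed r_inv)
    then show ?thesis using coset_join1[of P "x \<otimes> g \<otimes> inv x"] P(1) Psub g x by simp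
  qed
  have finP: "finite P" using finQ P(2) finite_subset by blast
  have "(\<lambda>y. x \<otimes> y \<otimes> inv x) ` P = P"
    by (rule endo_inj_surj[OF finP]) (use conj x in \<open>auto simp: inj_on_def\<close>)
  then have img: "(\<lambda>y. inv (inv x) \<otimes> y \<otimes> inv x) ` P = P" using x(1) by simp
  have "inv x \<in> Q - P"
    using x xP Q(1) by (metis Diff_iff \<open>\<And>x. x \<in> Q \<Longrightarrow> x \<in> carrier G\<close> inv_inv inv_mem subgroup.m_inv_closed)
  then show ?thesis using img by blast
qed

section \<open>The largest normal p-subgroup and groups of characteristic p\<close>

lemma (in group) inv_mult_cancel:
  assumes "x \<in> carrier G" "y \<in> carrier G"
  shows "inv x \<otimes> (x \<otimes> y) = y" "x \<otimes> (inv x \<otimes> y) = y"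
  using assms by (simp_all flip: m_assoc)

lemma (in group) inv_commute:
  assumes "a \<otimes> t = t \<otimes> a" "a \<in> carrier G" "t \<in> carrier G"
  shows "inv a \<otimes> t = t \<otimes> inv a"
proof -
  have "inv a \<otimes> (a \<otimes> t) \<otimes> inv a = inv a \<otimes> (t \<otimes> a) \<otimes> inv a" using assms(1) by simp
  then show ?thesis using assms(2,3) by (simp add: m_assoc inv_mult_cancel)
qed

lemma normal_surj_image:
  assumes "group G" "group H" "f \<in> hom G H" "f ` carrier G = carrier H" "N \<lhd> G"
  shows "f ` N \<lhd> H"
proof -
  interpret f: group_hom G H f
    using assms(1-3) by (simp add: group_hom_def group_hom_axioms_def)
  interpret N: normal N G by fact
  show ?thesis
  proof (rule f.H.normal_invI)
    show "subgroup (f ` N) H" by (rule f.subgroup_img_is_subgroup[OF N.is_subgroup])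
    fix x h assume x: "x \<in> carrier H" and h: "h \<in> f ` N"
    then obtain y n where "y \<in> carrier G" "x = f y" "n \<in> N" "h = f n" using assms(4) by blast
    moreover from this have "x \<otimes>\<^bsub>H\<^esub> h \<otimes>\<^bsub>H\<^esub> inv\<^bsub>H\<^esub> x = f (y \<otimes>\<^bsub>G\<^esub> n \<otimes>\<^bsub>G\<^esub> inv\<^bsub>G\<^esub> y)"
      by simp
    ultimately show "x \<otimes>\<^bsub>H\<^esub> h \<otimes>\<^bsub>H\<^esub> inv\<^bsub>H\<^esub> x \<in> f ` N" using N.inv_op_closed2 by blast
  qed
qed

lemma (in group) normal_p_subset_p_core:
  assumes "N \<lhd> G" "card N = p ^ n"
  shows "N \<subseteq> p_core p G"
  unfolding p_core_def using assms by (auto intro: generate.incl)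

lemma (in group) p_core_normal_p:
  assumes fin: "finite (carrier G)" and p: "prime p"
  shows "p_core p G \<lhd> G \<and> (\<exists>n. card (p_core p G) = p ^ n)"
proof -
  define A where "A = {N. N \<lhd> G \<and> (\<exists>n. card N = p ^ n)}"
  have "\<exists>N. N \<in> A \<and> (\<forall>M. M \<in> A \<longrightarrow> card M \<le> card N)"
  proof (rule ex_has_greatest_nat)
    show "{\<one>} \<in> A" using one_is_normal by (auto simp: A_def intro: exI[of _ 0])
    show "\<forall>N. N \<in> A \<longrightarrow> card N < Suc (card (carrier G))"
      using fin by (auto simp: A_def less_Suc_eq_le intro!: card_mono dest!: normal_imp_subgroup subgroup.subset)
  qed
  then obtain N where N: "N \<in> A" "\<And>M. M \<in> A \<Longrightarrow> card M \<le> card N" by blast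
  interpret N: normal N G using N(1) by (simp add: A_def)
  obtain a where a: "card N = p ^ a" using N(1) by (auto simp: A_def)
  have "M \<subseteq> N" if M: "M \<in> A" for M
  proof -
    interpret M: normal M G using M by (simp add: A_def)
    obtain b where b: "card M = p ^ b" using M by (auto simp: A_def)
    have NM: "subgroup (N <#> M) G" "\<exists>n. card (N <#> M) = p ^ n"
      using prime_power_card_set_mult[OF fin p N.normal_axioms a M.is_subgroup b] by blast+
    have "N <#> M \<lhd> G"
    proof (rule normal_invI[OF NM(1)])
      fix x h assume x: "x \<in> carrier G" and "h \<in> N <#> M"
      then obtain y z where yz: "y \<in> N" "z \<in> M" "h = y \<otimes> z" by (auto simp: set_mult_def)
      then have "x \<otimes> h \<otimes> inv x = (x \<otimes> y \<otimes> inv x) \<otimes> (x \<otimes> z \<otimes> inv x)"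
        using x N.mem_carrier M.mem_carrier by (simp add: inv_solve_left m_assoc)
      moreover have "x \<otimes> y \<otimes> inv x \<in> N" "x \<otimes> z \<otimes> inv x \<in> M"
        using yz x N.inv_op_closed2 M.inv_op_closed2 by blast+
      ultimately show "x \<otimes> h \<otimes> inv x \<in> N <#> M" unfolding set_mult_def by blast
    qed
    then have *: "card (N <#> M) \<le> card N" using N(2) NM(2) by (simp add: A_def)
    interpret NM: second_isomorphism_grp N G M
      using M.is_subgroup N.normal_axioms by (simp add: second_isomorphism_grp_def second_isomorphism_grp_axioms_def)
    have "finite (N <#> M)" using NM(1) fin finite_subset subgroup.subset by blast
    moreover have "N \<subseteq> N <#> M" by (rule NM.H_contained_in_set_mult)
    ultimately have "N = N <#> M" using * card_seteq[of "N <#> M" N] by simp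
    then show ?thesis using NM.S_contained_in_set_mult by simp
  qed
  then have "\<Union>A = N" using N(1) by blast
  then have "p_core p G = N"
    using generateI[OF N.is_subgroup, of N] by (simp add: p_core_def A_def)
  then show ?thesis using N(1) by (simp add: A_def)
qed

lemma (in group) p_core_eqI:
  assumes fin: "finite (carrier G)" and p: "prime p"
    and "N \<lhd> G" "\<exists>n. card N = p ^ n"
    and "\<And>M n. M \<lhd> G \<Longrightarrow> card M = p ^ n \<Longrightarrow> M \<subseteq> N"
  shows "p_core p G = N"
  using p_core_normal_p[OF fin p] normal_p_subset_p_core assms(3-5) by (metis subset_antisym)

lemma p_core_iso:
  assumes G: "group G" and H: "group H" and fin: "finite (carrier G)" and p: "prime p"
    and f: "f \<in> iso G H"
  shows "p_core p H = f ` p_core p G"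
proof -
  interpret G: group G by fact
  interpret H: group H by fact
  define g where "g = inv_into (carrier G) f"
  have g: "g \<in> iso H G" unfolding g_def using f by (rule G.iso_set_sym)
  have fhom: "f \<in> hom G H" "f ` carrier G = carrier H" "inj_on f (carrier G)"
    and ghom: "g \<in> hom H G" "g ` carrier H = carrier G"
    using f g by (auto simp: iso_iff)
  have finH: "finite (carrier H)" using fin fhom(2) by (metis finite_imageI)
  have core: "p_core p G \<lhd> G" "\<exists>n. card (p_core p G) = p ^ n"
    using G.p_core_normal_p[OF fin p] by auto
  have Hsub: "f (g y) = y" if "y \<in> carrier H" for y
    unfolding g_def using that fhom(2) by (simp add: f_inv_into_f)
  show ?thesis
  proof (rule H.p_core_eqI[OF finH p])
    show "f ` p_core p G \<lhd> H" by (rule normal_surj_image[OF G H fhom(1,2) core(1)])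
    show "\<exists>n. card (f ` p_core p G) = p ^ n"
      using prime_power_card_hom_image[OF G H fhom(1) fin finH p] core normal_imp_subgroup by blast
    fix M n assume M: "M \<lhd> H" "card M = p ^ n"
    have Mc: "M \<subseteq> carrier H" using M(1) normal_imp_subgroup subgroup.subset by blast
    have "g ` M \<subseteq> p_core p G"
      using prime_power_card_hom_image[OF H G ghom(1) finH fin p _ M(2)]
        normal_surj_image[OF H G ghom M(1)] normal_imp_subgroup[OF M(1)] G.normal_p_subset_p_core by blast
    then have "f ` g ` M \<subseteq> f ` p_core p G" by blast
    moreover have "f ` g ` M = M"
      using Mc Hsub by (simp add: image_image subset_iff cong: image_cong)
    ultimately show "M \<subseteq> f ` p_core p G" by simp
  qed
qed

lemma fst_hom_DirProd: "fst \<in> hom (G \<times>\<times> H) G"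
  and snd_hom_DirProd: "snd \<in> hom (G \<times>\<times> H) H"
  by (auto intro!: homI)

lemma p_core_DirProd:
  assumes G: "group G" and H: "group H" and fin: "finite (carrier G)" "finite (carrier H)"
    and p: "prime p"
  shows "p_core p (G \<times>\<times> H) = p_core p G \<times> p_core p H"
proof -
  interpret G: group G by fact
  interpret H: group H by fact
  interpret P: group "G \<times>\<times> H" using G H by (rule DirProd_group)
  have finP: "finite (carrier (G \<times>\<times> H))" using fin by simp
  have surj: "fst ` carrier (G \<times>\<times> H) = carrier G" "snd ` carrier (G \<times>\<times> H) = carrier H"
    using G.one_closed H.one_closed by auto
  have core: "p_core p G \<lhd> G" "p_core p H \<lhd> H"
    "\<exists>n. card (p_core p G) = p ^ n" "\<exists>n. card (p_core p H) = p ^ n"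
    using G.p_core_normal_p[OF fin(1) p] H.p_core_normal_p[OF fin(2) p] by auto
  show ?thesis
  proof (rule P.p_core_eqI[OF finP p])
    show "p_core p G \<times> p_core p H \<lhd> G \<times>\<times> H"
      using G.DirProd_normal[OF H core(1,2)] .
    show "\<exists>n. card (p_core p G \<times> p_core p H) = p ^ n"
      using core(3,4) by (auto simp: card_cartesian_product simp flip: power_add)
    fix M n assume M: "M \<lhd> G \<times>\<times> H" "card M = p ^ n"
    have Ms: "subgroup M (G \<times>\<times> H)" using M(1) normal_imp_subgroup by blast
    have "fst ` M \<subseteq> p_core p G"
      using prime_power_card_hom_image[OF P.is_group G fst_hom_DirProd finP fin(1) p Ms M(2)]
        normal_surj_image[OF P.is_group G fst_hom_DirProd surj(1) M(1)] G.normal_p_subset_p_core by blast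
    moreover have "snd ` M \<subseteq> p_core p H"
      using prime_power_card_hom_image[OF P.is_group H snd_hom_DirProd finP fin(2) p Ms M(2)]
        normal_surj_image[OF P.is_group H snd_hom_DirProd surj(2) M(1)] H.normal_p_subset_p_core by blast
    ultimately show "M \<subseteq> p_core p G \<times> p_core p H" by force
  qed
qed

lemma centralizer_DirProd:
  assumes "A \<noteq> {}" "B \<noteq> {}"
  shows "centralizer (G \<times>\<times> H) (A \<times> B) = centralizer G A \<times> centralizer H B"
  using assms by (fastforce simp: centralizer_def)

lemma characteristic_p_DirProd:
  assumes G: "group G" and H: "group H" and fin: "finite (carrier G)" "finite (carrier H)"
    and p: "prime p"
  shows "characteristic_p p (G \<times>\<times> H) \<longleftrightarrow> characteristic_p p G \<and> characteristic_p p H"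
proof -
  interpret G: group G by fact
  interpret H: group H by fact
  have one: "\<one>\<^bsub>G\<^esub> \<in> p_core p G" "\<one>\<^bsub>H\<^esub> \<in> p_core p H"
    by (simp_all add: p_core_def generate.one)
  have sub: "p_core p G \<subseteq> carrier G" "p_core p H \<subseteq> carrier H"
    using G.p_core_normal_p[OF fin(1) p] H.p_core_normal_p[OF fin(2) p]
      normal_imp_subgroup normal_imp_subgroup subgroup.subset by blast+
  have "\<one>\<^bsub>G\<^esub> \<in> centralizer G (p_core p G)" "\<one>\<^bsub>H\<^esub> \<in> centralizer H (p_core p H)"
    using sub by (auto simp: centralizer_def)
  then show ?thesis
    unfolding characteristic_p_def p_core_DirProd[OF assms]
    using one by (subst centralizer_DirProd) (auto simp: times_subset_iff)
qed

lemma (in group) p_regular_centralizes: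
  assumes fin: "finite (carrier G)" and p: "prime p" and Q: "subgroup Q G" "card Q = p ^ n"
    and x: "x \<in> carrier G" "\<And>q. q \<in> Q \<Longrightarrow> x \<otimes> q \<otimes> inv x \<in> Q" "x [^] (m::nat) = \<one>" "coprime m p"
    and P: "P \<subseteq> Q" "\<And>y. y \<in> P \<Longrightarrow> x \<otimes> y = y \<otimes> x"
    and CP: "\<And>y. y \<in> Q \<Longrightarrow> (\<And>z. z \<in> P \<Longrightarrow> y \<otimes> z = z \<otimes> y) \<Longrightarrow> x \<otimes> y = y \<otimes> x"
    and q: "q \<in> Q"
  shows "x \<otimes> q = q \<otimes> x"
proof -
  define C where "C = {y \<in> Q. x \<otimes> y = y \<otimes> x}"
  have Qc [simp]: "y \<in> carrier G" if "y \<in> Q" for y using that Q(1) subgroup.mem_carrier by fastforce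
  have Cc [simp]: "y \<in> carrier G" if "y \<in> C" for y using that by (simp add: C_def)
  have C: "subgroup C G"
  proof (rule subgroupI)
    show "C \<noteq> {}" using x(1) subgroup.one_closed[OF Q(1)] by (auto simp: C_def)
    fix a assume a: "a \<in> C"
    then have "x \<otimes> inv a = inv a \<otimes> x"
      using x(1) inv_commute[of a x] by (simp add: C_def)
    then show "inv a \<in> C" using a subgroup.m_inv_closed[OF Q(1)] by (auto simp: C_def)
    fix b assume b: "b \<in> C"
    have "x \<otimes> (a \<otimes> b) = a \<otimes> b \<otimes> x"
      using a b x(1) by (simp add: C_def) (metis Qc m_assoc)
    then show "a \<otimes> b \<in> C" using a b subgroup.m_closed[OF Q(1)] by (auto simp: C_def)
  qed (auto simp: C_def)
  have "C = Q"
  proof (rule ccontr)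
    assume "C \<noteq> Q"
    then obtain g where g: "g \<in> Q" "g \<notin> C" "(\<lambda>y. inv g \<otimes> y \<otimes> g) ` C = C"
      using normalizers_grow[OF fin p Q C] by (auto simp: C_def)
    define c where "c = inv g \<otimes> (x \<otimes> g \<otimes> inv x)"
    have cQ: "c \<in> Q" unfolding c_def using g(1) x(2) Q(1) by (simp add: subgroup.m_closed subgroup.m_inv_closed)
    note [simp] = x(1) Qc[OF g(1)] Qc[OF cQ]
    have xg: "x \<otimes> g = g \<otimes> c \<otimes> x" by (simp add: c_def m_assoc inv_mult_cancel)
    have "c \<otimes> y = y \<otimes> c" if y: "y \<in> C" for y
    proof -
      obtain z where z: "z \<in> C" "y = inv g \<otimes> z \<otimes> g" using g(3) y by blast
      have gy: "g \<otimes> y = z \<otimes> g" using z by (simp add: m_assoc inv_mult_cancel)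
      have "g \<otimes> c \<otimes> y \<otimes> x = g \<otimes> c \<otimes> x \<otimes> y" using y by (simp add: C_def m_assoc)
      also have "\<dots> = x \<otimes> (g \<otimes> y)" using y by (simp add: xg flip: m_assoc)
      also have "\<dots> = z \<otimes> (x \<otimes> g)" using z y unfolding gy by (simp add: C_def flip: m_assoc)
      also have "\<dots> = g \<otimes> y \<otimes> c \<otimes> x" using z y by (simp add: xg gy flip: m_assoc)
      finally have "g \<otimes> (c \<otimes> y) \<otimes> x = g \<otimes> (y \<otimes> c) \<otimes> x" using y by (simp add: m_assoc)
      then show ?thesis using y by simp
    qed
    then have xc: "x \<otimes> c = c \<otimes> x" using CP[OF cQ] P by (auto simp: C_def)
    have "x [^] k \<otimes> g = g \<otimes> c [^] k \<otimes> x [^] k" for k :: nat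
    proof (induction k)
      case (Suc k)
      have xck: "x \<otimes> c [^] k = c [^] k \<otimes> x"
        using group_commutes_pow[OF xc[symmetric]] by simp
      have "x [^] Suc k \<otimes> g = x \<otimes> (x [^] k \<otimes> g)" by (simp only: nat_pow_Suc2[OF x(1)]) (simp add: m_assoc)
      also have "\<dots> = (x \<otimes> g) \<otimes> c [^] k \<otimes> x [^] k" by (simp add: Suc m_assoc)
      also have "\<dots> = g \<otimes> c \<otimes> (x \<otimes> c [^] k) \<otimes> x [^] k" by (simp add: xg m_assoc)
      also have "\<dots> = g \<otimes> c [^] Suc k \<otimes> x [^] Suc k"
        unfolding xck by (simp only: nat_pow_Suc2[OF Qc[OF cQ]] nat_pow_Suc2[OF x(1)]) (simp add: m_assoc)
      finally show ?case .
    qed simp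
    from this[of m] have "c [^] m = \<one>" using x(3) by simp
    moreover obtain l :: nat where "c [^] (p ^ l) = \<one>"
      using prime_power_card_iff[OF fin p Q(1)] Q(2) cQ by blast
    ultimately have "ord c dvd m" "ord c dvd p ^ l" by (simp_all add: pow_eq_id)
    then have "ord c = 1" using x(4) by (metis coprime_common_divisor_nat coprime_power_right_iff)
    then have "c = \<one>" using ord_eq_1 by simp
    then show False using xg g by (simp add: C_def)
  qed
  then show ?thesis using q by (auto simp: C_def)
qed

lemma (in group) p_regular_part:
  assumes fin: "finite (carrier G)" and p: "prime p" and h: "h \<in> carrier G"
  obtains a m :: nat where "(h [^] (p ^ a)) [^] m = \<one>" "coprime m p"
proof -
  have "ord h \<noteq> 0" using ord_ge_1[OF fin h] by simp
  then obtain m where m: "ord h = p ^ multiplicity p (ord h) * m" "\<not> p dvd m"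
    using multiplicity_decompose'[of "ord h" p] p by (metis not_prime_unit)
  have "(h [^] (p ^ multiplicity p (ord h))) [^] m = \<one>"
    using h m(1) pow_ord_eq_1[OF h] by (metis nat_pow_pow)
  moreover have "coprime m p" using m(2) p by (metis coprime_commute prime_imp_coprime)
  ultimately show ?thesis using that by blast
qed

lemma (in group) centralizer_normal:
  assumes "T \<lhd> G"
  shows "centralizer G T \<lhd> G"
proof -
  interpret T: normal T G by fact
  have sub: "subgroup (centralizer G T) G"
  proof (rule subgroupI)
    fix a assume a: "a \<in> centralizer G T"
    show "inv a \<in> centralizer G T"
      using a T.mem_carrier inv_commute unfolding centralizer_def by auto
    fix b assume b: "b \<in> centralizer G T"
    show "a \<otimes> b \<in> centralizer G T"
    proof -
      have "a \<otimes> b \<otimes> t = t \<otimes> (a \<otimes> b)" if t: "t \<in> T" for t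
      proof -
        have c: "a \<in> carrier G" "b \<in> carrier G" "t \<in> carrier G" "b \<otimes> t = t \<otimes> b" "a \<otimes> t = t \<otimes> a"
          using a b t T.mem_carrier by (auto simp: centralizer_def)
        have "a \<otimes> b \<otimes> t = (a \<otimes> t) \<otimes> b" using c(1-4) by (simp add: m_assoc)
        then show ?thesis unfolding c(5) using c(1-3) by (simp add: m_assoc)
      qed
      then show ?thesis using a b by (simp add: centralizer_def)
    qed
  next
    show "centralizer G T \<noteq> {}" using T.mem_carrier by (force simp: centralizer_def)
  qed (simp add: centralizer_def)
  show ?thesis
  proof (rule normal_invI[OF sub])
    fix x h assume x: "x \<in> carrier G" and h: "h \<in> centralizer G T"
    have hc: "h \<in> carrier G" using h by (simp add: centralizer_def)
    have "x \<otimes> h \<otimes> inv x \<otimes> t = t \<otimes> (x \<otimes> h \<otimes> inv x)" if t: "t \<in> T" for t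
    proof -
      have tc: "t \<in> carrier G" using t T.mem_carrier by blast
      have "h \<otimes> (inv x \<otimes> t \<otimes> x) = inv x \<otimes> t \<otimes> x \<otimes> h"
        using h T.inv_op_closed1[OF x t] by (auto simp: centralizer_def)
      then have "x \<otimes> (h \<otimes> (inv x \<otimes> t \<otimes> x)) \<otimes> inv x = x \<otimes> (inv x \<otimes> t \<otimes> x \<otimes> h) \<otimes> inv x" by simp
      then show ?thesis using x hc tc by (simp add: m_assoc inv_mult_cancel)
    qed
    then show "x \<otimes> h \<otimes> inv x \<in> centralizer G T" using x hc by (simp add: centralizer_def)
  qed
qed

lemma (in group) p_regular_eq_one:
  assumes fin: "finite (carrier G)" and p: "prime p" and ch: "characteristic_p p G"
    and x: "x \<in> carrier G" "x [^] (m::nat) = \<one>" "coprime m p"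
    and P: "P \<subseteq> p_core p G" "\<And>y. y \<in> P \<Longrightarrow> x \<otimes> y = y \<otimes> x"
    and CP: "\<And>y. y \<in> p_core p G \<Longrightarrow> (\<And>z. z \<in> P \<Longrightarrow> y \<otimes> z = z \<otimes> y) \<Longrightarrow> x \<otimes> y = y \<otimes> x"
  shows "x = \<one>"
proof -
  obtain k where Q: "p_core p G \<lhd> G" and k: "card (p_core p G) = p ^ k"
    using p_core_normal_p[OF fin p] by blast
  note Qs = normal_imp_subgroup[OF Q]
  have "x \<otimes> q = q \<otimes> x" if "q \<in> p_core p G" for q
    using p_regular_centralizes[OF fin p Qs k x(1) normal.inv_op_closed2[OF Q x(1)] x(2,3) P CP that] by blast
  then have "x \<in> p_core p G" using ch x(1) by (auto simp: characteristic_p_def centralizer_def)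
  then obtain l :: nat where "x [^] (p ^ l) = \<one>" using prime_power_card_iff[OF fin p Qs] k by blast
  then have "ord x dvd m" "ord x dvd p ^ l" using x by (simp_all add: pow_eq_id)
  then have "ord x = 1" using x(3) by (metis coprime_common_divisor_nat coprime_power_right_iff)
  then show ?thesis using ord_eq_1 x(1) by blast
qed

lemma characteristic_p_subdirect:
  assumes G1: "group G1" and G2: "group G2" and fin: "finite (carrier G1)" "finite (carrier G2)"
    and p: "prime p" and ch: "characteristic_p p G1" "characteristic_p p G2"
    and N: "subgroup N (G1 \<times>\<times> G2)"
    and P: "P \<lhd> (G1 \<times>\<times> G2)\<lparr>carrier := N\<rparr>" "card P = p ^ n"
    and P1: "fst ` P \<subseteq> p_core p G1" and P2: "snd ` P \<subseteq> p_core p G2"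
    and CP: "centralizer (G1 \<times>\<times> G2) P \<subseteq> N"
  shows "characteristic_p p ((G1 \<times>\<times> G2)\<lparr>carrier := N\<rparr>)"
proof -
  let ?G = "G1 \<times>\<times> G2" let ?K = "?G\<lparr>carrier := N\<rparr>"
  interpret G1: group G1 by fact
  interpret G2: group G2 by fact
  interpret G: group ?G using G1 G2 by (rule DirProd_group)
  interpret K: group ?K using N by (rule G.subgroup_imp_group)
  have finG: "finite (carrier ?G)" using fin by simp
  have NG: "N \<subseteq> carrier G1 \<times> carrier G2" using subgroup.subset[OF N] by simp
  then have finK: "finite (carrier ?K)" using finG finite_subset by fastforce
  define Q1 where "Q1 = p_core p G1"
  define Q2 where "Q2 = p_core p G2"
  define T where "T = p_core p ?K"
  have Q1: "Q1 \<lhd> G1" "\<exists>n. card Q1 = p ^ n" and Q2: "Q2 \<lhd> G2" "\<exists>n. card Q2 = p ^ n"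
    using G1.p_core_normal_p[OF fin(1) p] G2.p_core_normal_p[OF fin(2) p] by (simp_all add: Q1_def Q2_def)
  have Q1c: "Q1 \<subseteq> carrier G1" and Q2c: "Q2 \<subseteq> carrier G2"
    using Q1(1) Q2(1) normal_imp_subgroup subgroup.subset by blast+
  have T: "T \<lhd> ?K" unfolding T_def using K.p_core_normal_p[OF finK p] by blast
  have PT: "P \<subseteq> T" unfolding T_def using P by (rule K.normal_p_subset_p_core)
  have PN: "P \<subseteq> N" using normal_imp_subgroup[OF P(1)] subgroup.subset by force
  have QT: "N \<inter> (Q1 \<times> Q2) \<subseteq> T"
  proof -
    have Q: "Q1 \<times> Q2 \<lhd> ?G" using G1.DirProd_normal[OF G2 Q1(1) Q2(1)] .
    obtain k where k: "card (Q1 \<times> Q2) = p ^ k"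
      using Q1(2) Q2(2) by (auto simp: card_cartesian_product simp flip: power_add)
    have NQ: "N \<inter> (Q1 \<times> Q2) \<lhd> ?K"
      using G.normal_Int_subgroup[OF N Q] by (simp add: Int_commute)
    have "subgroup (N \<inter> (Q1 \<times> Q2)) ?G"
      using G.subgroups_Inter_pair[OF N normal_imp_subgroup[OF Q]] .
    then obtain k' where "card (N \<inter> (Q1 \<times> Q2)) = p ^ k'"
      using G.prime_power_card_subgroup[OF finG p normal_imp_subgroup[OF Q] _ _ k] by blast
    then show ?thesis unfolding T_def by (rule K.normal_p_subset_p_core[OF NQ])
  qed
  define C where "C = centralizer ?K T"
  have C: "C \<lhd> ?K" unfolding C_def by (rule K.centralizer_normal[OF T])
  interpret C: group "?K\<lparr>carrier := C\<rparr>" by (rule K.subgroup_imp_group[OF normal_imp_subgroup[OF C]])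
  have CK: "C \<subseteq> N" by (auto simp: C_def centralizer_def)
  have "\<exists>k::nat. h [^]\<^bsub>?K\<^esub> (p ^ k) = \<one>\<^bsub>?K\<^esub>" if h: "h \<in> C" for h
  proof -
    have hN: "h \<in> carrier ?K" using h CK by auto
    obtain a m :: nat where am: "(h [^]\<^bsub>?K\<^esub> (p ^ a)) [^]\<^bsub>?K\<^esub> m = \<one>\<^bsub>?K\<^esub>" "coprime m p"
      using K.p_regular_part[OF finK p hN] .
    obtain x1 x2 where x: "h [^]\<^bsub>?K\<^esub> (p ^ a) = (x1, x2)" by (cases "h [^]\<^bsub>?K\<^esub> (p ^ a)")
    have xC: "(x1, x2) \<in> C"
      using C.nat_pow_closed[of h "p ^ a"] K.nat_pow_consistent[of h "p ^ a" C] h x by simp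
    then have xc: "x1 \<in> carrier G1" "x2 \<in> carrier G2" using CK NG by auto
    have comm: "x1 \<otimes>\<^bsub>G1\<^esub> y1 = y1 \<otimes>\<^bsub>G1\<^esub> x1 \<and> x2 \<otimes>\<^bsub>G2\<^esub> y2 = y2 \<otimes>\<^bsub>G2\<^esub> x2" if "(y1, y2) \<in> T" for y1 y2
      using xC that by (auto simp: C_def centralizer_def)
    have pw: "(x1, x2) [^]\<^bsub>?K\<^esub> k = (x1 [^]\<^bsub>G1\<^esub> k, x2 [^]\<^bsub>G2\<^esub> k)" for k :: nat
      by (induction k) simp_all
    have m: "x1 [^]\<^bsub>G1\<^esub> m = \<one>\<^bsub>G1\<^esub>" "x2 [^]\<^bsub>G2\<^esub> m = \<one>\<^bsub>G2\<^esub>"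
      using am(1) unfolding x pw by simp_all
    have one1: "x1 = \<one>\<^bsub>G1\<^esub>"
    proof (rule G1.p_regular_eq_one[OF fin(1) p ch(1) xc(1) m(1) am(2) P1])
      show "x1 \<otimes>\<^bsub>G1\<^esub> y = y \<otimes>\<^bsub>G1\<^esub> x1" if "y \<in> fst ` P" for y
        using that PT comm by auto
      fix y assume y: "y \<in> p_core p G1" "\<And>z. z \<in> fst ` P \<Longrightarrow> y \<otimes>\<^bsub>G1\<^esub> z = z \<otimes>\<^bsub>G1\<^esub> y"
      then have "(y, \<one>\<^bsub>G2\<^esub>) \<in> centralizer ?G P"
        using Q1c PN NG by (fastforce simp: centralizer_def Q1_def)
      then have "(y, \<one>\<^bsub>G2\<^esub>) \<in> N \<inter> (Q1 \<times> Q2)"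
        using CP y(1) subgroup.one_closed[OF normal_imp_subgroup[OF Q2(1)]] Q1_def by blast
      then show "x1 \<otimes>\<^bsub>G1\<^esub> y = y \<otimes>\<^bsub>G1\<^esub> x1" using QT comm by blast
    qed
    have one2: "x2 = \<one>\<^bsub>G2\<^esub>"
    proof (rule G2.p_regular_eq_one[OF fin(2) p ch(2) xc(2) m(2) am(2) P2])
      show "x2 \<otimes>\<^bsub>G2\<^esub> y = y \<otimes>\<^bsub>G2\<^esub> x2" if "y \<in> snd ` P" for y
        using that PT comm by auto
      fix y assume y: "y \<in> p_core p G2" "\<And>z. z \<in> snd ` P \<Longrightarrow> y \<otimes>\<^bsub>G2\<^esub> z = z \<otimes>\<^bsub>G2\<^esub> y"
      then have "(\<one>\<^bsub>G1\<^esub>, y) \<in> centralizer ?G P"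
        using Q2c PN NG by (fastforce simp: centralizer_def Q2_def)
      then have "(\<one>\<^bsub>G1\<^esub>, y) \<in> N \<inter> (Q1 \<times> Q2)"
        using CP y(1) subgroup.one_closed[OF normal_imp_subgroup[OF Q1(1)]] Q2_def by blast
      then show "x2 \<otimes>\<^bsub>G2\<^esub> y = y \<otimes>\<^bsub>G2\<^esub> x2" using QT comm by blast
    qed
    show ?thesis using x one1 one2 by auto
  qed
  then have "\<exists>n. card C = p ^ n" using K.prime_power_card_iff[OF finK p normal_imp_subgroup[OF C]] by blast
  then have "C \<subseteq> T" unfolding T_def using K.normal_p_subset_p_core[OF C] by blast
  then show ?thesis by (simp add: characteristic_p_def C_def T_def)
qed

section \<open>Partial groups and their subgroups\<close>

lemma winv_simps [simp]:
  "winv L [] = []" "winv L (x # w) = winv L w @ [pinv L x]" "winv L (u @ v) = winv L v @ winv L u"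
  by (simp_all add: winv_def)

context partial_group
begin

lemma dom_carrier: "w \<in> pdom L \<Longrightarrow> set w \<subseteq> carrier L"
  using dom_words by (auto simp: lists_eq_set)

lemma dom_mid: "u @ v @ w \<in> pdom L \<Longrightarrow> v \<in> pdom L"
  using dom_append by blast

lemma nil_dom: "[] \<in> pdom L"
  using nonempty single_dom dom_append[of "[]"] by fastforce

lemma one_closed: "pprod L [] \<in> carrier L"
  using nil_dom by (rule prod_closed)

lemma prod_append:
  assumes "u @ v \<in> pdom L"
  shows "[pprod L u, pprod L v] \<in> pdom L" "pprod L (u @ v) = pprod L [pprod L u, pprod L v]"
  using assoc_dom[of "[]" u v] assoc_prod[of "[]" u v] assoc_dom[of "[pprod L u]" v "[]"]
    assoc_prod[of "[pprod L u]" v "[]"] assms by simp_all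

lemma insert_one:
  assumes "u @ w \<in> pdom L"
  shows "u @ [pprod L []] @ w \<in> pdom L" "pprod L (u @ [pprod L []] @ w) = pprod L (u @ w)"
  using assoc_dom[of u "[]" w] assoc_prod[of u "[]" w] assms by simp_all

lemma winv_winv: "set w \<subseteq> carrier L \<Longrightarrow> winv L (winv L w) = w"
  by (induction w) (simp_all add: inv_inv)

lemma winv_in_dom: "w \<in> pdom L \<Longrightarrow> winv L w \<in> pdom L"
  using winv_dom dom_append by blast

lemma append_winv:
  assumes "w \<in> pdom L"
  shows "w @ winv L w \<in> pdom L" "pprod L (w @ winv L w) = pprod L []"
  using winv_dom[OF winv_in_dom[OF assms]] winv_prod[OF winv_in_dom[OF assms]]
    winv_winv[OF dom_carrier[OF assms]] by simp_all

lemma inv_unique: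
  assumes "[a, b] \<in> pdom L" "pprod L [a, b] = pprod L []"
  shows "a = pinv L b"
proof -
  have c: "a \<in> carrier L" "b \<in> carrier L" using dom_carrier[OF assms(1)] by auto
  have "[a, b, pinv L b, pinv L a] \<in> pdom L" using append_winv(1)[OF assms(1)] by simp
  then have d: "[a, b, pinv L b] \<in> pdom L" using dom_append[of "[a, b, pinv L b]" "[pinv L a]"] by simp
  have b: "pprod L [b, pinv L b] = pprod L []" using append_winv(2)[OF single_dom[OF c(2)]] by simp
  have "pprod L [a, b, pinv L b] = pprod L [pprod L [], pinv L b]"
    using assoc_prod[of "[]" "[a, b]" "[pinv L b]"] d assms(2) by simp
  moreover have "pprod L [a, b, pinv L b] = pprod L [a, pprod L []]"
    using assoc_prod[of "[a]" "[b, pinv L b]" "[]"] d b by simp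
  moreover have "pprod L [pprod L [], pinv L b] = pinv L b"
    using insert_one(2)[of "[]" "[pinv L b]"] single_dom prod_single inv_closed c by simp
  moreover have "pprod L [a, pprod L []] = a"
    using insert_one(2)[of "[a]" "[]"] single_dom prod_single c by simp
  ultimately show ?thesis by simp
qed

lemma prod_winv: "w \<in> pdom L \<Longrightarrow> pprod L (winv L w) = pinv L (pprod L w)"
  using inv_unique prod_append winv_dom winv_prod by metis

lemma inv_one: "pinv L (pprod L []) = pprod L []"
  using prod_winv[OF nil_dom] by simp

lemma conj_dom_iff:
  "x \<in> conj_dom L g \<longleftrightarrow> [pinv L g, x, g] \<in> pdom L"
  using dom_carrier[of "[pinv L g, x, g]"] by (auto simp: conj_dom_def)

lemma conj_domD:
  assumes "x \<in> conj_dom L g"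
  shows "x \<in> carrier L" "g \<in> carrier L" "[pinv L g, x, g] \<in> pdom L" "pconj L g x \<in> carrier L"
  using assms dom_carrier[of "[pinv L g, x, g]"] prod_closed by (auto simp: conj_dom_def pconj_def)

lemma conj_bracket:
  assumes "x \<in> conj_dom L g"
  shows "[g, pinv L g, x, g, pinv L g] \<in> pdom L"
proof -
  note c = conj_domD[OF assms]
  have "[pinv L g, pinv L x, g] @ [pinv L g, x, g] \<in> pdom L"
    using winv_dom[OF c(3)] c by (simp add: inv_inv)
  then have v: "[g, pinv L g, x, g] \<in> pdom L"
    using dom_append[of "[pinv L g, pinv L x]" "[g, pinv L g, x, g]"] by simp
  show ?thesis
    using append_winv(1)[OF v] dom_append[of "[g, pinv L g, x, g, pinv L g]" "[pinv L x, pinv L (pinv L g), pinv L g]"] by simp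
qed

lemma conj_reverse:
  assumes "x \<in> conj_dom L g"
  shows "pconj L g x \<in> conj_dom L (pinv L g)" "pconj L (pinv L g) (pconj L g x) = x"
proof -
  note c = conj_domD[OF assms] and b = conj_bracket[OF assms]
  show "pconj L g x \<in> conj_dom L (pinv L g)"
    using assoc_dom[of "[g]" "[pinv L g, x, g]" "[pinv L g]"] b c by (simp add: conj_dom_iff pconj_def inv_inv)
  have gg: "pprod L [g, pinv L g] = pprod L []" using append_winv(2)[OF single_dom[OF c(2)]] by simp
  have d: "[x, g, pinv L g] \<in> pdom L" "[g, pinv L g] \<in> pdom L"
    using dom_append[of "[g, pinv L g]" "[x, g, pinv L g]"] b by simp_all
  have "pconj L (pinv L g) (pconj L g x) = pprod L [g, pinv L g, x, g, pinv L g]"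
    using assoc_prod[of "[g]" "[pinv L g, x, g]" "[pinv L g]"] b c by (simp add: pconj_def inv_inv)
  also have "\<dots> = pprod L [x, g, pinv L g]"
    using assoc_prod[of "[]" "[g, pinv L g]" "[x, g, pinv L g]"] b gg insert_one(2)[of "[]" "[x, g, pinv L g]"] d by simp
  also have "\<dots> = pprod L [x]"
    using assoc_prod[of "[x]" "[g, pinv L g]" "[]"] d gg insert_one(2)[of "[x]" "[]"] single_dom[OF c(1)] by simp
  finally show "pconj L (pinv L g) (pconj L g x) = x" using prod_single c by simp
qed

lemma inj_on_conj: "inj_on (pconj L g) (conj_dom L g)"
  by (rule inj_on_inverseI[of _ "pconj L (pinv L g)"]) (rule conj_reverse)

lemma conj_reverse_image:
  assumes "P \<subseteq> conj_dom L g"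
  shows "pconj L g ` P \<subseteq> conj_dom L (pinv L g)" "pconj L (pinv L g) ` pconj L g ` P = P"
proof -
  show "pconj L g ` P \<subseteq> conj_dom L (pinv L g)" using conj_reverse(1) assms by blast
  have "pconj L (pinv L g) (pconj L g x) = x" if "x \<in> P" for x using that conj_reverse(2) assms by blast
  then show "pconj L (pinv L g) ` pconj L g ` P = P" by (force simp: image_image)
qed

lemma conj_one:
  assumes "g \<in> carrier L"
  shows "pprod L [] \<in> conj_dom L g" "pconj L g (pprod L []) = pprod L []"
  using insert_one[of "[pinv L g]" "[g]"] winv_dom[OF single_dom[OF assms]] winv_prod[OF single_dom[OF assms]]
  by (simp_all add: conj_dom_iff pconj_def)

lemma conj_by_one:
  assumes "x \<in> carrier L"
  shows "x \<in> conj_dom L (pprod L [])" "pconj L (pprod L []) x = x"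
  using insert_one[of "[]" "[x, pprod L []]"] insert_one[of "[x]" "[]"] single_dom[OF assms] prod_single[OF assms]
  by (simp_all add: conj_dom_iff pconj_def inv_one)

lemma conj_inv:
  assumes "x \<in> conj_dom L g"
  shows "pinv L x \<in> conj_dom L g" "pconj L g (pinv L x) = pinv L (pconj L g x)"
  using winv_in_dom[of "[pinv L g, x, g]"] prod_winv[of "[pinv L g, x, g]"] conj_domD[OF assms]
  by (simp_all add: conj_dom_iff pconj_def inv_inv)

lemma conj_mult:
  assumes w: "[pinv L g, a, g, pinv L g, b, g] \<in> pdom L"
  shows "[a, b] \<in> pdom L" "pprod L [a, b] \<in> conj_dom L g"
    "pconj L g (pprod L [a, b]) = pprod L [pconj L g a, pconj L g b]"
proof -
  have g: "g \<in> carrier L" using dom_carrier[OF w] by simp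
  have gg: "pprod L [g, pinv L g] = pprod L []" using append_winv(2)[OF single_dom[OF g]] by simp
  have "[pinv L g, a, pprod L [], b, g] \<in> pdom L"
    using assoc_dom[of "[pinv L g, a]" "[g, pinv L g]" "[b, g]"] w gg by simp
  then have "[pinv L g] @ [a, pprod L []] @ [b, g] \<in> pdom L" by simp
  note d1 = assoc_dom[OF this] assoc_prod[OF this]
  have "[a, pprod L []] \<in> pdom L" "a \<in> carrier L" using dom_carrier[OF w]
    dom_mid[of "[pinv L g]" "[a, pprod L []]" "[b, g]"] \<open>[pinv L g] @ [a, pprod L []] @ [b, g] \<in> pdom L\<close> by simp_all
  then have a1: "pprod L [a, pprod L []] = a"
    using insert_one(2)[of "[a]" "[]"] prod_single single_dom by simp
  have d: "[pinv L g, a, b, g] \<in> pdom L" using d1(1) a1 by simp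
  then show "[a, b] \<in> pdom L" using dom_mid[of "[pinv L g]" "[a, b]" "[g]"] by simp
  show "pprod L [a, b] \<in> conj_dom L g"
    using assoc_dom[of "[pinv L g]" "[a, b]" "[g]"] d by (simp add: conj_dom_iff)
  have "pconj L g (pprod L [a, b]) = pprod L [pinv L g, a, b, g]"
    using assoc_prod[of "[pinv L g]" "[a, b]" "[g]"] d by (simp add: pconj_def)
  also have "\<dots> = pprod L [pinv L g, a, g, pinv L g, b, g]"
    using assoc_prod[of "[pinv L g, a]" "[g, pinv L g]" "[b, g]"] w gg d1(2) a1 by simp
  also have "\<dots> = pprod L [pconj L g a, pconj L g b]"
    using prod_append(2)[of "[pinv L g, a, g]" "[pinv L g, b, g]"] w by (simp add: pconj_def)
  finally show "pconj L g (pprod L [a, b]) = pprod L [pconj L g a, pconj L g b]" .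
qed

lemma conj_word:
  assumes w: "winv L w @ [x] @ w \<in> pdom L"
  shows "x \<in> conj_dom L (pprod L w)" "pconj L (pprod L w) x = pprod L (winv L w @ [x] @ w)"
proof -
  have wd: "w \<in> pdom L" using dom_append[of "winv L w @ [x]" w] w by simp
  have "[pprod L (winv L w)] @ [x] @ w \<in> pdom L"
    "pprod L (winv L w @ [x] @ w) = pprod L ([pprod L (winv L w)] @ [x] @ w)"
    using assoc_dom[of "[]" "winv L w" "[x] @ w"] assoc_prod[of "[]" "winv L w" "[x] @ w"] w by simp_all
  then show "x \<in> conj_dom L (pprod L w)" "pconj L (pprod L w) x = pprod L (winv L w @ [x] @ w)"
    using assoc_dom[of "[pprod L (winv L w), x]" w "[]"] assoc_prod[of "[pprod L (winv L w), x]" w "[]"]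
      prod_winv[OF wd] by (simp_all add: conj_dom_iff pconj_def)
qed

lemma pg_subgroupI:
  assumes "H \<subseteq> carrier L" "lists H \<subseteq> pdom L" "pprod L [] \<in> H"
    "\<And>h. h \<in> H \<Longrightarrow> pinv L h \<in> H" "\<And>g h. g \<in> H \<Longrightarrow> h \<in> H \<Longrightarrow> pprod L [g, h] \<in> H"
  shows "pg_subgroup L H"
proof -
  have "pprod L w \<in> H" if "w \<in> lists H" for w
    using that
  proof (induction w)
    case (Cons g w)
    then have "g \<in> carrier L" using assms(1) by blast
    moreover have "[g] @ w \<in> pdom L" using Cons assms(2) by (auto simp: lists_eq_set subset_iff)
    ultimately have "pprod L (g # w) = pprod L [g, pprod L w]"
      using prod_append(2)[of "[g]" w] prod_single by simp
    then show ?case using Cons assms(5) by simp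
  qed (use assms(3) in simp)
  then show ?thesis using assms by (auto simp: pg_subgroup_def partial_subgroup_def)
qed

lemma pg_subgroupD:
  assumes "pg_subgroup L H"
  shows "H \<subseteq> carrier L" "set w \<subseteq> H \<Longrightarrow> w \<in> pdom L" "set w \<subseteq> H \<Longrightarrow> pprod L w \<in> H"
    "h \<in> H \<Longrightarrow> pinv L h \<in> H" "h \<in> H \<Longrightarrow> h \<in> carrier L"
  using assms by (auto simp: pg_subgroup_def partial_subgroup_def lists_eq_set subset_iff)

lemma group_of_sel [simp]:
  "carrier (group_of L H) = H" "\<one>\<^bsub>group_of L H\<^esub> = pprod L []" "x \<otimes>\<^bsub>group_of L H\<^esub> y = pprod L [x, y]"
  "(group_of L H)\<lparr>carrier := K\<rparr> = group_of L K"
  by (simp_all add: group_of_def)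

lemma group_group_of:
  assumes H: "pg_subgroup L H"
  shows "group (group_of L H)"
proof (rule groupI)
  note sub = pg_subgroupD[OF H]
  fix x y z assume x: "x \<in> carrier (group_of L H)" and y: "y \<in> carrier (group_of L H)"
    and z: "z \<in> carrier (group_of L H)"
  have "[x, y, z] \<in> pdom L" using sub x y z by simp
  then show "x \<otimes>\<^bsub>group_of L H\<^esub> y \<otimes>\<^bsub>group_of L H\<^esub> z = x \<otimes>\<^bsub>group_of L H\<^esub> (y \<otimes>\<^bsub>group_of L H\<^esub> z)"
    using assoc_prod[of "[]" "[x, y]" "[z]"] assoc_prod[of "[x]" "[y, z]" "[]"] by simp
next
  note sub = pg_subgroupD[OF H]
  fix x assume x: "x \<in> carrier (group_of L H)"
  then show "\<one>\<^bsub>group_of L H\<^esub> \<otimes>\<^bsub>group_of L H\<^esub> x = x"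
    using insert_one(2)[of "[]" "[x]"] single_dom prod_single sub(5) by simp
  have "pinv L x \<otimes>\<^bsub>group_of L H\<^esub> x = \<one>\<^bsub>group_of L H\<^esub>"
    using winv_prod[OF single_dom[of x]] sub x by simp
  then show "\<exists>y\<in>carrier (group_of L H). y \<otimes>\<^bsub>group_of L H\<^esub> x = \<one>\<^bsub>group_of L H\<^esub>"
    using sub(4) x by auto
qed (use pg_subgroupD[OF H] in auto)

lemma inv_group_of:
  assumes H: "pg_subgroup L H" and x: "x \<in> H"
  shows "inv\<^bsub>group_of L H\<^esub> x = pinv L x"
  using winv_prod[OF single_dom[of x]] pg_subgroupD[OF H] x
  by (intro group.inv_equality[OF group_group_of[OF H]]) simp_all

lemma subgroup_group_of_iff:
  assumes H: "pg_subgroup L H"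
  shows "subgroup K (group_of L H) \<longleftrightarrow> pg_subgroup L K \<and> K \<subseteq> H"
proof
  interpret H: group "group_of L H" by (rule group_group_of[OF H])
  assume K: "subgroup K (group_of L H)"
  have KH: "K \<subseteq> H" using subgroup.subset[OF K] by simp
  have "pg_subgroup L K"
  proof (rule pg_subgroupI)
    show "pinv L h \<in> K" if "h \<in> K" for h
      using subgroup.m_inv_closed[OF K that] inv_group_of[OF H] KH that by auto
    show "pprod L [g, h] \<in> K" if "g \<in> K" "h \<in> K" for g h
      using subgroup.m_closed[OF K that] by simp
  qed (use KH pg_subgroupD[OF H] subgroup.one_closed[OF K] in \<open>auto simp: lists_eq_set subset_iff\<close>)
  then show "pg_subgroup L K \<and> K \<subseteq> H" using KH by blast
next
  interpret H: group "group_of L H" by (rule group_group_of[OF H])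
  assume K: "pg_subgroup L K \<and> K \<subseteq> H"
  show "subgroup K (group_of L H)"
  proof (rule H.subgroupI)
    show "K \<noteq> {}" using K pg_subgroupD(3)[of K "[]"] by auto
    show "inv\<^bsub>group_of L H\<^esub> a \<in> K" if "a \<in> K" for a
      using that K pg_subgroupD(4)[of K a] inv_group_of[OF H] by auto
    show "a \<otimes>\<^bsub>group_of L H\<^esub> b \<in> K" if "a \<in> K" "b \<in> K" for a b
      using that K pg_subgroupD(3)[of K "[a, b]"] by simp
  qed (use K in simp)
qed

lemma conj_in_subgroup:
  assumes H: "pg_subgroup L H" and g: "g \<in> H" and x: "x \<in> H"
  shows "x \<in> conj_dom L g" "pconj L g x \<in> H"
    "pconj L g x = inv\<^bsub>group_of L H\<^esub> g \<otimes>\<^bsub>group_of L H\<^esub> x \<otimes>\<^bsub>group_of L H\<^esub> g"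
proof -
  note sub = pg_subgroupD[OF H]
  have d: "[pinv L g, x, g] \<in> pdom L" using sub(2) sub(4)[OF g] g x by simp
  then show "x \<in> conj_dom L g" by (simp add: conj_dom_iff)
  show "pconj L g x \<in> H" unfolding pconj_def using sub(3) sub(4)[OF g] g x by simp
  show "pconj L g x = inv\<^bsub>group_of L H\<^esub> g \<otimes>\<^bsub>group_of L H\<^esub> x \<otimes>\<^bsub>group_of L H\<^esub> g"
    using assoc_prod[of "[]" "[pinv L g, x]" "[g]"] d inv_group_of[OF H g] by (simp add: pconj_def)
qed

lemma conj_map_group_of:
  assumes H: "pg_subgroup L H" and g: "g \<in> H" and P: "P \<subseteq> H"
  shows "conj_map (group_of L H) P g = restrict (pconj L g) P"
  using conj_in_subgroup(3)[OF H g] P by (force simp: conj_map_def restrict_def)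

lemma pg_subgroup_conj_image:
  assumes P: "pg_subgroup L P" and g: "g \<in> carrier L" and PS: "pconj L g ` P \<subseteq> S" and S: "pg_subgroup L S"
    and w: "\<And>a b. a \<in> P \<Longrightarrow> b \<in> P \<Longrightarrow> [pinv L g, a, g, pinv L g, b, g] \<in> pdom L"
  shows "pg_subgroup L (pconj L g ` P)"
proof (rule pg_subgroupI)
  note P' = pg_subgroupD[OF P]
  have D: "P \<subseteq> conj_dom L g"
    using w dom_append[of "[pinv L g, a, g]" "[pinv L g, a, g]" for a] by (auto simp: conj_dom_iff)
  show "pconj L g ` P \<subseteq> carrier L" "lists (pconj L g ` P) \<subseteq> pdom L"
    using PS pg_subgroupD[OF S] by (auto simp: lists_eq_set subset_iff)
  show "pprod L [] \<in> pconj L g ` P"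
    using conj_one(2)[OF g] P'(3)[of "[]"] by force
  show "pinv L h \<in> pconj L g ` P" if "h \<in> pconj L g ` P" for h
    using that conj_inv(2) D P'(4) by force
  show "pprod L [h, k] \<in> pconj L g ` P" if "h \<in> pconj L g ` P" "k \<in> pconj L g ` P" for h k
  proof -
    obtain a b where ab: "a \<in> P" "b \<in> P" "h = pconj L g a" "k = pconj L g b" using \<open>h \<in> _\<close> \<open>k \<in> _\<close> by blast
    then show ?thesis using conj_mult(3)[OF w[OF ab(1,2)]] P'(3)[of "[a, b]"] by force
  qed
qed

end

section \<open>Conjugation of objects in a locality\<close>

primrec object_path :: "('a, 'm) partial_group_scheme \<Rightarrow> 'a set set \<Rightarrow> 'a set \<Rightarrow> 'a list \<Rightarrow> bool" where
  "object_path L \<Delta> P [] \<longleftrightarrow> P \<in> \<Delta>"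
| "object_path L \<Delta> P (g # w) \<longleftrightarrow>
     P \<in> \<Delta> \<and> g \<in> carrier L \<and> P \<subseteq> conj_dom L g \<and> object_path L \<Delta> (pconj L g ` P) w"

lemma object_path_iff:
  "object_path L \<Delta> P w \<longleftrightarrow> w \<in> lists (carrier L) \<and>
     (\<exists>Ps. length Ps = Suc (length w) \<and> set Ps \<subseteq> \<Delta> \<and> Ps ! 0 = P \<and>
       (\<forall>i<length w. Ps ! i \<subseteq> conj_dom L (w ! i) \<and> pconj L (w ! i) ` (Ps ! i) = Ps ! Suc i))"
  (is "_ \<longleftrightarrow> ?R P w")
proof (induction w arbitrary: P)
  case Nil
  show ?case
  proof
    assume "object_path L \<Delta> P []"
    then show "?R P []" by (auto intro!: exI[of _ "[P]"])
  qed (auto simp: length_Suc_conv)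
next
  case (Cons g w)
  show ?case
  proof
    assume path: "object_path L \<Delta> P (g # w)"
    then obtain Ps where Ps: "w \<in> lists (carrier L)" "length Ps = Suc (length w)" "set Ps \<subseteq> \<Delta>"
      "Ps ! 0 = pconj L g ` P"
      "\<forall>i<length w. Ps ! i \<subseteq> conj_dom L (w ! i) \<and> pconj L (w ! i) ` (Ps ! i) = Ps ! Suc i"
      using Cons.IH by auto
    then show "?R P (g # w)"
      using path by (intro conjI exI[of _ "P # Ps"]) (auto simp: All_less_Suc2)
  next
    assume "?R P (g # w)"
    then obtain Ps where Ps: "g # w \<in> lists (carrier L)" "length Ps = Suc (Suc (length w))" "set Ps \<subseteq> \<Delta>" "Ps ! 0 = P"
       "\<forall>i<Suc (length w). Ps ! i \<subseteq> conj_dom L ((g # w) ! i) \<and> pconj L ((g # w) ! i) ` (Ps ! i) = Ps ! Suc i"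
      by auto
    then obtain Qs where Qs: "Ps = P # Qs" by (cases Ps) auto
    have "object_path L \<Delta> (Qs ! 0) w"
      unfolding Cons.IH using Ps unfolding Qs by (intro conjI exI[of _ Qs]) (auto simp: All_less_Suc2)
    then show "object_path L \<Delta> P (g # w)"
      using Ps unfolding Qs by (auto simp: All_less_Suc2)
  qed
qed

lemma dom_of_objects_iff: "w \<in> dom_of_objects L \<Delta> \<longleftrightarrow> (\<exists>P. object_path L \<Delta> P w)"
  unfolding object_path_iff dom_of_objects_def by auto

context locality
begin

lemma pathI: "object_path L \<Delta> P w \<Longrightarrow> w \<in> pdom L"
  using dom_eq dom_of_objects_iff by blast

lemma S_subgroup: "pg_subgroup L S" and S_closed: "x \<in> S \<Longrightarrow> x \<in> carrier L"
  using S_p_subgroup pg_subgroupD(5) by (auto simp: pg_p_subgroup_def)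

lemma objectD: "P \<in> \<Delta> \<Longrightarrow> pg_subgroup L P" "P \<in> \<Delta> \<Longrightarrow> P \<subseteq> S"
  using objects_subgroups by auto

lemma object_overgroup: "P \<in> \<Delta> \<Longrightarrow> P \<subseteq> Q \<Longrightarrow> Q \<subseteq> S \<Longrightarrow> pg_subgroup L Q \<Longrightarrow> Q \<in> \<Delta>"
proof -
  assume P: "P \<in> \<Delta>" "P \<subseteq> Q" "Q \<subseteq> S" "pg_subgroup L Q"
  have sub: "x \<in> P \<Longrightarrow> x \<in> carrier L" for x using objectD(2) P(1) S_closed by blast
  then have "pconj L (pprod L []) ` P = P" using conj_by_one(2) by force
  moreover have "P \<subseteq> conj_dom L (pprod L [])" using sub conj_by_one(1) by blast
  ultimately show "Q \<in> \<Delta>"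
    using objects_closed[OF P(4,3,1) one_closed] P objectD(1) by simp
qed

lemma S_object: "S \<in> \<Delta>"
  using objects_nonempty object_overgroup objectD S_subgroup by blast

lemma conj_object_by_S:
  assumes P: "P \<in> \<Delta>" and x: "x \<in> S"
  shows "P \<subseteq> conj_dom L x" "pconj L x ` P \<in> \<Delta>"
proof -
  have PS: "P \<subseteq> S" using objectD(2)[OF P] .
  note c = conj_in_subgroup[OF S_subgroup x]
  show D: "P \<subseteq> conj_dom L x" using PS c(1) by blast
  have im: "pconj L x ` P \<subseteq> S" using PS c(2) by blast
  have "pinv L x \<in> S" using pg_subgroupD(4)[OF S_subgroup x] .
  then have "[pinv L x, a, x, pinv L x, b, x] \<in> pdom L" if "a \<in> P" "b \<in> P" for a b
    using that x PS by (intro pg_subgroupD(2)[OF S_subgroup]) auto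
  with objectD(1)[OF P] S_closed[OF x] im S_subgroup have "pg_subgroup L (pconj L x ` P)"
    by (rule pg_subgroup_conj_image)
  then show "pconj L x ` P \<in> \<Delta>"
    using objects_closed[OF _ im P S_closed[OF x] D] by blast
qed

lemma conj_object_self:
  assumes P: "P \<in> \<Delta>" and x: "x \<in> P"
  shows "pconj L x ` P = P"
proof -
  have PG: "pg_subgroup L P" using objectD(1)[OF P] .
  have "finite P" using finite_carrier pg_subgroupD(1)[OF PG] finite_subset by blast
  moreover have "pconj L x ` P \<subseteq> P" "inj_on (pconj L x) P"
    using conj_in_subgroup[OF PG x] inj_on_conj inj_on_subset[of "pconj L x" "conj_dom L x" P] by blast+
  ultimately show ?thesis using endo_inj_surj by blast
qed

definition carries :: "'a \<Rightarrow> 'a set \<Rightarrow> bool" where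
  "carries g P \<longleftrightarrow> g \<in> carrier L \<and> P \<in> \<Delta> \<and> P \<subseteq> conj_dom L g \<and> pconj L g ` P \<in> \<Delta>"

lemma carries_exists: "g \<in> carrier L \<Longrightarrow> \<exists>P. carries g P"
  using single_dom[of g] dom_eq dom_of_objects_iff[of "[g]" L \<Delta>] unfolding carries_def by simp

text \<open>The word \<open>(a\<^sup>-\<^sup>1, g, a\<^sup>g)\<close> has product \<open>g\<close>, and it carries \<open>P\<^sup>a\<close> along \<open>P\<close> and \<open>P\<^sup>g\<close> to an object.\<close>

lemma carries_conj:
  assumes P: "carries g P" and a: "a \<in> S" "a \<in> conj_dom L g" "pconj L g a \<in> S"
  shows "carries g (pconj L a ` P)"
proof -
  define b where "b = pconj L g a"
  define Q where "Q = pconj L g ` P"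
  have g: "g \<in> carrier L" and P': "P \<in> \<Delta>" "P \<subseteq> conj_dom L g" "Q \<in> \<Delta>"
    using P by (auto simp: carries_def Q_def)
  have ac: "a \<in> carrier L" and bc: "b \<in> carrier L" using a S_closed by (auto simp: b_def)
  note Pa = conj_object_by_S[OF P'(1) a(1)] and Qb = conj_object_by_S[OF P'(3) a(3)]
  note inv_c = inv_closed[OF ac] inv_closed[OF bc] inv_closed[OF g]
  have rev: "pconj L (pinv L a) ` pconj L a ` P = P" "pconj L a ` P \<subseteq> conj_dom L (pinv L a)"
    "pconj L (pinv L b) ` pconj L b ` Q = Q" "pconj L b ` Q \<subseteq> conj_dom L (pinv L b)"
    "pconj L (pinv L g) ` Q = P" "Q \<subseteq> conj_dom L (pinv L g)"
    using conj_reverse_image[OF Pa(1)] conj_reverse_image[OF Qb(1)] conj_reverse_image[OF P'(2)]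
    by (simp_all add: Q_def b_def)
  have agb: "[pinv L a, g, b] \<in> pdom L"
    by (rule pathI[of "pconj L a ` P"])
      (use Pa Qb P' rev g ac bc inv_c in \<open>simp add: Q_def[symmetric] b_def[symmetric]\<close>)
  have br: "[g, pinv L g, a, g] \<in> pdom L"
    using conj_bracket[OF a(2)] dom_append[of "[g, pinv L g, a, g]" "[pinv L g]"] by simp
  have gg: "pprod L [g, pinv L g] = pprod L []" using append_winv(2)[OF single_dom[OF g]] by simp
  have ag: "[a, g] \<in> pdom L" using br dom_append[of "[g, pinv L g]" "[a, g]"] by simp
  have "pprod L [g, b] = pprod L [g, pinv L g, a, g]"
    using assoc_prod[of "[g]" "[pinv L g, a, g]" "[]"] br by (simp add: b_def pconj_def)
  also have "\<dots> = pprod L [a, g]"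
    using assoc_prod[of "[]" "[g, pinv L g]" "[a, g]"] br gg insert_one(2)[of "[]" "[a, g]"] ag by simp
  finally have gb: "pprod L [g, b] = pprod L [a, g]" .
  have d: "[pinv L a, a, g] \<in> pdom L"
    using winv_dom[OF ag] dom_append[of "[pinv L g]" "[pinv L a, a, g]"] by simp
  have "pprod L [pinv L a, g, b] = pprod L [pinv L a, pprod L [a, g]]"
    using assoc_prod[of "[pinv L a]" "[g, b]" "[]"] agb gb by simp
  also have "\<dots> = pprod L [pinv L a, a, g]"
    using assoc_prod[of "[pinv L a]" "[a, g]" "[]"] d by simp
  also have "\<dots> = g"
    using assoc_prod[of "[]" "[pinv L a, a]" "[g]"] d winv_prod[OF single_dom[OF ac]] prod_single[OF g]
      insert_one(2)[of "[]" "[g]"] single_dom[OF g] by simp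
  finally have prod: "pprod L [pinv L a, g, b] = g" .
  have conj: "x \<in> conj_dom L g \<and> pconj L g x = pconj L b (pconj L g (pconj L (pinv L a) x))"
    if x: "x \<in> pconj L a ` P" for x
  proof -
    have xc: "x \<in> carrier L" using x Pa objectD(2) S_closed by blast
    have Px: "pconj L a ` P \<subseteq> conj_dom L x" "pconj L x ` pconj L a ` P = pconj L a ` P"
      using conj_object_by_S(1)[OF Pa(2)] conj_object_self[OF Pa(2) x] subsetD[OF objectD(2)[OF Pa(2)] x] by blast+
    have w: "[pinv L b, pinv L g, a, x, pinv L a, g, b] \<in> pdom L"
      by (rule pathI[of "pconj L b ` Q"])
        (use Pa Qb P' rev g ac bc xc inv_c Px in \<open>simp add: Q_def[symmetric] b_def[symmetric]\<close>)
    have wv: "winv L [pinv L a, g, b] @ [x] @ [pinv L a, g, b] \<in> pdom L" using w ac by (simp add: inv_inv)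
    have "pconj L g x = pprod L [pinv L b, pinv L g, a, x, pinv L a, g, b]"
      using conj_word(2)[OF wv] prod ac by (simp add: inv_inv)
    also have "\<dots> = pprod L [pinv L b, pinv L g, pconj L (pinv L a) x, g, b]"
      using assoc_prod[of "[pinv L b, pinv L g]" "[a, x, pinv L a]" "[g, b]"] w ac by (simp add: pconj_def inv_inv)
    also have "\<dots> = pconj L b (pconj L g (pconj L (pinv L a) x))"
      using assoc_prod[of "[pinv L b]" "[pinv L g, pconj L (pinv L a) x, g]" "[b]"]
        assoc_dom[of "[pinv L b, pinv L g]" "[a, x, pinv L a]" "[g, b]"] w ac by (simp add: pconj_def inv_inv)
    finally show ?thesis using conj_word(1)[OF wv] prod by simp
  qed
  have "pconj L g ` pconj L a ` P = (\<lambda>x. pconj L b (pconj L g (pconj L (pinv L a) x))) ` pconj L a ` P"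
    using conj by (intro image_cong) auto
  also have "\<dots> = pconj L b ` pconj L g ` pconj L (pinv L a) ` pconj L a ` P"
    by (simp add: image_image)
  also have "\<dots> = pconj L b ` Q" using rev(1) by (simp add: Q_def)
  finally show ?thesis using conj Pa(2) Qb(2) g by (auto simp: carries_def b_def)
qed

lemma conj_dom_word:
  assumes g: "g \<in> carrier L"
    and a: "a \<in> S" "a \<in> conj_dom L g" "pconj L g a \<in> S"
    and b: "b \<in> S" "b \<in> conj_dom L g" "pconj L g b \<in> S"
  shows "[pinv L g, a, g, pinv L g, b, g] \<in> pdom L"
proof -
  obtain P where P: "carries g P" using carries_exists[OF g] by blast
  define Q where "Q = pconj L g ` P"
  have Pa: "carries g (pconj L a ` P)" using carries_conj[OF P a] .
  have Pab: "carries g (pconj L b ` pconj L a ` P)" using carries_conj[OF Pa b] .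
  show ?thesis
    by (rule pathI[of Q])
      (use P Pa Pab conj_reverse_image[of P g] conj_reverse_image[of "pconj L a ` P" g] inv_closed[OF g] S_closed a b
        conj_object_by_S in \<open>simp add: carries_def Q_def\<close>)
qed

lemma conj_subgroup:
  assumes R: "pg_subgroup L R" "R \<subseteq> S" and g: "g \<in> carrier L" "R \<subseteq> conj_dom L g" "pconj L g ` R \<subseteq> S"
  shows "pg_subgroup L (pconj L g ` R)"
    "\<And>a b. a \<in> R \<Longrightarrow> b \<in> R \<Longrightarrow> pconj L g (pprod L [a, b]) = pprod L [pconj L g a, pconj L g b]"
proof -
  have w: "[pinv L g, a, g, pinv L g, b, g] \<in> pdom L" if "a \<in> R" "b \<in> R" for a b
    using that R g by (intro conj_dom_word) auto
  show "pg_subgroup L (pconj L g ` R)"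
    using R(1) g(1,3) S_subgroup w by (rule pg_subgroup_conj_image)
  show "\<And>a b. a \<in> R \<Longrightarrow> b \<in> R \<Longrightarrow> pconj L g (pprod L [a, b]) = pprod L [pconj L g a, pconj L g b]"
    using conj_mult(3)[OF w] .
qed

lemma conj_object:
  assumes R: "R \<in> \<Delta>" and g: "g \<in> carrier L" "R \<subseteq> conj_dom L g" "pconj L g ` R \<subseteq> S"
  shows "pconj L g ` R \<in> \<Delta>"
  using conj_subgroup(1)[OF objectD[OF R] g] objects_closed[OF _ g(3) R g(1,2)] by blast

lemma normalizer_words:
  assumes P: "P \<in> \<Delta>" and w: "w \<in> lists (pg_normalizer L P)"
  shows "w \<in> pdom L"
proof -
  have "object_path L \<Delta> P w"
    using w by (induction w) (use P in \<open>auto simp: pg_normalizer_def\<close>)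
  then show ?thesis by (rule pathI)
qed

lemma subset_normalizer: "P \<in> \<Delta> \<Longrightarrow> P \<subseteq> pg_normalizer L P"
  using conj_object_self conj_object_by_S(1) objectD(2) S_closed by (fastforce simp: pg_normalizer_def)

lemma conj_normalizer_mult:
  assumes P: "P \<in> \<Delta>" and g: "g \<in> pg_normalizer L P" and h: "h \<in> pg_normalizer L P" and x: "x \<in> P"
  shows "x \<in> conj_dom L (pprod L [g, h])" "pconj L (pprod L [g, h]) x = pconj L h (pconj L g x)"
proof -
  have inv: "pinv L k \<in> pg_normalizer L P" if "k \<in> pg_normalizer L P" for k
    using that conj_reverse_image[of P k] inv_closed by (auto simp: pg_normalizer_def)
  have xN: "x \<in> pg_normalizer L P" using subset_normalizer[OF P] x by blast
  have w: "[pinv L h, pinv L g, x, g, h] \<in> pdom L"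
    using normalizer_words[OF P] g h xN inv by simp
  then show "x \<in> conj_dom L (pprod L [g, h])" using conj_word(1)[of "[g, h]" x] by simp
  have "pconj L (pprod L [g, h]) x = pprod L [pinv L h, pinv L g, x, g, h]"
    using conj_word(2)[of "[g, h]" x] w by simp
  also have "\<dots> = pconj L h (pconj L g x)"
    using assoc_prod[of "[pinv L h]" "[pinv L g, x, g]" "[h]"] w by (simp add: pconj_def)
  finally show "pconj L (pprod L [g, h]) x = pconj L h (pconj L g x)" .
qed

lemma normalizer_subgroup:
  assumes P: "P \<in> \<Delta>"
  shows "pg_subgroup L (pg_normalizer L P)"
proof (rule pg_subgroupI)
  show "pprod L [] \<in> pg_normalizer L P"
    using subset_normalizer[OF P] pg_subgroupD(3)[OF objectD(1)[OF P], of "[]"] by auto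
  show "pinv L k \<in> pg_normalizer L P" if "k \<in> pg_normalizer L P" for k
    using that conj_reverse_image[of P k] inv_closed by (auto simp: pg_normalizer_def)
  fix g h assume g: "g \<in> pg_normalizer L P" and h: "h \<in> pg_normalizer L P"
  have "[g, h] \<in> pdom L" using normalizer_words[OF P] g h by simp
  then have "pprod L [g, h] \<in> carrier L" by (rule prod_closed)
  moreover have "pconj L (pprod L [g, h]) ` P = pconj L h ` pconj L g ` P"
    using conj_normalizer_mult(2)[OF P g h] by (force simp: image_image)
  ultimately show "pprod L [g, h] \<in> pg_normalizer L P"
    using conj_normalizer_mult(1)[OF P g h] g h by (auto simp: pg_normalizer_def)
qed (use normalizer_words[OF P] in \<open>auto simp: pg_normalizer_def\<close>)

end

section \<open>The external direct product is a locality\<close>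

lemma pg_prod_sel [simp]:
  "carrier (pg_prod L1 L2) = carrier L1 \<times> carrier L2"
  "pinv (pg_prod L1 L2) = map_prod (pinv L1) (pinv L2)"
  "pdom (pg_prod L1 L2) = {u. map fst u \<in> pdom L1 \<and> map snd u \<in> pdom L2}"
  "pprod (pg_prod L1 L2) u = (pprod L1 (map fst u), pprod L2 (map snd u))"
  by (simp_all add: pg_prod_def)

lemma winv_pg_prod [simp]:
  "map fst (winv (pg_prod L1 L2) w) = winv L1 (map fst w)"
  "map snd (winv (pg_prod L1 L2) w) = winv L2 (map snd w)"
  by (induction w) auto

lemma partial_group_pg_prod:
  assumes "partial_group L1" "partial_group L2"
  shows "partial_group (pg_prod L1 L2)"
proof -
  let ?L = "pg_prod L1 L2"
  interpret L1: partial_group L1 by fact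
  interpret L2: partial_group L2 by fact
  show ?thesis
  proof
    show "pdom ?L \<subseteq> lists (carrier ?L)"
    proof
      fix u assume "u \<in> pdom ?L"
      then have "set (map fst u) \<subseteq> carrier L1" "set (map snd u) \<subseteq> carrier L2"
        using L1.dom_carrier L2.dom_carrier by (simp_all del: set_map)
      then show "u \<in> lists (carrier ?L)" by (force simp: lists_eq_set)
    qed
    show "carrier ?L \<noteq> {}" using L1.nonempty L2.nonempty by simp
    show "pinv ?L f \<in> carrier ?L"
      "pinv ?L (pinv ?L f) = f"
      "[f] \<in> pdom ?L" "pprod ?L [f] = f" if "f \<in> carrier ?L" for f
      using that by (cases f, simp add: L1.inv_closed L2.inv_closed L1.inv_inv L2.inv_inv
          L1.single_dom L2.single_dom L1.prod_single L2.prod_single)+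
    show "pprod ?L w \<in> carrier ?L"
      "winv ?L w @ w \<in> pdom ?L"
      "pprod ?L (winv ?L w @ w) = pprod ?L []"
      if "w \<in> pdom ?L" for w
      using that by (simp_all add: L1.prod_closed L2.prod_closed L1.winv_dom L2.winv_dom L1.winv_prod L2.winv_prod)
    show "u \<in> pdom ?L \<and> v \<in> pdom ?L" if "u @ v \<in> pdom ?L" for u v
      using that L1.dom_append[of "map fst u" "map fst v"] L2.dom_append[of "map snd u" "map snd v"] by auto
    show "u @ [pprod ?L v] @ w \<in> pdom ?L"
      "pprod ?L (u @ v @ w) = pprod ?L (u @ [pprod ?L v] @ w)"
      if "u @ v @ w \<in> pdom ?L" for u v w
      using that L1.assoc_dom[of "map fst u" "map fst v" "map fst w"] L2.assoc_dom[of "map snd u" "map snd v" "map snd w"]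
        L1.assoc_prod[of "map fst u" "map fst v" "map fst w"] L2.assoc_prod[of "map snd u" "map snd v" "map snd w"]
      by simp_all
  qed
qed

lemma conj_dom_pg_prod:
  "(x, y) \<in> conj_dom (pg_prod L1 L2) (g, h) \<longleftrightarrow> x \<in> conj_dom L1 g \<and> y \<in> conj_dom L2 h"
  by (auto simp: conj_dom_def)

lemma pconj_pg_prod: "pconj (pg_prod L1 L2) (g, h) = map_prod (pconj L1 g) (pconj L2 h)"
  by (auto simp: pconj_def)

lemma fst_snd_map_prod_image:
  "fst ` map_prod f g ` X = f ` fst ` X" "snd ` map_prod f g ` X = g ` snd ` X"
  by force+

lemma subset_conj_dom_pg_prod:
  assumes "X \<subseteq> conj_dom (pg_prod L1 L2) (g, h)"
  shows "fst ` X \<subseteq> conj_dom L1 g" "snd ` X \<subseteq> conj_dom L2 h"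
  using assms conj_dom_pg_prod by fastforce+

lemma group_of_pg_prod:
  "group_of (pg_prod L1 L2) (A \<times> B) = group_of L1 A \<times>\<times> group_of L2 B"
  by (auto simp: group_of_def DirProd_def fun_eq_iff)

lemma pg_subgroup_projections:
  assumes "pg_subgroup (pg_prod L1 L2) Q"
  shows "pg_subgroup L1 (fst ` Q)" "pg_subgroup L2 (snd ` Q)"
proof -
  have Q: "Q \<subseteq> carrier L1 \<times> carrier L2" "\<And>h. h \<in> Q \<Longrightarrow> map_prod (pinv L1) (pinv L2) h \<in> Q"
    "\<And>u. u \<in> lists Q \<Longrightarrow> map fst u \<in> pdom L1 \<and> map snd u \<in> pdom L2 \<and> (pprod L1 (map fst u), pprod L2 (map snd u)) \<in> Q"
    using assms by (auto simp: pg_subgroup_def partial_subgroup_def)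
  have "fst ` Q \<subseteq> carrier L1" "snd ` Q \<subseteq> carrier L2" using Q(1) by auto
  moreover have "pinv L1 a \<in> fst ` Q" if "a \<in> fst ` Q" for a
    using that Q(2) by (metis (no_types, lifting) fst_map_prod imageE rev_image_eqI)
  moreover have "pinv L2 b \<in> snd ` Q" if "b \<in> snd ` Q" for b
    using that Q(2) by (metis (no_types, lifting) snd_map_prod imageE rev_image_eqI)
  moreover have "w \<in> pdom L1 \<and> pprod L1 w \<in> fst ` Q" if w: "w \<in> lists (fst ` Q)" for w
  proof -
    obtain u where "u \<in> lists Q" "w = map fst u" using w by (auto simp: lists_image)
    then show ?thesis using Q(3)[of u] by force
  qed
  moreover have "w \<in> pdom L2 \<and> pprod L2 w \<in> snd ` Q" if w: "w \<in> lists (snd ` Q)" for w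
  proof -
    obtain u where "u \<in> lists Q" "w = map snd u" using w by (auto simp: lists_image)
    then show ?thesis using Q(3)[of u] by force
  qed
  ultimately show "pg_subgroup L1 (fst ` Q)" "pg_subgroup L2 (snd ` Q)"
    by (simp_all add: pg_subgroup_def partial_subgroup_def subset_eq del: in_lists_conv_set)
qed

lemma pg_subgroup_Times:
  assumes "pg_subgroup L1 A" "pg_subgroup L2 B"
  shows "pg_subgroup (pg_prod L1 L2) (A \<times> B)"
proof -
  let ?L = "pg_prod L1 L2"
  have u: "map fst u \<in> lists A" "map snd u \<in> lists B" if "u \<in> lists (A \<times> B)" for u
    using that by (induction u) auto
  have "A \<subseteq> carrier L1" "B \<subseteq> carrier L2" "\<And>a. a \<in> A \<Longrightarrow> pinv L1 a \<in> A" "\<And>b. b \<in> B \<Longrightarrow> pinv L2 b \<in> B"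
    and w: "\<And>w. w \<in> lists A \<Longrightarrow> w \<in> pdom L1 \<and> pprod L1 w \<in> A" "\<And>w. w \<in> lists B \<Longrightarrow> w \<in> pdom L2 \<and> pprod L2 w \<in> B"
    using assms by (auto simp: pg_subgroup_def partial_subgroup_def)
  then have "A \<times> B \<subseteq> carrier ?L" "\<And>h. h \<in> A \<times> B \<Longrightarrow> pinv ?L h \<in> A \<times> B" by auto
  moreover have "u \<in> pdom ?L" "pprod ?L u \<in> A \<times> B" if "u \<in> lists (A \<times> B)" for u
    using w u[OF that] by (simp_all del: in_lists_conv_set)
  ultimately show ?thesis unfolding pg_subgroup_def partial_subgroup_def by blast
qed

locale locality_pair = L1: locality p L1 \<Delta>1 S1 + L2: locality p L2 \<Delta>2 S2
  for p and L1 :: "'a partial_group" and \<Delta>1 S1 and L2 :: "'b partial_group" and \<Delta>2 S2 +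
  assumes prime_p: "prime p"
begin

abbreviation "L \<equiv> pg_prod L1 L2"
abbreviation "\<Delta> \<equiv> prod_objects L1 \<Delta>1 S1 L2 \<Delta>2 S2"
abbreviation "S \<equiv> S1 \<times> S2"

sublocale L: partial_group L
  using L1.partial_group_axioms L2.partial_group_axioms by (rule partial_group_pg_prod)

lemma Times_object: "P1 \<in> \<Delta>1 \<Longrightarrow> P2 \<in> \<Delta>2 \<Longrightarrow> P1 \<times> P2 \<in> \<Delta>"
  using L1.objectD L2.objectD pg_subgroup_Times by (fastforce simp: prod_objects_def)

lemma object_projections:
  assumes "Q \<in> \<Delta>"
  shows "fst ` Q \<in> \<Delta>1" "snd ` Q \<in> \<Delta>2"
proof -
  obtain P1 P2 where Q: "pg_subgroup L Q" "Q \<subseteq> S1 \<times> S2" "P1 \<in> \<Delta>1" "P2 \<in> \<Delta>2" "P1 \<times> P2 \<subseteq> Q"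
    using assms by (auto simp: prod_objects_def)
  have ne: "P1 \<noteq> {}" "P2 \<noteq> {}"
    using Q(3,4) L1.objectD(1) L2.objectD(1) L1.pg_subgroupD(3)[of P1 "[]"] L2.pg_subgroupD(3)[of P2 "[]"] by auto
  have "fst ` (P1 \<times> P2) \<subseteq> fst ` Q" "snd ` (P1 \<times> P2) \<subseteq> snd ` Q" by (rule image_mono[OF Q(5)])+
  then have "P1 \<subseteq> fst ` Q" "P2 \<subseteq> snd ` Q" using ne by simp_all
  moreover have "fst ` Q \<subseteq> S1" "snd ` Q \<subseteq> S2" using Q(2) by auto
  ultimately show "fst ` Q \<in> \<Delta>1" "snd ` Q \<in> \<Delta>2"
    using L1.object_overgroup[OF Q(3) _ _ pg_subgroup_projections(1)[OF Q(1)]]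
      L2.object_overgroup[OF Q(4) _ _ pg_subgroup_projections(2)[OF Q(1)]] by simp_all
qed

lemma object_path_projections:
  "object_path L \<Delta> Q u \<Longrightarrow> object_path L1 \<Delta>1 (fst ` Q) (map fst u) \<and> object_path L2 \<Delta>2 (snd ` Q) (map snd u)"
proof (induction u arbitrary: Q)
  case (Cons g u)
  obtain g1 g2 where g: "g = (g1, g2)" by (cases g)
  have "fst ` pconj L g ` Q = pconj L1 g1 ` fst ` Q" "snd ` pconj L g ` Q = pconj L2 g2 ` snd ` Q"
    by (simp_all only: g pconj_pg_prod fst_snd_map_prod_image)
  then show ?case
    using Cons.IH[of "pconj L g ` Q"] Cons.prems object_projections[of Q] subset_conj_dom_pg_prod[of Q L1 L2 g1 g2]
    by (simp add: g)
qed (simp add: object_projections)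

lemma object_path_Times:
  "object_path L1 \<Delta>1 P1 (map fst u) \<Longrightarrow> object_path L2 \<Delta>2 P2 (map snd u) \<Longrightarrow> object_path L \<Delta> (P1 \<times> P2) u"
proof (induction u arbitrary: P1 P2)
  case (Cons g u)
  obtain g1 g2 where g: "g = (g1, g2)" by (cases g)
  have "pconj L g ` (P1 \<times> P2) = (pconj L1 g1 ` P1) \<times> (pconj L2 g2 ` P2)"
    by (auto simp: g pconj_pg_prod)
  moreover have "P1 \<times> P2 \<subseteq> conj_dom L g" using Cons.prems by (auto simp: g conj_dom_pg_prod)
  ultimately show ?case
    using Cons.IH[of "pconj L1 g1 ` P1" "pconj L2 g2 ` P2"] Cons.prems Times_object by (simp add: g)
qed (simp add: Times_object)

lemma p_subgroup_projections:
  assumes "pg_p_subgroup p L T"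
  shows "pg_p_subgroup p L1 (fst ` T)" "pg_p_subgroup p L2 (snd ` T)"
proof -
  have T: "pg_subgroup L T" and card: "\<exists>n. card T = p ^ n" using assms by (auto simp: pg_p_subgroup_def)
  note T' = pg_subgroup_projections[OF T]
  have fin: "finite T"
    using L.pg_subgroupD(1)[OF T] L1.finite_carrier L2.finite_carrier by (auto intro: finite_subset)
  have T_self: "subgroup T (group_of L T)" using L.subgroup_group_of_iff[OF T] T by blast
  have "fst \<in> hom (group_of L T) (group_of L1 (fst ` T))" "snd \<in> hom (group_of L T) (group_of L2 (snd ` T))"
    by (force simp: group_of_def intro!: homI)+
  then show "pg_p_subgroup p L1 (fst ` T)" "pg_p_subgroup p L2 (snd ` T)"
    using prime_power_card_hom_image[OF L.group_group_of[OF T] L1.group_group_of[OF T'(1)] _ _ _ prime_p T_self]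
      prime_power_card_hom_image[OF L.group_group_of[OF T] L2.group_group_of[OF T'(2)] _ _ _ prime_p T_self]
      card fin T' by (auto simp: pg_p_subgroup_def)
qed

lemma objects_closed:
  assumes Q: "pg_subgroup L Q" "Q \<subseteq> S" and P: "P \<in> \<Delta>" and g: "g \<in> carrier L" "P \<subseteq> conj_dom L g"
    "pconj L g ` P \<subseteq> Q"
  shows "Q \<in> \<Delta>"
proof -
  obtain P1 P2 where P12: "P1 \<in> \<Delta>1" "P2 \<in> \<Delta>2" "P1 \<times> P2 \<subseteq> P"
    using P by (auto simp: prod_objects_def)
  obtain g1 g2 where g12: "g = (g1, g2)" by (cases g)
  have ne: "P1 \<noteq> {}" "P2 \<noteq> {}"
    using P12(1,2) L1.objectD(1) L2.objectD(1) L1.pg_subgroupD(3)[of P1 "[]"] L2.pg_subgroupD(3)[of P2 "[]"] by auto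
  have sub: "P1 \<times> P2 \<subseteq> conj_dom L (g1, g2)" using P12(3) g(2) g12 by blast
  have dom: "P1 \<subseteq> conj_dom L1 g1" "P2 \<subseteq> conj_dom L2 g2"
    using subset_conj_dom_pg_prod[OF sub] ne by simp_all
  have im: "(pconj L1 g1 ` P1) \<times> (pconj L2 g2 ` P2) \<subseteq> Q"
    using g(3) P12(3) unfolding g12 pconj_pg_prod by force
  have "pconj L1 g1 ` P1 \<subseteq> S1" "pconj L2 g2 ` P2 \<subseteq> S2"
    using order_trans[OF im Q(2)] ne by (auto simp: times_subset_iff)
  then have "pconj L1 g1 ` P1 \<in> \<Delta>1" "pconj L2 g2 ` P2 \<in> \<Delta>2"
    using L1.conj_object[OF P12(1) _ dom(1)] L2.conj_object[OF P12(2) _ dom(2)] g(1) g12 by simp_all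
  then show ?thesis using Q im by (auto simp: prod_objects_def)
qed

lemma locality_prod: "locality p L \<Delta> S"
proof (unfold_locales)
  have SS: "pg_subgroup L S" using pg_subgroup_Times[OF L1.S_subgroup L2.S_subgroup] .
  show "finite (carrier L)" using L1.finite_carrier L2.finite_carrier by simp
  show "pg_p_subgroup p L S"
    using SS L1.S_p_subgroup L2.S_p_subgroup
    by (auto simp: pg_p_subgroup_def card_cartesian_product simp flip: power_add)
  show "\<Delta> \<noteq> {}" using Times_object[OF L1.S_object L2.S_object] by blast
  show "pg_subgroup L P \<and> P \<subseteq> S" if "P \<in> \<Delta>" for P using that by (simp add: prod_objects_def)
  show "T = S" if T: "pg_p_subgroup p L T" "S \<subseteq> T" for T
  proof -
    have "S1 \<subseteq> fst ` T" "S2 \<subseteq> snd ` T"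
      using image_mono[OF T(2), of fst] image_mono[OF T(2), of snd]
        L1.pg_subgroupD(3)[OF L1.S_subgroup, of "[]"] L2.pg_subgroupD(3)[OF L2.S_subgroup, of "[]"] by auto
    then have "fst ` T = S1" "snd ` T = S2"
      using p_subgroup_projections[OF T(1)] L1.S_maximal L2.S_maximal by blast+
    then have "T \<subseteq> S" by force
    then show ?thesis using T(2) by blast
  qed
  show "pdom L = dom_of_objects L \<Delta>"
  proof (intro equalityI subsetI)
    fix u assume "u \<in> pdom L"
    then have "map fst u \<in> dom_of_objects L1 \<Delta>1" "map snd u \<in> dom_of_objects L2 \<Delta>2"
      using L1.dom_eq L2.dom_eq by auto
    then show "u \<in> dom_of_objects L \<Delta>"
      unfolding dom_of_objects_iff using object_path_Times by blast
  next
    fix u assume "u \<in> dom_of_objects L \<Delta>"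
    then have "map fst u \<in> dom_of_objects L1 \<Delta>1" "map snd u \<in> dom_of_objects L2 \<Delta>2"
      unfolding dom_of_objects_iff using object_path_projections by blast+
    then show "u \<in> pdom L" using L1.dom_eq L2.dom_eq by auto
  qed
  show "Q \<in> \<Delta>" if "pg_subgroup L Q" "Q \<subseteq> S" "P \<in> \<Delta>" "g \<in> carrier L" "P \<subseteq> conj_dom L g"
    "pconj L g ` P \<subseteq> Q" for P Q g
    using objects_closed that by blast
qed

end

section \<open>Fusion systems and their products\<close>

lemma inj_homsD:
  assumes "\<phi> \<in> inj_homs G P Q"
  shows "\<And>x. x \<in> P \<Longrightarrow> \<phi> x \<in> Q" "\<And>x y. x \<in> P \<Longrightarrow> y \<in> P \<Longrightarrow> \<phi> (x \<otimes>\<^bsub>G\<^esub> y) = \<phi> x \<otimes>\<^bsub>G\<^esub> \<phi> y"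
    "inj_on \<phi> P" "\<phi> \<in> extensional P"
  using assms by (auto simp: inj_homs_def mon_def hom_def)

lemma inj_homsI:
  assumes "\<And>x. x \<in> P \<Longrightarrow> \<phi> x \<in> Q" "\<And>x y. x \<in> P \<Longrightarrow> y \<in> P \<Longrightarrow> \<phi> (x \<otimes>\<^bsub>G\<^esub> y) = \<phi> x \<otimes>\<^bsub>G\<^esub> \<phi> y"
    "inj_on \<phi> P" "\<phi> \<in> extensional P"
  shows "\<phi> \<in> inj_homs G P Q"
  using assms by (auto simp: inj_homs_def mon_def hom_def)

lemma (in group) inj_homs_group_hom:
  assumes "\<phi> \<in> inj_homs G P Q" "subgroup P G" "subgroup Q G"
  shows "group_hom (G\<lparr>carrier := P\<rparr>) (G\<lparr>carrier := Q\<rparr>) \<phi>"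
  using assms subgroup_imp_group by (auto simp: inj_homs_def mon_def group_hom_def group_hom_axioms_def)

lemma (in group) inj_homs_image_subgroup:
  assumes "\<phi> \<in> inj_homs G P Q" "subgroup P G" "subgroup Q G"
  shows "subgroup (\<phi> ` P) G"
  using group_hom.img_is_subgroup[OF inj_homs_group_hom[OF assms]] incl_subgroup[OF assms(3)] by simp

lemma (in group) inj_homs_inv:
  assumes "\<phi> \<in> inj_homs G P Q" "subgroup P G" "subgroup Q G" "x \<in> P"
  shows "\<phi> (inv x) = inv (\<phi> x)"
  using group_hom.hom_inv[OF inj_homs_group_hom[OF assms(1-3)], of x] assms inj_homsD(1)[OF assms(1)]
  by (simp add: m_inv_consistent)

lemma (in group) conj_map_inj_homs:
  assumes "subgroup P G" "g \<in> carrier G" "conj_map G P g ` P \<subseteq> Q"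
  shows "conj_map G P g \<in> inj_homs G P Q"
proof (rule inj_homsI)
  note [simp] = subgroup.mem_carrier[OF assms(1)] subgroup.m_closed[OF assms(1)]
  show "conj_map G P g x \<in> Q" if "x \<in> P" for x using that assms(3) by blast
  show "conj_map G P g (x \<otimes> y) = conj_map G P g x \<otimes> conj_map G P g y" if "x \<in> P" "y \<in> P" for x y
    using that assms(2) by (simp add: conj_map_def m_assoc inv_mult_cancel)
  show "inj_on (conj_map G P g) P" using assms(2) by (auto simp: inj_on_def conj_map_def)
qed (simp add: conj_map_def)

lemma fusion_systemD:
  assumes "fusion_system G F"
  shows "\<phi> \<in> F P Q \<Longrightarrow> subgroup P G" "\<phi> \<in> F P Q \<Longrightarrow> subgroup Q G"
    "\<phi> \<in> F P Q \<Longrightarrow> \<phi> \<in> inj_homs G P Q"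
    "subgroup P G \<Longrightarrow> subgroup Q G \<Longrightarrow> g \<in> carrier G \<Longrightarrow> conj_map G P g ` P \<subseteq> Q \<Longrightarrow> conj_map G P g \<in> F P Q"
    "\<phi> \<in> F P Q \<Longrightarrow> \<psi> \<in> F Q R \<Longrightarrow> compose P \<psi> \<phi> \<in> F P R"
    "\<phi> \<in> F P Q \<Longrightarrow> \<phi> \<in> F P (\<phi> ` P)"
    "\<phi> \<in> F P Q \<Longrightarrow> restrict (inv_into P \<phi>) (\<phi> ` P) \<in> F (\<phi> ` P) P"
proof -
  have sub: "subgroup P G \<and> subgroup Q G" if "\<phi> \<in> F P Q" for \<phi> P Q
    using assms that unfolding fusion_system_def by blast
  then show "\<phi> \<in> F P Q \<Longrightarrow> subgroup P G" "\<phi> \<in> F P Q \<Longrightarrow> subgroup Q G" by blast+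
  show "\<phi> \<in> F P Q \<Longrightarrow> \<phi> \<in> inj_homs G P Q"
    using assms sub unfolding fusion_system_def by blast
  show "subgroup P G \<Longrightarrow> subgroup Q G \<Longrightarrow> g \<in> carrier G \<Longrightarrow> conj_map G P g ` P \<subseteq> Q \<Longrightarrow> conj_map G P g \<in> F P Q"
    using assms unfolding fusion_system_def conj_homs_def by blast
qed (use assms in \<open>simp_all add: fusion_system_def\<close>)

lemma fusion_systemI:
  assumes "\<And>\<phi> P Q. \<phi> \<in> F P Q \<Longrightarrow> subgroup P G \<and> subgroup Q G \<and> \<phi> \<in> inj_homs G P Q"
    "\<And>P Q g. subgroup P G \<Longrightarrow> subgroup Q G \<Longrightarrow> g \<in> carrier G \<Longrightarrow> conj_map G P g ` P \<subseteq> Q \<Longrightarrow> conj_map G P g \<in> F P Q"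
    "\<And>\<phi> \<psi> P Q R. \<phi> \<in> F P Q \<Longrightarrow> \<psi> \<in> F Q R \<Longrightarrow> compose P \<psi> \<phi> \<in> F P R"
    "\<And>\<phi> P Q. \<phi> \<in> F P Q \<Longrightarrow> \<phi> \<in> F P (\<phi> ` P) \<and> restrict (inv_into P \<phi>) (\<phi> ` P) \<in> F (\<phi> ` P) P"
  shows "fusion_system G F"
proof -
  have "\<forall>P Q. F P Q \<noteq> {} \<longrightarrow> subgroup P G \<and> subgroup Q G" using assms(1) by blast
  moreover have "\<forall>P Q. subgroup P G \<longrightarrow> subgroup Q G \<longrightarrow> conj_homs G P Q \<subseteq> F P Q \<and> F P Q \<subseteq> inj_homs G P Q"
    using assms(1,2) unfolding conj_homs_def by blast
  ultimately show ?thesis unfolding fusion_system_def using assms(3,4) by simp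
qed

lemma fusion_system_Inter:
  assumes "\<F> \<noteq> {}" "\<And>F. F \<in> \<F> \<Longrightarrow> fusion_system G F"
  shows "fusion_system G (\<lambda>P Q. \<Inter>F\<in>\<F>. F P Q)"
proof (rule fusion_systemI)
  obtain F0 where F0: "F0 \<in> \<F>" using assms(1) by blast
  show "subgroup P G \<and> subgroup Q G \<and> \<phi> \<in> inj_homs G P Q" if "\<phi> \<in> (\<Inter>F\<in>\<F>. F P Q)" for \<phi> P Q
  proof -
    have "\<phi> \<in> F0 P Q" using that F0 by blast
    then show ?thesis using fusion_systemD(1-3)[OF assms(2)[OF F0]] by blast
  qed
next
  fix \<phi> P Q assume \<phi>: "\<phi> \<in> (\<Inter>F\<in>\<F>. F P Q)"
  show "\<phi> \<in> (\<Inter>F\<in>\<F>. F P (\<phi> ` P)) \<and> restrict (inv_into P \<phi>) (\<phi> ` P) \<in> (\<Inter>F\<in>\<F>. F (\<phi> ` P) P)"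
  proof (intro conjI INT_I)
    fix F assume F: "F \<in> \<F>"
    then have "\<phi> \<in> F P Q" using \<phi> by blast
    then show "\<phi> \<in> F P (\<phi> ` P)" "restrict (inv_into P \<phi>) (\<phi> ` P) \<in> F (\<phi> ` P) P"
      using fusion_systemD(6,7)[OF assms(2)[OF F], of \<phi> P Q] by simp_all
  qed
next
  fix \<phi> \<psi> P Q R assume \<phi>: "\<phi> \<in> (\<Inter>F\<in>\<F>. F P Q)" and \<psi>: "\<psi> \<in> (\<Inter>F\<in>\<F>. F Q R)"
  show "compose P \<psi> \<phi> \<in> (\<Inter>F\<in>\<F>. F P R)"
  proof
    fix F assume F: "F \<in> \<F>"
    then have "\<phi> \<in> F P Q" "\<psi> \<in> F Q R" using \<phi> \<psi> by blast+
    then show "compose P \<psi> \<phi> \<in> F P R" by (rule fusion_systemD(5)[OF assms(2)[OF F]])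
  qed
qed (use fusion_systemD(4)[OF assms(2)] in auto)

lemma (in group) fusion_system_inj_homs:
  "fusion_system G (\<lambda>P Q. {\<phi> \<in> inj_homs G P Q. subgroup P G \<and> subgroup Q G})"
proof (rule fusion_systemI)
  fix \<phi> \<psi> P Q R assume \<phi>: "\<phi> \<in> {\<phi> \<in> inj_homs G P Q. subgroup P G \<and> subgroup Q G}"
    and \<psi>: "\<psi> \<in> {\<phi> \<in> inj_homs G Q R. subgroup Q G \<and> subgroup R G}"
  note f = inj_homsD[of \<phi> G P Q] and g = inj_homsD[of \<psi> G Q R]
  have "compose P \<psi> \<phi> \<in> inj_homs G P R"
  proof (rule inj_homsI)
    show "inj_on (compose P \<psi> \<phi>) P"
      using f g \<phi> \<psi> by (auto simp: inj_on_def compose_def)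
  qed (use f g \<phi> \<psi> in \<open>auto simp: compose_def subgroup.m_closed\<close>)
  then show "compose P \<psi> \<phi> \<in> {\<phi> \<in> inj_homs G P R. subgroup P G \<and> subgroup R G}" using \<phi> \<psi> by blast
next
  fix \<phi> P Q assume \<phi>: "\<phi> \<in> {\<phi> \<in> inj_homs G P Q. subgroup P G \<and> subgroup Q G}"
  then have f: "\<phi> \<in> inj_homs G P Q" "subgroup P G" "subgroup Q G" by auto
  note f' = inj_homsD[OF f(1)]
  have sub: "subgroup (\<phi> ` P) G" by (rule inj_homs_image_subgroup[OF f])
  have "\<phi> \<in> inj_homs G P (\<phi> ` P)" using f' by (intro inj_homsI) auto
  moreover have "restrict (inv_into P \<phi>) (\<phi> ` P) \<in> inj_homs G (\<phi> ` P) P"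
  proof (rule inj_homsI)
    fix x y assume "x \<in> \<phi> ` P" "y \<in> \<phi> ` P"
    then obtain a b where ab: "a \<in> P" "b \<in> P" "x = \<phi> a" "y = \<phi> b" by blast
    then have "x \<otimes> y = \<phi> (a \<otimes> b)" "a \<otimes> b \<in> P" using f' subgroup.m_closed[OF f(2)] by simp_all
    then show "restrict (inv_into P \<phi>) (\<phi> ` P) (x \<otimes> y) =
        restrict (inv_into P \<phi>) (\<phi> ` P) x \<otimes> restrict (inv_into P \<phi>) (\<phi> ` P) y"
      using ab f'(3) by simp
  qed (use f'(3) in \<open>auto simp: inj_on_inv_into inj_on_restrict_eq\<close>)
  ultimately show "\<phi> \<in> {\<phi>' \<in> inj_homs G P (\<phi> ` P). subgroup P G \<and> subgroup (\<phi> ` P) G} \<and>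
      restrict (inv_into P \<phi>) (\<phi> ` P) \<in> {\<phi>' \<in> inj_homs G (\<phi> ` P) P. subgroup (\<phi> ` P) G \<and> subgroup P G}"
    using f sub by blast
qed (use conj_map_inj_homs in auto)

lemma (in group) conj_map_one: "subgroup A G \<Longrightarrow> conj_map G A \<one> = (\<lambda>x\<in>A. x)"
  by (auto simp: conj_map_def fun_eq_iff subgroup.mem_carrier)

lemma (in group) fusion_incl:
  assumes "fusion_system G F" "subgroup A G" "subgroup B G" "A \<subseteq> B"
  shows "(\<lambda>x\<in>A. x) \<in> F A B"
  using fusion_systemD(4)[OF assms(1-3), of \<one>] conj_map_one[OF assms(2)] assms(4) by auto

lemma (in group) fusion_restrict:
  assumes F: "fusion_system G F" and \<phi>: "\<phi> \<in> F P Q" and A: "subgroup A G" "A \<subseteq> P"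
    and B: "subgroup B G" "\<phi> ` A \<subseteq> B"
  shows "restrict \<phi> A \<in> F A B"
proof -
  have "compose A \<phi> (\<lambda>x\<in>A. x) \<in> F A Q"
    using fusion_incl[OF F A(1) fusion_systemD(1)[OF F \<phi>] A(2)] \<phi> by (rule fusion_systemD(5)[OF F])
  moreover have "compose A \<phi> (\<lambda>x\<in>A. x) = restrict \<phi> A" by (auto simp: compose_def fun_eq_iff)
  ultimately have r: "restrict \<phi> A \<in> F A (restrict \<phi> A ` A)" using fusion_systemD(6)[OF F] by metis
  have "compose A (\<lambda>x\<in>restrict \<phi> A ` A. x) (restrict \<phi> A) \<in> F A B"
    using r by (rule fusion_systemD(5)[OF F])
      (use fusion_incl[OF F fusion_systemD(2)[OF F r] B(1)] B(2) in auto)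
  moreover have "compose A (\<lambda>x\<in>restrict \<phi> A ` A. x) (restrict \<phi> A) = restrict \<phi> A"
    by (auto simp: compose_def fun_eq_iff)
  ultimately show ?thesis by simp
qed

definition prod_fusion ::
    "('a, 'm) monoid_scheme \<Rightarrow> ('b, 'n) monoid_scheme \<Rightarrow> 'a hom_sets \<Rightarrow> 'b hom_sets \<Rightarrow> ('a \<times> 'b) hom_sets" where
  "prod_fusion G1 G2 F1 F2 P Q = {\<phi>. subgroup P (G1 \<times>\<times> G2) \<and> subgroup Q (G1 \<times>\<times> G2) \<and> \<phi> ` P \<subseteq> Q \<and>
     (\<exists>\<phi>1\<in>F1 (fst ` P) (fst ` Q). \<exists>\<phi>2\<in>F2 (snd ` P) (snd ` Q). \<phi> = restrict (map_prod \<phi>1 \<phi>2) P)}"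

lemma subgroup_DirProd_projections:
  assumes "group G1" "group G2" "subgroup P (G1 \<times>\<times> G2)"
  shows "subgroup (fst ` P) G1" "subgroup (snd ` P) G2"
proof -
  have "group_hom (G1 \<times>\<times> G2) G1 fst" "group_hom (G1 \<times>\<times> G2) G2 snd"
    using assms(1,2) DirProd_group[OF assms(1,2)] fst_hom_DirProd snd_hom_DirProd
    by (auto simp: group_hom_def group_hom_axioms_def)
  then show "subgroup (fst ` P) G1" "subgroup (snd ` P) G2"
    using group_hom.subgroup_img_is_subgroup assms(3) by blast+
qed

lemma restrict_map_prod_images:
  assumes "\<phi> = restrict (map_prod \<phi>1 \<phi>2) P"
  shows "fst ` \<phi> ` P = \<phi>1 ` fst ` P" "snd ` \<phi> ` P = \<phi>2 ` snd ` P"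
  using assms by (force simp: image_image)+

lemma fusion_system_prod_fusion:
  assumes G: "group G1" "group G2" and F1: "fusion_system G1 F1" and F2: "fusion_system G2 F2"
  shows "fusion_system (G1 \<times>\<times> G2) (prod_fusion G1 G2 F1 F2)"
proof -
  let ?G = "G1 \<times>\<times> G2" and ?F = "prod_fusion G1 G2 F1 F2"
  interpret G1: group G1 by fact
  interpret G2: group G2 by fact
  interpret G: group "?G" using G by (rule DirProd_group)
  have inj: "restrict (map_prod \<phi>1 \<phi>2) P \<in> inj_homs ?G P Q"
    if P: "subgroup P ?G" "restrict (map_prod \<phi>1 \<phi>2) P ` P \<subseteq> Q"
      and f: "\<phi>1 \<in> F1 (fst ` P) (fst ` Q)" "\<phi>2 \<in> F2 (snd ` P) (snd ` Q)" for P Q \<phi>1 \<phi>2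
  proof -
    note f1 = inj_homsD[OF fusion_systemD(3)[OF F1 f(1)]]
    note f2 = inj_homsD[OF fusion_systemD(3)[OF F2 f(2)]]
    have PF: "x \<in> fst ` P" "y \<in> snd ` P" if "(x, y) \<in> P" for x y using that by force+
    show ?thesis
    proof (rule inj_homsI)
      fix u v assume uv: "u \<in> P" "v \<in> P"
      obtain a b c d where [simp]: "u = (a, b)" "v = (c, d)" by (cases u, cases v)
      have "(a \<otimes>\<^bsub>G1\<^esub> c, b \<otimes>\<^bsub>G2\<^esub> d) \<in> P" using subgroup.m_closed[OF P(1) uv] by simp
      then show "restrict (map_prod \<phi>1 \<phi>2) P (u \<otimes>\<^bsub>?G\<^esub> v) =
          restrict (map_prod \<phi>1 \<phi>2) P u \<otimes>\<^bsub>?G\<^esub> restrict (map_prod \<phi>1 \<phi>2) P v"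
        using uv f1(2) f2(2) PF by auto
    next
      show "inj_on (restrict (map_prod \<phi>1 \<phi>2) P) P"
      proof (rule inj_onI)
        fix u v assume uv: "u \<in> P" "v \<in> P" and eq: "restrict (map_prod \<phi>1 \<phi>2) P u = restrict (map_prod \<phi>1 \<phi>2) P v"
        obtain a b c d where [simp]: "u = (a, b)" "v = (c, d)" by (cases u, cases v)
        have "\<phi>1 a = \<phi>1 c" "\<phi>2 b = \<phi>2 d" using eq uv by simp_all
        then show "u = v" using inj_onD[OF f1(3)] inj_onD[OF f2(3)] PF uv by simp
      qed
    qed (use P in auto)
  qed
  show ?thesis
  proof (rule fusion_systemI)
    show "subgroup P ?G \<and> subgroup Q ?G \<and> \<phi> \<in> inj_homs ?G P Q"
      if "\<phi> \<in> ?F P Q" for \<phi> P Q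
      using that inj unfolding prod_fusion_def by blast
  next
    fix P Q g assume P: "subgroup P ?G" and Q: "subgroup Q ?G" and g: "g \<in> carrier ?G"
      and im: "conj_map ?G P g ` P \<subseteq> Q"
    obtain g1 g2 where g12: "g = (g1, g2)" "g1 \<in> carrier G1" "g2 \<in> carrier G2" using g by auto
    have inv: "inv\<^bsub>?G\<^esub> g = (inv\<^bsub>G1\<^esub> g1, inv\<^bsub>G2\<^esub> g2)"
      using g12 G by (simp add: inv_DirProd)
    have eq: "conj_map ?G P g = restrict (map_prod (conj_map G1 (fst ` P) g1) (conj_map G2 (snd ` P) g2)) P"
      unfolding conj_map_def[of "?G"]
    proof (rule restrict_ext)
      fix z assume "z \<in> P"
      then obtain a b where "z = (a, b)" "a \<in> fst ` P" "b \<in> snd ` P" by (cases z) force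
      then show "inv\<^bsub>?G\<^esub> g \<otimes>\<^bsub>?G\<^esub> z \<otimes>\<^bsub>?G\<^esub> g =
          map_prod (conj_map G1 (fst ` P) g1) (conj_map G2 (snd ` P) g2) z"
        using inv g12(1) by (simp add: conj_map_def)
    qed
    note P12 = subgroup_DirProd_projections[OF G P] and Q12 = subgroup_DirProd_projections[OF G Q]
    have "conj_map G1 (fst ` P) g1 ` fst ` P \<subseteq> fst ` Q" "conj_map G2 (snd ` P) g2 ` snd ` P \<subseteq> snd ` Q"
      using image_mono[OF im, of fst] image_mono[OF im, of snd] by (simp_all only: restrict_map_prod_images[OF eq])
    then have "conj_map G1 (fst ` P) g1 \<in> F1 (fst ` P) (fst ` Q)" "conj_map G2 (snd ` P) g2 \<in> F2 (snd ` P) (snd ` Q)"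
      using fusion_systemD(4)[OF F1 P12(1) Q12(1) g12(2)] fusion_systemD(4)[OF F2 P12(2) Q12(2) g12(3)] by blast+
    then show "conj_map ?G P g \<in> ?F P Q"
      unfolding prod_fusion_def using P Q im eq by blast
  next
    fix \<phi> \<psi> P Q R assume "\<phi> \<in> ?F P Q" "\<psi> \<in> ?F Q R"
    then obtain \<phi>1 \<phi>2 \<psi>1 \<psi>2 where PQR: "subgroup P ?G" "subgroup R ?G" "\<phi> ` P \<subseteq> Q" "\<psi> ` Q \<subseteq> R"
      and f: "\<phi>1 \<in> F1 (fst ` P) (fst ` Q)" "\<phi>2 \<in> F2 (snd ` P) (snd ` Q)" "\<phi> = restrict (map_prod \<phi>1 \<phi>2) P"
      and g: "\<psi>1 \<in> F1 (fst ` Q) (fst ` R)" "\<psi>2 \<in> F2 (snd ` Q) (snd ` R)" "\<psi> = restrict (map_prod \<psi>1 \<psi>2) Q"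
      unfolding prod_fusion_def by blast
    have c: "compose (fst ` P) \<psi>1 \<phi>1 \<in> F1 (fst ` P) (fst ` R)" "compose (snd ` P) \<psi>2 \<phi>2 \<in> F2 (snd ` P) (snd ` R)"
      using fusion_systemD(5)[OF F1 f(1) g(1)] fusion_systemD(5)[OF F2 f(2) g(2)] .
    have "\<phi> x \<in> Q" if "x \<in> P" for x using that PQR(3) by blast
    then have Q: "\<phi> x \<in> Q" if "x \<in> P" for x using that .
    have "compose P \<psi> \<phi> = restrict (map_prod (compose (fst ` P) \<psi>1 \<phi>1) (compose (snd ` P) \<psi>2 \<phi>2)) P"
      unfolding compose_def
    proof (rule restrict_ext)
      fix z assume z: "z \<in> P"
      then obtain a b where ab: "z = (a, b)" "a \<in> fst ` P" "b \<in> snd ` P" by (cases z) force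
      then show "\<psi> (\<phi> z) = map_prod (\<lambda>x\<in>fst ` P. \<psi>1 (\<phi>1 x)) (\<lambda>x\<in>snd ` P. \<psi>2 (\<phi>2 x)) z"
        using z Q[OF z] by (simp add: f(3) g(3))
    qed
    moreover have "compose P \<psi> \<phi> ` P \<subseteq> R" using PQR(3,4) by (auto simp: compose_def)
    ultimately show "compose P \<psi> \<phi> \<in> ?F P R"
      unfolding prod_fusion_def using PQR c by blast
  next
    fix \<phi> P Q assume "\<phi> \<in> ?F P Q"
    then obtain \<phi>1 \<phi>2 where PQ: "subgroup P ?G" "subgroup Q ?G" "\<phi> ` P \<subseteq> Q"
      and f: "\<phi>1 \<in> F1 (fst ` P) (fst ` Q)" "\<phi>2 \<in> F2 (snd ` P) (snd ` Q)" "\<phi> = restrict (map_prod \<phi>1 \<phi>2) P"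
      unfolding prod_fusion_def by blast
    note im = restrict_map_prod_images[OF f(3)]
    have phi: "\<phi> \<in> inj_homs ?G P Q" using inj[OF PQ(1) _ f(1,2)] PQ(3) f(3) by blast
    have sub: "subgroup (\<phi> ` P) ?G" by (rule G.inj_homs_image_subgroup[OF phi PQ(1,2)])
    have inj12: "inj_on \<phi>1 (fst ` P)" "inj_on \<phi>2 (snd ` P)"
      using inj_homsD(3)[OF fusion_systemD(3)[OF F1 f(1)]] inj_homsD(3)[OF fusion_systemD(3)[OF F2 f(2)]] .
    define \<chi>1 where "\<chi>1 = restrict (inv_into (fst ` P) \<phi>1) (\<phi>1 ` fst ` P)"
    define \<chi>2 where "\<chi>2 = restrict (inv_into (snd ` P) \<phi>2) (\<phi>2 ` snd ` P)"
    have inv_eq: "restrict (inv_into P \<phi>) (\<phi> ` P) = restrict (map_prod \<chi>1 \<chi>2) (\<phi> ` P)"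
    proof (rule restrict_ext)
      fix z assume "z \<in> \<phi> ` P"
      then obtain a b where ab: "(a, b) \<in> P" "z = \<phi> (a, b)" by auto
      have m: "a \<in> fst ` P" "b \<in> snd ` P" using ab(1) by force+
      have z: "z = (\<phi>1 a, \<phi>2 b)" using ab by (simp add: f(3))
      have "inv_into P \<phi> z = (a, b)" using ab inj_homsD(3)[OF phi] by simp
      also have "(a, b) = map_prod \<chi>1 \<chi>2 z" using m inj12 by (simp add: z \<chi>1_def \<chi>2_def)
      finally show "inv_into P \<phi> z = map_prod \<chi>1 \<chi>2 z" .
    qed
    have inv_im: "restrict (inv_into P \<phi>) (\<phi> ` P) ` \<phi> ` P \<subseteq> P" by (auto simp: inv_into_into)
    show "\<phi> \<in> ?F P (\<phi> ` P) \<and>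
        restrict (inv_into P \<phi>) (\<phi> ` P) \<in> ?F (\<phi> ` P) P"
    proof
      show "\<phi> \<in> ?F P (\<phi> ` P)"
        unfolding prod_fusion_def im using fusion_systemD(6)[OF F1 f(1)] fusion_systemD(6)[OF F2 f(2)] PQ(1) sub f(3) by blast
      show "restrict (inv_into P \<phi>) (\<phi> ` P) \<in> ?F (\<phi> ` P) P"
        unfolding prod_fusion_def im
        using fusion_systemD(7)[OF F1 f(1)] fusion_systemD(7)[OF F2 f(2)] PQ(1) sub inv_im inv_eq
        unfolding \<chi>1_def[symmetric] \<chi>2_def[symmetric] by blast
    qed
  qed
qed

section \<open>The fusion system of an external direct product\<close>

lemma fusion_system_left_factor:
  assumes G: "group G1" "group G2" and F1: "fusion_system G1 F1" and F: "fusion_system (G1 \<times>\<times> G2) F"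
  shows "fusion_system G1 (\<lambda>A B. {\<phi> \<in> F1 A B.
    restrict (map_prod \<phi> id) (A \<times> carrier G2) \<in> F (A \<times> carrier G2) (B \<times> carrier G2)})"
proof (rule fusion_systemI)
  let ?X = "\<lambda>A B. {\<phi> \<in> F1 A B.
    restrict (map_prod \<phi> id) (A \<times> carrier G2) \<in> F (A \<times> carrier G2) (B \<times> carrier G2)}"
  let ?G = "G1 \<times>\<times> G2" and ?S = "carrier G2"
  interpret G2: group G2 by fact
  let ?e = "\<lambda>\<phi> A. restrict (map_prod \<phi> id) (A \<times> ?S)"
  {
    fix A B g assume A: "subgroup A G1" and B: "subgroup B G1" and g: "g \<in> carrier G1"
      and im: "conj_map G1 A g ` A \<subseteq> B"
    have c: "subgroup (A \<times> ?S) ?G" "subgroup (B \<times> ?S) ?G"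
      using DirProd_subgroups[OF G(1) A G(2) G2.subgroup_self] DirProd_subgroups[OF G(1) B G(2) G2.subgroup_self] by auto
    have gc: "(g, \<one>\<^bsub>G2\<^esub>) \<in> carrier ?G" using g by simp
    have eq: "conj_map ?G (A \<times> ?S) (g, \<one>\<^bsub>G2\<^esub>) = ?e (conj_map G1 A g) A"
      unfolding conj_map_def[of "?G"]
    proof (rule restrict_ext)
      fix z assume "z \<in> A \<times> ?S"
      then obtain a b where "z = (a, b)" "a \<in> A" "b \<in> ?S" by blast
      then show "inv\<^bsub>?G\<^esub> (g, \<one>\<^bsub>G2\<^esub>) \<otimes>\<^bsub>?G\<^esub> z \<otimes>\<^bsub>?G\<^esub> (g, \<one>\<^bsub>G2\<^esub>) =
          map_prod (conj_map G1 A g) id z"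
        using g G by (simp add: inv_DirProd conj_map_def)
    qed
    have "?e (conj_map G1 A g) A ` (A \<times> ?S) \<subseteq> B \<times> ?S" using im by auto
    then show "conj_map G1 A g \<in> ?X A B"
      using fusion_systemD(4)[OF F c gc, unfolded eq] fusion_systemD(4)[OF F1 A B g im] by simp
  next
    fix \<phi> \<psi> A B C
    assume \<phi>: "\<phi> \<in> ?X A B"
      and \<psi>: "\<psi> \<in> ?X B C"
    have "\<phi> a \<in> B" if "a \<in> A" for a
      using inj_homsD(1)[OF fusion_systemD(3)[OF F1, of \<phi> A B]] \<phi> that by simp
    then have "compose (A \<times> ?S) (?e \<psi> B) (?e \<phi> A) = ?e (compose A \<psi> \<phi>) A"
      by (auto simp: compose_def fun_eq_iff)
    then show "compose A \<psi> \<phi> \<in> ?X A C"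
      using fusion_systemD(5)[OF F, of "?e \<phi> A" "A \<times> ?S" "B \<times> ?S" "?e \<psi> B" "C \<times> ?S"]
        fusion_systemD(5)[OF F1, of \<phi> A B \<psi> C] \<phi> \<psi> by simp
  next
    fix \<phi> A B assume \<phi>: "\<phi> \<in> ?X A B"
    then have f: "\<phi> \<in> F1 A B" "?e \<phi> A \<in> F (A \<times> ?S) (B \<times> ?S)" by auto
    have im: "?e \<phi> A ` (A \<times> ?S) = (\<phi> ` A) \<times> ?S" by force
    have inj: "inj_on (?e \<phi> A) (A \<times> ?S)" "inj_on \<phi> A"
      using inj_homsD(3)[OF fusion_systemD(3)[OF F f(2)]] inj_homsD(3)[OF fusion_systemD(3)[OF F1 f(1)]] .
    have inv: "restrict (inv_into (A \<times> ?S) (?e \<phi> A)) ((\<phi> ` A) \<times> ?S) =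
        ?e (restrict (inv_into A \<phi>) (\<phi> ` A)) (\<phi> ` A)"
    proof (rule restrict_ext)
      fix z assume "z \<in> (\<phi> ` A) \<times> ?S"
      then obtain a c where z: "z = (\<phi> a, c)" "a \<in> A" "c \<in> ?S" by auto
      then have "z = ?e \<phi> A (a, c)" by simp
      then have "inv_into (A \<times> ?S) (?e \<phi> A) z = (a, c)" using inv_into_f_f[OF inj(1)] z(2,3) by blast
      then show "inv_into (A \<times> ?S) (?e \<phi> A) z = map_prod (restrict (inv_into A \<phi>) (\<phi> ` A)) id z"
        using z inj(2) by simp
    qed
    show "\<phi> \<in> ?X A (\<phi> ` A) \<and>
        restrict (inv_into A \<phi>) (\<phi> ` A) \<in>
          ?X (\<phi> ` A) A"
      using fusion_systemD(6,7)[OF F1 f(1)] fusion_systemD(6,7)[OF F f(2), unfolded im inv] by (intro conjI CollectI)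
  }
qed (use fusion_systemD(1-3)[OF F1] in auto)

lemma fusion_system_right_factor:
  assumes G: "group G1" "group G2" and F2: "fusion_system G2 F2" and F: "fusion_system (G1 \<times>\<times> G2) F"
  shows "fusion_system G2 (\<lambda>A B. {\<phi> \<in> F2 A B.
    restrict (map_prod id \<phi>) (carrier G1 \<times> A) \<in> F (carrier G1 \<times> A) (carrier G1 \<times> B)})"
proof (rule fusion_systemI)
  let ?X = "\<lambda>A B. {\<phi> \<in> F2 A B.
    restrict (map_prod id \<phi>) (carrier G1 \<times> A) \<in> F (carrier G1 \<times> A) (carrier G1 \<times> B)}"
  let ?G = "G1 \<times>\<times> G2" and ?S = "carrier G1"
  interpret G1: group G1 by fact
  let ?e = "\<lambda>\<phi> A. restrict (map_prod id \<phi>) (?S \<times> A)"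
  {
    fix A B g assume A: "subgroup A G2" and B: "subgroup B G2" and g: "g \<in> carrier G2"
      and im: "conj_map G2 A g ` A \<subseteq> B"
    have c: "subgroup (?S \<times> A) ?G" "subgroup (?S \<times> B) ?G"
      using DirProd_subgroups[OF G(1) G1.subgroup_self G(2) A] DirProd_subgroups[OF G(1) G1.subgroup_self G(2) B] by auto
    have gc: "(\<one>\<^bsub>G1\<^esub>, g) \<in> carrier ?G" using g by simp
    have eq: "conj_map ?G (?S \<times> A) (\<one>\<^bsub>G1\<^esub>, g) = ?e (conj_map G2 A g) A"
      unfolding conj_map_def[of "?G"]
    proof (rule restrict_ext)
      fix z assume "z \<in> ?S \<times> A"
      then obtain a b where "z = (b, a)" "a \<in> A" "b \<in> ?S" by blast
      then show "inv\<^bsub>?G\<^esub> (\<one>\<^bsub>G1\<^esub>, g) \<otimes>\<^bsub>?G\<^esub> z \<otimes>\<^bsub>?G\<^esub> (\<one>\<^bsub>G1\<^esub>, g) =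
          map_prod id (conj_map G2 A g) z"
        using g G by (simp add: inv_DirProd conj_map_def)
    qed
    have "?e (conj_map G2 A g) A ` (?S \<times> A) \<subseteq> ?S \<times> B" using im by auto
    then show "conj_map G2 A g \<in> ?X A B"
      using fusion_systemD(4)[OF F c gc, unfolded eq] fusion_systemD(4)[OF F2 A B g im] by simp
  next
    fix \<phi> \<psi> A B C
    assume \<phi>: "\<phi> \<in> ?X A B"
      and \<psi>: "\<psi> \<in> ?X B C"
    have "\<phi> a \<in> B" if "a \<in> A" for a
      using inj_homsD(1)[OF fusion_systemD(3)[OF F2, of \<phi> A B]] \<phi> that by simp
    then have "compose (?S \<times> A) (?e \<psi> B) (?e \<phi> A) = ?e (compose A \<psi> \<phi>) A"
      by (auto simp: compose_def fun_eq_iff)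
    then show "compose A \<psi> \<phi> \<in> ?X A C"
      using fusion_systemD(5)[OF F, of "?e \<phi> A" "?S \<times> A" "?S \<times> B" "?e \<psi> B" "?S \<times> C"]
        fusion_systemD(5)[OF F2, of \<phi> A B \<psi> C] \<phi> \<psi> by simp
  next
    fix \<phi> A B assume \<phi>: "\<phi> \<in> ?X A B"
    then have f: "\<phi> \<in> F2 A B" "?e \<phi> A \<in> F (?S \<times> A) (?S \<times> B)" by auto
    have im: "?e \<phi> A ` (?S \<times> A) = ?S \<times> (\<phi> ` A)" by force
    have inj: "inj_on (?e \<phi> A) (?S \<times> A)" "inj_on \<phi> A"
      using inj_homsD(3)[OF fusion_systemD(3)[OF F f(2)]] inj_homsD(3)[OF fusion_systemD(3)[OF F2 f(1)]] .
    have inv: "restrict (inv_into (?S \<times> A) (?e \<phi> A)) (?S \<times> (\<phi> ` A)) =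
        ?e (restrict (inv_into A \<phi>) (\<phi> ` A)) (\<phi> ` A)"
    proof (rule restrict_ext)
      fix z assume "z \<in> ?S \<times> (\<phi> ` A)"
      then obtain a c where z: "z = (c, \<phi> a)" "a \<in> A" "c \<in> ?S" by auto
      then have "z = ?e \<phi> A (c, a)" by simp
      then have "inv_into (?S \<times> A) (?e \<phi> A) z = (c, a)" using inv_into_f_f[OF inj(1)] z(2,3) by blast
      then show "inv_into (?S \<times> A) (?e \<phi> A) z = map_prod id (restrict (inv_into A \<phi>) (\<phi> ` A)) z"
        using z inj(2) by simp
    qed
    show "\<phi> \<in> ?X A (\<phi> ` A) \<and>
        restrict (inv_into A \<phi>) (\<phi> ` A) \<in>
          ?X (\<phi> ` A) A"
      using fusion_systemD(6,7)[OF F2 f(1)] fusion_systemD(6,7)[OF F f(2), unfolded im inv] by (intro conjI CollectI)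
  }
qed (use fusion_systemD(1-3)[OF F2] in auto)

lemma prod_fusion_subset:
  assumes G: "group G1" "group G2" and F1: "fusion_system G1 F1" and F2: "fusion_system G2 F2"
    and F: "fusion_system (G1 \<times>\<times> G2) F"
    and e1: "\<And>\<phi> A B. \<phi> \<in> F1 A B \<Longrightarrow>
      restrict (map_prod \<phi> id) (A \<times> carrier G2) \<in> F (A \<times> carrier G2) (B \<times> carrier G2)"
    and e2: "\<And>\<phi> A B. \<phi> \<in> F2 A B \<Longrightarrow>
      restrict (map_prod id \<phi>) (carrier G1 \<times> A) \<in> F (carrier G1 \<times> A) (carrier G1 \<times> B)"
  shows "prod_fusion G1 G2 F1 F2 P Q \<subseteq> F P Q"
proof
  let ?G = "G1 \<times>\<times> G2"
  interpret G: group "?G" using G by (rule DirProd_group)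
  fix \<phi> assume "\<phi> \<in> prod_fusion G1 G2 F1 F2 P Q"
  then obtain \<phi>1 \<phi>2 where P: "subgroup P ?G" and Q: "subgroup Q ?G" and im: "\<phi> ` P \<subseteq> Q"
    and f: "\<phi>1 \<in> F1 (fst ` P) (fst ` Q)" "\<phi>2 \<in> F2 (snd ` P) (snd ` Q)" and \<phi>: "\<phi> = restrict (map_prod \<phi>1 \<phi>2) P"
    unfolding prod_fusion_def by blast
  note P12 = subgroup_DirProd_projections[OF G P] and Q12 = subgroup_DirProd_projections[OF G Q]
  have sub: "subgroup (fst ` Q \<times> snd ` P) ?G" "subgroup (fst ` Q \<times> snd ` Q) ?G"
    using DirProd_subgroups[OF G(1) Q12(1) G(2) P12(2)] DirProd_subgroups[OF G(1) Q12(1) G(2) Q12(2)] .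
  have c: "fst ` Q \<subseteq> carrier G1" "snd ` P \<subseteq> carrier G2" using subgroup.subset Q12(1) P12(2) by blast+
  have m1: "\<phi>1 a \<in> fst ` Q" if "a \<in> fst ` P" for a using that inj_homsD(1)[OF fusion_systemD(3)[OF F1 f(1)]] by blast
  have m2: "\<phi>2 b \<in> snd ` Q" if "b \<in> snd ` P" for b using that inj_homsD(1)[OF fusion_systemD(3)[OF F2 f(2)]] by blast
  have mem: "a \<in> fst ` P \<and> b \<in> snd ` P" if "(a, b) \<in> P" for a b using that by force
  define \<alpha> where "\<alpha> = restrict (restrict (map_prod \<phi>1 id) (fst ` P \<times> carrier G2)) P"
  define \<beta> where "\<beta> = restrict (restrict (map_prod id \<phi>2) (carrier G1 \<times> snd ` P)) (fst ` Q \<times> snd ` P)"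
  have \<alpha>: "\<alpha> \<in> F P (fst ` Q \<times> snd ` P)"
    unfolding \<alpha>_def
  proof (rule G.fusion_restrict[OF F e1[OF f(1)] P _ sub(1)])
    show PA: "P \<subseteq> fst ` P \<times> carrier G2" using c(2) mem by auto
    show "restrict (map_prod \<phi>1 id) (fst ` P \<times> carrier G2) ` P \<subseteq> fst ` Q \<times> snd ` P"
    proof (clarify)
      fix x y a b assume "(a, b) \<in> P"
        "(x, y) = restrict (map_prod \<phi>1 id) (fst ` P \<times> carrier G2) (a, b)"
      then show "x \<in> fst ` Q \<and> y \<in> snd ` P" using m1 mem PA by auto
    qed
  qed
  have \<beta>: "\<beta> \<in> F (fst ` Q \<times> snd ` P) (fst ` Q \<times> snd ` Q)"
    unfolding \<beta>_def
  proof (rule G.fusion_restrict[OF F e2[OF f(2)] sub(1) _ sub(2)])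
    show "fst ` Q \<times> snd ` P \<subseteq> carrier G1 \<times> snd ` P" using c(1) by blast
    show "restrict (map_prod id \<phi>2) (carrier G1 \<times> snd ` P) ` (fst ` Q \<times> snd ` P) \<subseteq> fst ` Q \<times> snd ` Q"
    proof (rule image_subsetI)
      fix z assume "z \<in> fst ` Q \<times> snd ` P"
      then obtain a b where "z = (a, b)" "a \<in> fst ` Q" "b \<in> snd ` P" by blast
      then show "restrict (map_prod id \<phi>2) (carrier G1 \<times> snd ` P) z \<in> fst ` Q \<times> snd ` Q"
        using m2 subsetD[OF c(1)] by simp
    qed
  qed
  have "compose P \<beta> \<alpha> = \<phi>"
    unfolding compose_def \<phi>
  proof (rule restrict_ext)
    fix z assume z: "z \<in> P"
    obtain a b where ab: "z = (a, b)" by (cases z)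
    have m: "a \<in> fst ` P" "b \<in> snd ` P" "b \<in> carrier G2" using mem z ab c(2) by blast+
    then have "\<alpha> z = (\<phi>1 a, b)" using z ab by (simp add: \<alpha>_def)
    then show "\<beta> (\<alpha> z) = map_prod \<phi>1 \<phi>2 z" using m m1 c(1) ab by (simp add: \<beta>_def subsetD)
  qed
  then have \<phi>F: "\<phi> \<in> F P (fst ` Q \<times> snd ` Q)" using fusion_systemD(5)[OF F \<alpha> \<beta>] by simp
  have "restrict \<phi> P \<in> F P Q" by (rule G.fusion_restrict[OF F \<phi>F P _ Q im]) simp
  then show "\<phi> \<in> F P Q" by (simp add: \<phi>)
qed

context locality
begin

abbreviation "fusion \<equiv> locality_fusion L \<Delta> S"

definition contains_conj :: "'a hom_sets \<Rightarrow> bool" where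
  "contains_conj F \<longleftrightarrow> (\<forall>R\<in>\<Delta>. \<forall>g\<in>carrier L. R \<subseteq> conj_dom L g \<and> pconj L g ` R \<subseteq> S
     \<longrightarrow> restrict (pconj L g) R \<in> F R (pconj L g ` R))"

lemma contains_conjD:
  "contains_conj F \<Longrightarrow> R \<in> \<Delta> \<Longrightarrow> g \<in> carrier L \<Longrightarrow> R \<subseteq> conj_dom L g \<Longrightarrow> pconj L g ` R \<subseteq> S
    \<Longrightarrow> restrict (pconj L g) R \<in> F R (pconj L g ` R)"
  by (simp add: contains_conj_def)

lemma locality_fusion_minimal:
  assumes "fusion_system (group_of L S) F" "contains_conj F"
  shows "locality_fusion L \<Delta> S P Q \<subseteq> F P Q"
  unfolding locality_fusion_def using assms unfolding contains_conj_def by blast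

lemma fusion_generators:
  "contains_conj (locality_fusion L \<Delta> S)"
  unfolding locality_fusion_def contains_conj_def by blast

lemma conj_inj_homs:
  assumes R: "R \<in> \<Delta>" and g: "g \<in> carrier L" "R \<subseteq> conj_dom L g" "pconj L g ` R \<subseteq> S"
  shows "restrict (pconj L g) R \<in> inj_homs (group_of L S) R (pconj L g ` R)"
proof (rule inj_homsI)
  show "restrict (pconj L g) R (x \<otimes>\<^bsub>group_of L S\<^esub> y) =
      restrict (pconj L g) R x \<otimes>\<^bsub>group_of L S\<^esub> restrict (pconj L g) R y" if "x \<in> R" "y \<in> R" for x y
    using that conj_subgroup(2)[OF objectD[OF R] g that] pg_subgroupD(3)[OF objectD(1)[OF R], of "[x, y]"] by simp
  show "inj_on (restrict (pconj L g) R) R"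
    using inj_on_subset[OF inj_on_conj g(2)] by (simp add: inj_on_restrict_eq)
qed auto

lemma fusion_system_locality_fusion: "fusion_system (group_of L S) fusion"
proof -
  interpret S: group "group_of L S" by (rule group_group_of[OF S_subgroup])
  define \<F> where "\<F> = {F. fusion_system (group_of L S) F \<and> contains_conj F}"
  let ?U = "\<lambda>P Q. {\<phi> \<in> inj_homs (group_of L S) P Q. subgroup P (group_of L S) \<and> subgroup Q (group_of L S)}"
  have "contains_conj ?U"
    unfolding contains_conj_def
    using conj_inj_homs objectD conj_subgroup(1) subgroup_group_of_iff[OF S_subgroup] by simp
  then have "\<F> \<noteq> {}" using S.fusion_system_inj_homs unfolding \<F>_def by blast
  then have "fusion_system (group_of L S) (\<lambda>P Q. \<Inter>F\<in>\<F>. F P Q)"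
    by (rule fusion_system_Inter) (simp add: \<F>_def)
  moreover have "fusion = (\<lambda>P Q. \<Inter>F\<in>\<F>. F P Q)"
    unfolding locality_fusion_def \<F>_def contains_conj_def by (intro ext arg_cong[where f = Inter]) blast
  ultimately show ?thesis by simp
qed

end

context locality_pair
begin

abbreviation "G1 \<equiv> group_of L1 S1"
abbreviation "G2 \<equiv> group_of L2 S2"

lemma group_factors: "group G1" "group G2"
  using L1.group_group_of[OF L1.S_subgroup] L2.group_group_of[OF L2.S_subgroup] .

lemma locality_fusion_pg_prod:
  "locality_fusion L \<Delta> S = prod_fusion G1 G2 L1.fusion L2.fusion"
proof (intro ext subset_antisym)
  let ?F = "prod_fusion G1 G2 L1.fusion L2.fusion"
  interpret L: locality p L \<Delta> S by (rule locality_prod)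
  have GS: "group_of L S = G1 \<times>\<times> G2" by (rule group_of_pg_prod)
  note F = L.fusion_system_locality_fusion[unfolded GS]
  note F1 = L1.fusion_system_locality_fusion and F2 = L2.fusion_system_locality_fusion
  fix P Q
  show "L.fusion P Q \<subseteq> ?F P Q"
  proof (rule L.locality_fusion_minimal)
    show "fusion_system (group_of L S) (?F)"
      unfolding GS by (rule fusion_system_prod_fusion[OF group_factors F1 F2])
    show "L.contains_conj (?F)"
      unfolding L.contains_conj_def
    proof (intro ballI impI)
      fix R g assume R: "R \<in> \<Delta>" and g: "g \<in> carrier L" and h: "R \<subseteq> conj_dom L g \<and> pconj L g ` R \<subseteq> S"
      obtain g1 g2 where g12: "g = (g1, g2)" by (cases g)
      have gc: "g1 \<in> carrier L1" "g2 \<in> carrier L2" using g g12 by auto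
      note R12 = object_projections[OF R]
      have d: "fst ` R \<subseteq> conj_dom L1 g1" "snd ` R \<subseteq> conj_dom L2 g2"
        using subset_conj_dom_pg_prod[of R L1 L2 g1 g2] h g12 by auto
      have im: "fst ` pconj L g ` R = pconj L1 g1 ` fst ` R" "snd ` pconj L g ` R = pconj L2 g2 ` snd ` R"
        by (simp_all only: g12 pconj_pg_prod fst_snd_map_prod_image)
      have "fst ` pconj L g ` R \<subseteq> S1" "snd ` pconj L g ` R \<subseteq> S2" using h by auto
      then have f: "restrict (pconj L1 g1) (fst ` R) \<in> L1.fusion (fst ` R) (fst ` pconj L g ` R)"
        "restrict (pconj L2 g2) (snd ` R) \<in> L2.fusion (snd ` R) (snd ` pconj L g ` R)"
        unfolding im
        using L1.contains_conjD[OF L1.fusion_generators R12(1) gc(1) d(1)]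
          L2.contains_conjD[OF L2.fusion_generators R12(2) gc(2) d(2)] by simp_all
      have "restrict (pconj L g) R = restrict (map_prod (restrict (pconj L1 g1) (fst ` R)) (restrict (pconj L2 g2) (snd ` R))) R"
      proof (rule restrict_ext)
        fix z assume "z \<in> R"
        then obtain a b where "z = (a, b)" "a \<in> fst ` R" "b \<in> snd ` R" by (cases z) force
        then show "pconj L g z = map_prod (restrict (pconj L1 g1) (fst ` R)) (restrict (pconj L2 g2) (snd ` R)) z"
          by (simp add: g12 pconj_pg_prod)
      qed
      moreover have "subgroup R (G1 \<times>\<times> G2)" "subgroup (pconj L g ` R) (G1 \<times>\<times> G2)"
        using L.objectD[OF R] L.conj_subgroup(1)[OF L.objectD[OF R] g] h L.subgroup_group_of_iff[OF L.S_subgroup]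
        unfolding GS by auto
      moreover have "restrict (pconj L g) R ` R \<subseteq> pconj L g ` R" by auto
      ultimately show "restrict (pconj L g) R \<in> ?F R (pconj L g ` R)"
        unfolding prod_fusion_def using f by blast
    qed
  qed
  show "?F P Q \<subseteq> L.fusion P Q"
  proof (rule prod_fusion_subset[OF group_factors F1 F2 F])
    fix \<phi> A B assume "\<phi> \<in> L1.fusion A B"
    moreover have "L1.contains_conj (\<lambda>A B. {\<phi> \<in> L1.fusion A B.
        restrict (map_prod \<phi> id) (A \<times> carrier G2) \<in> L.fusion (A \<times> carrier G2) (B \<times> carrier G2)})"
      unfolding L1.contains_conj_def
    proof (intro ballI impI CollectI conjI)
      fix R g assume R: "R \<in> \<Delta>1" and g: "g \<in> carrier L1" and h: "R \<subseteq> conj_dom L1 g \<and> pconj L1 g ` R \<subseteq> S1"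
      show "restrict (pconj L1 g) R \<in> L1.fusion R (pconj L1 g ` R)"
        using L1.contains_conjD[OF L1.fusion_generators R g] h by simp
      let ?g = "(g, pprod L2 [])"
      have S2c: "b \<in> carrier L2" if "b \<in> S2" for b using L2.S_closed that .
      have im: "pconj L ?g ` (R \<times> S2) = (pconj L1 g ` R) \<times> S2"
        using L2.conj_by_one(2) S2c by (force simp: pconj_pg_prod)
      have "R \<times> S2 \<in> \<Delta>" using Times_object[OF R L2.S_object] .
      moreover have "?g \<in> carrier L" using g L2.one_closed by simp
      moreover have "R \<times> S2 \<subseteq> conj_dom L ?g" using h L2.conj_by_one(1) S2c by (auto simp: conj_dom_pg_prod)
      moreover have "pconj L ?g ` (R \<times> S2) \<subseteq> S" using h im by auto
      ultimately have "restrict (pconj L ?g) (R \<times> S2) \<in> L.fusion (R \<times> S2) (pconj L ?g ` (R \<times> S2))"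
        by (rule L.contains_conjD[OF L.fusion_generators])
      moreover have "restrict (pconj L ?g) (R \<times> S2) = restrict (map_prod (restrict (pconj L1 g) R) id) (R \<times> S2)"
        using L2.conj_by_one(2) S2c by (auto simp: pconj_pg_prod intro!: restrict_ext)
      ultimately show "restrict (map_prod (restrict (pconj L1 g) R) id) (R \<times> carrier G2) \<in>
          L.fusion (R \<times> carrier G2) ((pconj L1 g ` R) \<times> carrier G2)"
        unfolding im by simp
    qed
    ultimately show "restrict (map_prod \<phi> id) (A \<times> carrier G2) \<in> L.fusion (A \<times> carrier G2) (B \<times> carrier G2)"
      using L1.locality_fusion_minimal[OF fusion_system_left_factor[OF group_factors F1 F]] by blast
  next
    fix \<phi> A B assume "\<phi> \<in> L2.fusion A B"
    moreover have "L2.contains_conj (\<lambda>A B. {\<phi> \<in> L2.fusion A B.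
        restrict (map_prod id \<phi>) (carrier G1 \<times> A) \<in> L.fusion (carrier G1 \<times> A) (carrier G1 \<times> B)})"
      unfolding L2.contains_conj_def
    proof (intro ballI impI CollectI conjI)
      fix R g assume R: "R \<in> \<Delta>2" and g: "g \<in> carrier L2" and h: "R \<subseteq> conj_dom L2 g \<and> pconj L2 g ` R \<subseteq> S2"
      show "restrict (pconj L2 g) R \<in> L2.fusion R (pconj L2 g ` R)"
        using L2.contains_conjD[OF L2.fusion_generators R g] h by simp
      let ?g = "(pprod L1 [], g)"
      have S1c: "b \<in> carrier L1" if "b \<in> S1" for b using L1.S_closed that .
      have im: "pconj L ?g ` (S1 \<times> R) = S1 \<times> (pconj L2 g ` R)"
        using L1.conj_by_one(2) S1c by (force simp: pconj_pg_prod)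
      have "S1 \<times> R \<in> \<Delta>" using Times_object[OF L1.S_object R] .
      moreover have "?g \<in> carrier L" using g L1.one_closed by simp
      moreover have "S1 \<times> R \<subseteq> conj_dom L ?g" using h L1.conj_by_one(1) S1c by (auto simp: conj_dom_pg_prod)
      moreover have "pconj L ?g ` (S1 \<times> R) \<subseteq> S" using h im by auto
      ultimately have "restrict (pconj L ?g) (S1 \<times> R) \<in> L.fusion (S1 \<times> R) (pconj L ?g ` (S1 \<times> R))"
        by (rule L.contains_conjD[OF L.fusion_generators])
      moreover have "restrict (pconj L ?g) (S1 \<times> R) = restrict (map_prod id (restrict (pconj L2 g) R)) (S1 \<times> R)"
        using L1.conj_by_one(2) S1c by (auto simp: pconj_pg_prod intro!: restrict_ext)
      ultimately show "restrict (map_prod id (restrict (pconj L2 g) R)) (carrier G1 \<times> R) \<in>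
          L.fusion (carrier G1 \<times> R) (carrier G1 \<times> (pconj L2 g ` R))"
        unfolding im by simp
    qed
    ultimately show "restrict (map_prod id \<phi>) (carrier G1 \<times> A) \<in> L.fusion (carrier G1 \<times> A) (carrier G1 \<times> B)"
      using L2.locality_fusion_minimal[OF fusion_system_right_factor[OF group_factors F2 F]] by blast
  qed
qed

end

section \<open>Centric radical subgroups of a product\<close>

lemma (in group) conj_image_eqI:
  assumes "finite P" "P \<subseteq> carrier G" "h \<in> carrier G" "\<And>x. x \<in> P \<Longrightarrow> inv h \<otimes> x \<otimes> h \<in> P"
  shows "(\<lambda>x. inv h \<otimes> x \<otimes> h) ` P = P"
proof (rule endo_inj_surj[OF assms(1)])
  show "inj_on (\<lambda>x. inv h \<otimes> x \<otimes> h) P" using assms(2,3) by (auto simp: inj_on_def subset_iff)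
qed (use assms(4) in blast)

lemma (in group) relative_normalizer_subgroup:
  assumes Q: "subgroup Q G" and P: "finite P" "P \<subseteq> carrier G"
  shows "subgroup {h \<in> Q. (\<lambda>x. inv h \<otimes> x \<otimes> h) ` P = P} G"
proof (rule subgroupI)
  let ?H = "{h \<in> Q. (\<lambda>x. inv h \<otimes> x \<otimes> h) ` P = P}"
  have HI: "h \<in> ?H" if "h \<in> Q" "\<And>x. x \<in> P \<Longrightarrow> inv h \<otimes> x \<otimes> h \<in> P" for h
    using conj_image_eqI[OF P subgroup.mem_carrier[OF Q that(1)] that(2)] that(1) by simp
  have Pc [simp]: "x \<in> carrier G" if "x \<in> P" for x using P(2) that by blast
  have HD: "inv h \<otimes> x \<otimes> h \<in> P" if "h \<in> ?H" "x \<in> P" for h x using that by auto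
  show "?H \<subseteq> carrier G" using subgroup.subset[OF Q] by blast
  have "\<one> \<in> ?H" using subgroup.one_closed[OF Q] by (intro HI) simp_all
  then show "?H \<noteq> {}" by blast
  fix a assume a: "a \<in> ?H"
  have aQ: "a \<in> Q" and ac [simp]: "a \<in> carrier G" using a subgroup.mem_carrier[OF Q] by auto
  show "inv a \<in> ?H"
  proof (rule HI)
    show "inv a \<in> Q" using subgroup.m_inv_closed[OF Q aQ] .
    fix x assume "x \<in> P"
    then have "x \<in> (\<lambda>x. inv a \<otimes> x \<otimes> a) ` P" using a by simp
    then obtain y where y: "y \<in> P" "x = inv a \<otimes> y \<otimes> a" by blast
    have "inv (inv a) \<otimes> x \<otimes> inv a = y" using y by (simp add: m_assoc inv_mult_cancel)
    then show "inv (inv a) \<otimes> x \<otimes> inv a \<in> P" using y(1) by simp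
  qed
  fix b assume b: "b \<in> ?H"
  have bQ: "b \<in> Q" and bc [simp]: "b \<in> carrier G" using b subgroup.mem_carrier[OF Q] by auto
  show "a \<otimes> b \<in> ?H"
  proof (rule HI)
    show "a \<otimes> b \<in> Q" using subgroup.m_closed[OF Q aQ bQ] .
    fix x assume x: "x \<in> P"
    have "inv (a \<otimes> b) \<otimes> x \<otimes> (a \<otimes> b) = inv b \<otimes> (inv a \<otimes> x \<otimes> a) \<otimes> b"
      using x by (simp add: m_assoc inv_mult_group)
    then show "inv (a \<otimes> b) \<otimes> x \<otimes> (a \<otimes> b) \<in> P" using HD[OF b HD[OF a x]] by simp
  qed
qed

lemma (in group) conj_map_eq_centralizer:
  assumes eq: "conj_map G P g = conj_map G P y" and c: "g \<in> carrier G" "y \<in> carrier G" "P \<subseteq> carrier G"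
  shows "y \<otimes> inv g \<in> centralizer G P"
proof -
  have "y \<otimes> inv g \<otimes> x = x \<otimes> (y \<otimes> inv g)" if x: "x \<in> P" for x
  proof -
    have xc: "x \<in> carrier G" using x c(3) by blast
    have "inv g \<otimes> x \<otimes> g = inv y \<otimes> x \<otimes> y" using fun_cong[OF eq, of x] x by (simp add: conj_map_def)
    then have "y \<otimes> (inv g \<otimes> x \<otimes> g) \<otimes> inv g = y \<otimes> (inv y \<otimes> x \<otimes> y) \<otimes> inv g" by simp
    then show ?thesis using c xc by (simp add: m_assoc inv_mult_cancel)
  qed
  then show ?thesis using c by (simp add: centralizer_def)
qed

locale finite_fusion = group G for G (structure) +
  fixes p :: nat and F :: "'a hom_sets"
  assumes fusion_system: "fusion_system G F"
    and prime_p: "prime p"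
    and p_group: "\<exists>n. card (carrier G) = p ^ n"
begin

lemma finite_G: "finite (carrier G)"
  using p_group prime_p by (metis card.infinite not_prime_0 power_not_zero)

lemma p_subgroup: "subgroup H G \<Longrightarrow> \<exists>n. card H = p ^ n"
  using p_group prime_power_card_subgroup[OF finite_G prime_p subgroup_self _ subgroup.subset] by blast

lemma finite_subgroup: "subgroup H G \<Longrightarrow> finite H"
  using finite_G finite_subset subgroup.subset by blast

lemma automorphism:
  assumes "\<phi> \<in> F P P"
  shows "\<phi> \<in> Bij P" "\<phi> ` P = P" "inj_on \<phi> P"
proof -
  note i = inj_homsD[OF fusion_systemD(3)[OF fusion_system assms]]
  have P: "finite P" using finite_subgroup[OF fusion_systemD(1)[OF fusion_system assms]] .
  have "\<phi> ` P \<subseteq> P" using i(1) by blast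
  then show "\<phi> ` P = P" using endo_inj_surj[OF P _ i(3)] by blast
  then show "\<phi> \<in> Bij P" using i(3,4) by (simp add: Bij_def bij_betw_def)
  show "inj_on \<phi> P" by (rule i(3))
qed

lemma Aut_group_sel [simp]:
  "carrier (Aut_group F P) = F P P" "\<one>\<^bsub>Aut_group F P\<^esub> = (\<lambda>x\<in>P. x)"
  by (simp_all add: Aut_group_def BijGroup_def)

lemma Aut_group_mult:
  "\<phi> \<in> F P P \<Longrightarrow> \<psi> \<in> F P P \<Longrightarrow> \<phi> \<otimes>\<^bsub>Aut_group F P\<^esub> \<psi> = compose P \<phi> \<psi>"
  using automorphism(1) by (simp add: Aut_group_def BijGroup_def)

lemma group_Aut_group:
  assumes P: "subgroup P G"
  shows "group (Aut_group F P)"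
proof -
  have "subgroup (F P P) (BijGroup P)"
  proof (rule subgroup.intro)
    show "F P P \<subseteq> carrier (BijGroup P)" using automorphism(1) by (auto simp: BijGroup_def)
    show "\<one>\<^bsub>BijGroup P\<^esub> \<in> F P P"
      using fusion_incl[OF fusion_system P P] by (simp add: BijGroup_def)
    fix \<phi> assume \<phi>: "\<phi> \<in> F P P"
    show "inv\<^bsub>BijGroup P\<^esub> \<phi> \<in> F P P"
      using fusion_systemD(7)[OF fusion_system \<phi>] automorphism[OF \<phi>] by (simp add: inv_BijGroup)
    fix \<psi> assume \<psi>: "\<psi> \<in> F P P"
    show "\<phi> \<otimes>\<^bsub>BijGroup P\<^esub> \<psi> \<in> F P P"
      using fusion_systemD(5)[OF fusion_system \<psi> \<phi>] automorphism(1)[OF \<phi>] automorphism(1)[OF \<psi>]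
      by (simp add: BijGroup_def)
  qed
  then show ?thesis unfolding Aut_group_def by (rule subgroup.subgroup_is_group[OF _ group_BijGroup])
qed

lemma finite_automorphisms:
  assumes P: "subgroup P G"
  shows "finite (F P P)"
proof (rule finite_subset)
  show "F P P \<subseteq> (\<Pi>\<^sub>E x\<in>P. P)"
    using automorphism(1) Bij_imp_funcset Bij_imp_extensional by (force simp: PiE_def)
  show "finite (\<Pi>\<^sub>E x\<in>P. P)" using finite_subgroup[OF P] by (intro finite_PiE)
qed

lemma conj_maps_subset_p_core:
  assumes P: "subgroup P G" and H: "subgroup H G"
    and norm: "\<And>h x. h \<in> H \<Longrightarrow> x \<in> P \<Longrightarrow> inv h \<otimes> x \<otimes> h \<in> P"
    and ex: "\<And>\<phi> h. \<phi> \<in> F P P \<Longrightarrow> h \<in> H \<Longrightarrow> \<exists>h'\<in>H. \<forall>x\<in>P. \<phi> (inv h \<otimes> x \<otimes> h) = inv h' \<otimes> \<phi> x \<otimes> h'"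
  shows "conj_map G P ` H \<subseteq> p_core p (Aut_group F P)"
proof -
  let ?A = "Aut_group F P" and ?c = "conj_map G P"
  interpret A: group ?A by (rule group_Aut_group[OF P])
  note [simp] = subgroup.mem_carrier[OF P] subgroup.mem_carrier[OF H] subgroup.m_closed[OF H] subgroup.m_inv_closed[OF H]
  have c: "?c h \<in> F P P" if h: "h \<in> H" for h
  proof (rule fusion_systemD(4)[OF fusion_system P P])
    show "?c h ` P \<subseteq> P" using norm[OF h] by (auto simp: conj_map_def)
  qed (use h in simp)
  have mult: "?c h \<otimes>\<^bsub>?A\<^esub> ?c k = ?c (k \<otimes> h)" if hk: "h \<in> H" "k \<in> H" for h k
    unfolding Aut_group_mult[OF c[OF hk(1)] c[OF hk(2)]] compose_def conj_map_def[of G P "k \<otimes> h"]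
    by (rule restrict_ext) (use hk norm in \<open>simp add: conj_map_def inv_mult_group m_assoc\<close>)
  have one: "?c \<one> = \<one>\<^bsub>?A\<^esub>" using conj_map_one[OF P] by simp
  have one_H: "\<one> \<in> H" using subgroup.one_closed[OF H] .
  have sub: "subgroup (?c ` H) ?A"
  proof (rule A.subgroupI)
    fix a assume "a \<in> ?c ` H"
    then obtain h where h: "h \<in> H" "a = ?c h" by blast
    have "?c (inv h) \<otimes>\<^bsub>?A\<^esub> ?c h = \<one>\<^bsub>?A\<^esub>" using mult[of "inv h" h] h one by simp
    then have "inv\<^bsub>?A\<^esub> a = ?c (inv h)" using A.inv_equality c h by simp
    then show "inv\<^bsub>?A\<^esub> a \<in> ?c ` H" using h by simp
    fix b assume "b \<in> ?c ` H"
    then obtain k where "k \<in> H" "b = ?c k" by blast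
    then show "a \<otimes>\<^bsub>?A\<^esub> b \<in> ?c ` H" using mult h by simp
  qed (use c one_H in auto)
  have normal: "?c ` H \<lhd> ?A"
  proof (rule A.normal_invI[OF sub])
    fix \<phi> a assume \<phi>: "\<phi> \<in> carrier ?A" and "a \<in> ?c ` H"
    then obtain h where h: "h \<in> H" "a = ?c h" by blast
    have \<phi>': "\<phi> \<in> F P P" using \<phi> by simp
    obtain h' where h': "h' \<in> H" "\<And>x. x \<in> P \<Longrightarrow> \<phi> (inv h \<otimes> x \<otimes> h) = inv h' \<otimes> \<phi> x \<otimes> h'"
      using ex[OF \<phi>' h(1)] by blast
    have "\<phi> x \<in> P" if "x \<in> P" for x using that automorphism(2)[OF \<phi>'] by blast
    then have "compose P \<phi> (?c h) = compose P (?c h') \<phi>"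
      using h'(2) unfolding compose_def by (intro restrict_ext) (simp add: conj_map_def)
    then have "\<phi> \<otimes>\<^bsub>?A\<^esub> a = ?c h' \<otimes>\<^bsub>?A\<^esub> \<phi>"
      using Aut_group_mult c h h'(1) \<phi>' by simp
    moreover have cA: "?c h' \<in> carrier ?A" using c[OF h'(1)] by simp
    ultimately have "\<phi> \<otimes>\<^bsub>?A\<^esub> a \<otimes>\<^bsub>?A\<^esub> inv\<^bsub>?A\<^esub> \<phi> = ?c h'"
      using \<phi> cA by (simp add: A.m_assoc del: Aut_group_sel)
    then show "\<phi> \<otimes>\<^bsub>?A\<^esub> a \<otimes>\<^bsub>?A\<^esub> inv\<^bsub>?A\<^esub> \<phi> \<in> ?c ` H" using h'(1) by simp
  qed
  have pow_H: "h [^] k \<in> H" if "h \<in> H" for h and k :: nat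
    using that one_H by (induction k) simp_all
  have pow: "?c h [^]\<^bsub>?A\<^esub> k = ?c (h [^] k)" if h: "h \<in> H" for h and k :: nat
  proof (induction k)
    case (Suc k)
    have "?c h [^]\<^bsub>?A\<^esub> Suc k = ?c (h \<otimes> h [^] k)"
      using Suc mult[OF pow_H[OF h, of k] h] by simp
    then show ?case using h by (simp only: nat_pow_Suc2[of h] subgroup.mem_carrier[OF H])
  qed (use one in simp)
  have "\<exists>k::nat. a [^]\<^bsub>?A\<^esub> (p ^ k) = \<one>\<^bsub>?A\<^esub>" if a: "a \<in> ?c ` H" for a
  proof -
    obtain h where h: "h \<in> H" "a = ?c h" using a by blast
    then obtain k :: nat where "h [^] (p ^ k) = \<one>"
      using p_subgroup[OF H] prime_power_card_iff[OF finite_G prime_p H] by blast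
    then have "a [^]\<^bsub>?A\<^esub> (p ^ k) = \<one>\<^bsub>?A\<^esub>" using pow[OF h(1)] one h(2) by metis
    then show ?thesis by blast
  qed
  then have "\<exists>n. card (?c ` H) = p ^ n"
    using A.prime_power_card_iff[OF _ prime_p sub] finite_automorphisms[OF P] by simp
  then show ?thesis using A.normal_p_subset_p_core[OF normal] by blast
qed

lemma Inn_subset_p_core:
  assumes P: "subgroup P G"
  shows "Inn G P \<subseteq> p_core p (Aut_group F P)"
  unfolding Inn_def
proof (rule conj_maps_subset_p_core[OF P P])
  note [simp] = subgroup.m_closed[OF P] subgroup.m_inv_closed[OF P]
  show "inv h \<otimes> x \<otimes> h \<in> P" if "h \<in> P" "x \<in> P" for h x using that by simp
  fix \<phi> h assume \<phi>: "\<phi> \<in> F P P" and h: "h \<in> P"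
  note i = fusion_systemD(3)[OF fusion_system \<phi>]
  show "\<exists>h'\<in>P. \<forall>x\<in>P. \<phi> (inv h \<otimes> x \<otimes> h) = inv h' \<otimes> \<phi> x \<otimes> h'"
    using h inj_homsD(1,2)[OF i] inj_homs_inv[OF i P P] by (intro bexI[of _ "\<phi> h"]) simp_all
qed

lemma conjugates_subgroup:
  assumes "Q \<in> conjugates F P"
  shows "subgroup Q G"
  using assms fusion_systemD(2)[OF fusion_system] by (auto simp: conjugates_def)

lemma self_conjugate: "subgroup P G \<Longrightarrow> P \<in> conjugates F P"
  using fusion_incl[OF fusion_system, of P P] by (auto simp: conjugates_def intro!: bexI[of _ "\<lambda>x\<in>P. x"])

lemma centric_radical_eq_overgroup:
  assumes cr: "P \<in> centric_radicals p G F" and Q: "subgroup Q G" "P \<subseteq> Q"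
    and ext: "\<And>\<phi>. \<phi> \<in> F P P \<Longrightarrow> \<exists>\<phi>'\<in>inj_homs G Q Q. \<forall>x\<in>P. \<phi>' x = \<phi> x"
  shows "P = Q"
proof (rule ccontr)
  assume "P \<noteq> Q"
  then have PQ: "P \<subset> Q" using Q(2) by blast
  have P: "subgroup P G" and rad: "p_core p (Aut_group F P) = Inn G P" and cent: "centralizer G P \<subseteq> P"
    using cr self_conjugate[of P] by (auto simp: centric_radicals_def centric_def radical_def)
  obtain n where n: "card Q = p ^ n" using p_subgroup[OF Q(1)] by blast
  obtain g where g: "g \<in> Q" "g \<notin> P" "(\<lambda>y. inv g \<otimes> y \<otimes> g) ` P = P"
    using normalizers_grow[OF finite_G prime_p Q(1) n P PQ] by blast
  define H where "H = {h \<in> Q. (\<lambda>y. inv h \<otimes> y \<otimes> h) ` P = P}"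
  have Qc: "h \<in> carrier G" if "h \<in> Q" for h using that subgroup.mem_carrier[OF Q(1)] by blast
  have finP: "finite P" using finite_subgroup[OF P] .
  have Psub: "P \<subseteq> carrier G" by (rule subgroup.subset[OF P])
  have norm: "inv h \<otimes> x \<otimes> h \<in> P" if "h \<in> H" "x \<in> P" for h x using that by (auto simp: H_def)
  have HI: "h \<in> H" if h: "h \<in> Q" "\<And>x. x \<in> P \<Longrightarrow> inv h \<otimes> x \<otimes> h \<in> P" for h
    using h(1) conj_image_eqI[OF finP Psub Qc[OF h(1)] h(2)] by (simp add: H_def)
  have H: "subgroup H G"
    unfolding H_def by (rule relative_normalizer_subgroup[OF Q(1) finP Psub])
  have "conj_map G P ` H \<subseteq> p_core p (Aut_group F P)"
  proof (rule conj_maps_subset_p_core[OF P H norm])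
    fix \<phi> h assume \<phi>: "\<phi> \<in> F P P" and h: "h \<in> H"
    obtain \<phi>' where i: "\<phi>' \<in> inj_homs G Q Q" and e: "\<And>x. x \<in> P \<Longrightarrow> \<phi>' x = \<phi> x"
      using ext[OF \<phi>] by blast
    have hQ: "h \<in> Q" using h by (simp add: H_def)
    have eq: "\<phi> (inv h \<otimes> x \<otimes> h) = inv (\<phi>' h) \<otimes> \<phi> x \<otimes> \<phi>' h" if x: "x \<in> P" for x
    proof -
      have "x \<in> Q" using x Q(2) by blast
      then have "\<phi>' (inv h \<otimes> x \<otimes> h) = inv (\<phi>' h) \<otimes> \<phi>' x \<otimes> \<phi>' h"
        using inj_homsD(2)[OF i] inj_homs_inv[OF i Q(1) Q(1)] hQ
          subgroup.m_closed[OF Q(1)] subgroup.m_inv_closed[OF Q(1)] by simp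
      then show ?thesis using e x norm[OF h x] by simp
    qed
    have "\<phi>' h \<in> H"
    proof (rule HI)
      show "\<phi>' h \<in> Q" using inj_homsD(1)[OF i hQ] .
      fix y assume "y \<in> P"
      then obtain x where x: "x \<in> P" "y = \<phi> x" using automorphism(2)[OF \<phi>] by blast
      show "inv (\<phi>' h) \<otimes> y \<otimes> \<phi>' h \<in> P"
        unfolding x(2) eq[OF x(1), symmetric] using norm[OF h x(1)] automorphism(2)[OF \<phi>] by blast
    qed
    then show "\<exists>h'\<in>H. \<forall>x\<in>P. \<phi> (inv h \<otimes> x \<otimes> h) = inv h' \<otimes> \<phi> x \<otimes> h'" using eq by blast
  qed
  moreover have "g \<in> H" using g by (simp add: H_def)
  ultimately have "conj_map G P g \<in> Inn G P" using rad by blast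
  then obtain y where y: "y \<in> P" "conj_map G P g = conj_map G P y" by (auto simp: Inn_def)
  have gc: "g \<in> carrier G" and yc: "y \<in> carrier G" using g(1) Qc y(1) Psub by blast+
  have "y \<otimes> inv g \<in> P" using conj_map_eq_centralizer[OF y(2) gc yc Psub] cent by blast
  then have "inv (y \<otimes> inv g) \<otimes> y \<in> P"
    using subgroup.m_closed[OF P subgroup.m_inv_closed[OF P] y(1)] by blast
  moreover have "inv (y \<otimes> inv g) \<otimes> y = g" using gc yc by (simp add: inv_mult_group m_assoc)
  ultimately show False using g(2) by simp
qed

end

locale fusion_pair = F1: finite_fusion G1 p F1 + F2: finite_fusion G2 p F2
  for p :: nat and G1 :: "'a monoid" and F1 and G2 :: "'b monoid" and F2
begin

abbreviation "G \<equiv> G1 \<times>\<times> G2"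
abbreviation "F \<equiv> prod_fusion G1 G2 F1 F2"

sublocale F: finite_fusion G p F
proof (intro finite_fusion.intro finite_fusion_axioms.intro)
  show "group G" using F1.is_group F2.is_group by (rule DirProd_group)
  show "fusion_system G F"
    using F1.is_group F2.is_group F1.fusion_system F2.fusion_system by (rule fusion_system_prod_fusion)
  show "prime p" by (rule F1.prime_p)
  show "\<exists>n. card (carrier G) = p ^ n"
    using F1.p_group F2.p_group by (auto simp: card_cartesian_product simp flip: power_add)
qed

lemma inv_G: "a \<in> carrier G1 \<Longrightarrow> b \<in> carrier G2 \<Longrightarrow> inv\<^bsub>G\<^esub> (a, b) = (inv\<^bsub>G1\<^esub> a, inv\<^bsub>G2\<^esub> b)"
  using F1.is_group F2.is_group by (rule inv_DirProd)

lemma centric_radical_eq_Times: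
  assumes P: "P \<in> centric_radicals p G F"
  shows "P = fst ` P \<times> snd ` P"
proof (rule F.centric_radical_eq_overgroup[OF P])
  have "subgroup P G" using P by (simp add: centric_radicals_def centric_def)
  note P12 = subgroup_DirProd_projections[OF F1.is_group F2.is_group this]
  let ?Q = "fst ` P \<times> snd ` P"
  show Q: "subgroup ?Q G" using DirProd_subgroups[OF F1.is_group P12(1) F2.is_group P12(2)] .
  show PQ: "P \<subseteq> ?Q" by force
  fix \<phi> assume "\<phi> \<in> F P P"
  then obtain \<phi>1 \<phi>2 where f: "\<phi>1 \<in> F1 (fst ` P) (fst ` P)" "\<phi>2 \<in> F2 (snd ` P) (snd ` P)"
    "\<phi> = restrict (map_prod \<phi>1 \<phi>2) P" unfolding prod_fusion_def by blast
  have Q12: "fst ` ?Q = fst ` P" "snd ` ?Q = snd ` P" by force+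
  let ?\<phi> = "restrict (map_prod \<phi>1 \<phi>2) ?Q"
  have m1: "\<phi>1 a \<in> fst ` P" if "a \<in> fst ` P" for a using that F1.automorphism(2)[OF f(1)] by blast
  have m2: "\<phi>2 b \<in> snd ` P" if "b \<in> snd ` P" for b using that F2.automorphism(2)[OF f(2)] by blast
  have "?\<phi> ` ?Q \<subseteq> ?Q"
  proof (rule image_subsetI)
    fix z assume "z \<in> ?Q"
    then obtain a b where "z = (a, b)" "a \<in> fst ` P" "b \<in> snd ` P" by blast
    then show "?\<phi> z \<in> ?Q" using m1 m2 by simp
  qed
  then have "?\<phi> \<in> F ?Q ?Q" unfolding prod_fusion_def Q12 using Q f(1,2) by blast
  then have "?\<phi> \<in> inj_homs G ?Q ?Q" by (rule fusion_systemD(3)[OF F.fusion_system])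
  moreover have "?\<phi> x = \<phi> x" if "x \<in> P" for x using that PQ f(3) by auto
  ultimately show "\<exists>\<phi>'\<in>inj_homs G ?Q ?Q. \<forall>x\<in>P. \<phi>' x = \<phi> x" by blast
qed

end

context fusion_pair
begin

context
  fixes A :: "'a set" and B :: "'b set"
  assumes A: "subgroup A G1" and B: "subgroup B G2"
begin

definition pair_map :: "('a \<Rightarrow> 'a) \<times> ('b \<Rightarrow> 'b) \<Rightarrow> 'a \<times> 'b \<Rightarrow> 'a \<times> 'b" where
  "pair_map = (\<lambda>(\<phi>1, \<phi>2). restrict (map_prod \<phi>1 \<phi>2) (A \<times> B))"

lemma Times_subgroup: "subgroup (A \<times> B) G"
  using DirProd_subgroups[OF F1.is_group A F2.is_group B] .

lemma one_mem: "\<one>\<^bsub>G1\<^esub> \<in> A" "\<one>\<^bsub>G2\<^esub> \<in> B"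
  using subgroup.one_closed A B by blast+

lemma Times_projections: "fst ` (A \<times> B) = A" "snd ` (A \<times> B) = B"
  using one_mem by auto

lemma morphisms_Times:
  assumes C: "subgroup C G1" "subgroup D G2"
  shows "F (A \<times> B) (C \<times> D) = pair_map ` (F1 A C \<times> F2 B D)"
proof -
  have CD: "fst ` (C \<times> D) = C" "snd ` (C \<times> D) = D" "subgroup (C \<times> D) G"
    using subgroup.one_closed[OF C(1)] subgroup.one_closed[OF C(2)]
      DirProd_subgroups[OF F1.is_group C(1) F2.is_group C(2)] by auto
  have "pair_map (\<phi>1, \<phi>2) ` (A \<times> B) \<subseteq> C \<times> D" if "\<phi>1 \<in> F1 A C" "\<phi>2 \<in> F2 B D" for \<phi>1 \<phi>2
    using that inj_homsD(1)[OF fusion_systemD(3)[OF F1.fusion_system that(1)]]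
      inj_homsD(1)[OF fusion_systemD(3)[OF F2.fusion_system that(2)]] by (auto simp: pair_map_def)
  note im = this
  show ?thesis
  proof (intro equalityI subsetI)
    fix \<phi> assume "\<phi> \<in> F (A \<times> B) (C \<times> D)"
    then obtain \<phi>1 \<phi>2 where "\<phi>1 \<in> F1 A C" "\<phi>2 \<in> F2 B D" "\<phi> = pair_map (\<phi>1, \<phi>2)"
      unfolding prod_fusion_def Times_projections CD(1,2) pair_map_def prod.case by blast
    then show "\<phi> \<in> pair_map ` (F1 A C \<times> F2 B D)" by blast
  next
    fix \<phi> assume "\<phi> \<in> pair_map ` (F1 A C \<times> F2 B D)"
    then obtain \<phi>1 \<phi>2 where f: "\<phi>1 \<in> F1 A C" "\<phi>2 \<in> F2 B D" "\<phi> = pair_map (\<phi>1, \<phi>2)" by blast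
    moreover have "\<phi> = restrict (map_prod \<phi>1 \<phi>2) (A \<times> B)" by (simp add: f(3) pair_map_def)
    ultimately show "\<phi> \<in> F (A \<times> B) (C \<times> D)"
      unfolding prod_fusion_def Times_projections CD(1,2) using Times_subgroup CD(3) im by blast
  qed
qed

lemma pair_map_iso:
  "pair_map \<in> iso (Aut_group F1 A \<times>\<times> Aut_group F2 B) (Aut_group F (A \<times> B))"
proof -
  let ?A = "Aut_group F1 A \<times>\<times> Aut_group F2 B" and ?B = "Aut_group F (A \<times> B)"
  have mem: "pair_map (\<phi>1, \<phi>2) \<in> F (A \<times> B) (A \<times> B)" if "\<phi>1 \<in> F1 A A" "\<phi>2 \<in> F2 B B" for \<phi>1 \<phi>2
    using that morphisms_Times[OF A B] by blast
  have "pair_map \<in> hom ?A ?B"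
  proof (rule homI)
    fix u v assume "u \<in> carrier ?A" "v \<in> carrier ?A"
    then obtain \<phi>1 \<phi>2 \<psi>1 \<psi>2 where uv: "u = (\<phi>1, \<phi>2)" "v = (\<psi>1, \<psi>2)"
      and f: "\<phi>1 \<in> F1 A A" "\<phi>2 \<in> F2 B B" "\<psi>1 \<in> F1 A A" "\<psi>2 \<in> F2 B B" by auto
    have m: "\<psi>1 a \<in> A" if "a \<in> A" for a using that F1.automorphism(2)[OF f(3)] by blast
    have m': "\<psi>2 a \<in> B" if "a \<in> B" for a using that F2.automorphism(2)[OF f(4)] by blast
    have "pair_map (compose A \<phi>1 \<psi>1, compose B \<phi>2 \<psi>2) = compose (A \<times> B) (pair_map (\<phi>1, \<phi>2)) (pair_map (\<psi>1, \<psi>2))"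
      using m m' by (auto simp: pair_map_def compose_def fun_eq_iff)
    then show "pair_map (u \<otimes>\<^bsub>?A\<^esub> v) = pair_map u \<otimes>\<^bsub>?B\<^esub> pair_map v"
      using F.Aut_group_mult[OF mem[OF f(1,2)] mem[OF f(3,4)]] F1.Aut_group_mult[OF f(1,3)] F2.Aut_group_mult[OF f(2,4)]
      by (simp add: uv)
  qed (use mem in auto)
  moreover have "inj_on pair_map (carrier ?A)"
  proof (rule inj_onI)
    fix u v assume "u \<in> carrier ?A" "v \<in> carrier ?A"
      and eq: "pair_map u = pair_map v"
    then obtain \<phi>1 \<phi>2 \<psi>1 \<psi>2 where uv: "u = (\<phi>1, \<phi>2)" "v = (\<psi>1, \<psi>2)"
      and f: "\<phi>1 \<in> F1 A A" "\<phi>2 \<in> F2 B B" "\<psi>1 \<in> F1 A A" "\<psi>2 \<in> F2 B B" by auto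
    have e: "\<phi>1 a = \<psi>1 a \<and> \<phi>2 b = \<psi>2 b" if "a \<in> A" "b \<in> B" for a b
      using fun_cong[OF eq, of "(a, b)"] that by (simp add: uv pair_map_def)
    have "\<phi>1 = \<psi>1"
      using inj_homsD(4)[OF fusion_systemD(3)[OF F1.fusion_system f(1)]] inj_homsD(4)[OF fusion_systemD(3)[OF F1.fusion_system f(3)]]
      by (rule extensionalityI) (use e one_mem(2) in blast)
    moreover have "\<phi>2 = \<psi>2"
      using inj_homsD(4)[OF fusion_systemD(3)[OF F2.fusion_system f(2)]] inj_homsD(4)[OF fusion_systemD(3)[OF F2.fusion_system f(4)]]
      by (rule extensionalityI) (use e one_mem(1) in blast)
    ultimately show "u = v" using uv by simp
  qed
  ultimately show ?thesis
    using morphisms_Times[OF A B] by (simp add: iso_iff)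
qed

lemma Inn_Times: "Inn G (A \<times> B) = pair_map ` (Inn G1 A \<times> Inn G2 B)"
proof -
  have eq: "conj_map G (A \<times> B) (a, b) = pair_map (conj_map G1 A a, conj_map G2 B b)" if ab: "a \<in> A" "b \<in> B" for a b
  proof -
    have c: "a \<in> carrier G1" "b \<in> carrier G2" using ab subgroup.mem_carrier A B by metis+
    show ?thesis
      unfolding conj_map_def[of G] pair_map_def prod.case
    proof (rule restrict_ext)
      fix z assume "z \<in> A \<times> B"
      then obtain x y where "z = (x, y)" "x \<in> A" "y \<in> B" by blast
      then show "inv\<^bsub>G\<^esub> (a, b) \<otimes>\<^bsub>G\<^esub> z \<otimes>\<^bsub>G\<^esub> (a, b) = map_prod (conj_map G1 A a) (conj_map G2 B b) z"
        using inv_G[OF c] by (simp add: conj_map_def)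
    qed
  qed
  have "Inn G (A \<times> B) = (\<lambda>(a, b). pair_map (conj_map G1 A a, conj_map G2 B b)) ` (A \<times> B)"
    unfolding Inn_def by (rule image_cong) (auto simp: eq)
  also have "\<dots> = pair_map ` (Inn G1 A \<times> Inn G2 B)" unfolding Inn_def by force
  finally show ?thesis .
qed

lemma radical_Times_iff: "radical p G F (A \<times> B) \<longleftrightarrow> radical p G1 F1 A \<and> radical p G2 F2 B"
proof -
  let ?O1 = "p_core p (Aut_group F1 A)" and ?O2 = "p_core p (Aut_group F2 B)"
  interpret A1: group "Aut_group F1 A" by (rule F1.group_Aut_group[OF A])
  interpret A2: group "Aut_group F2 B" by (rule F2.group_Aut_group[OF B])
  have fin: "finite (carrier (Aut_group F1 A))" "finite (carrier (Aut_group F2 B))"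
    using F1.finite_automorphisms[OF A] F2.finite_automorphisms[OF B] by simp_all
  have core: "p_core p (Aut_group F (A \<times> B)) = pair_map ` (?O1 \<times> ?O2)"
    unfolding p_core_DirProd[OF A1.is_group A2.is_group fin F1.prime_p, symmetric]
    by (rule p_core_iso[OF DirProd_group[OF A1.is_group A2.is_group] F.group_Aut_group[OF Times_subgroup] _ F1.prime_p pair_map_iso])
      (use fin in simp)
  have sub: "?O1 \<subseteq> F1 A A" "?O2 \<subseteq> F2 B B"
    using A1.p_core_normal_p[OF fin(1) F1.prime_p] A2.p_core_normal_p[OF fin(2) F1.prime_p]
      normal_imp_subgroup subgroup.subset by fastforce+
  have Inn: "Inn G1 A \<subseteq> ?O1" "Inn G2 B \<subseteq> ?O2"
    using F1.Inn_subset_p_core[OF A] F2.Inn_subset_p_core[OF B] .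
  have ne: "Inn G1 A \<noteq> {}" "Inn G2 B \<noteq> {}" using one_mem by (auto simp: Inn_def)
  have inj: "inj_on pair_map (F1 A A \<times> F2 B B)" using pair_map_iso by (simp add: iso_iff)
  have "radical p G F (A \<times> B) \<longleftrightarrow> pair_map ` (?O1 \<times> ?O2) = pair_map ` (Inn G1 A \<times> Inn G2 B)"
    unfolding radical_def core Inn_Times using Times_subgroup by simp
  also have "\<dots> \<longleftrightarrow> ?O1 \<times> ?O2 = Inn G1 A \<times> Inn G2 B"
    by (rule inj_on_image_eq_iff[OF inj]) (use sub Inn in blast)+
  also have "\<dots> \<longleftrightarrow> ?O1 = Inn G1 A \<and> ?O2 = Inn G2 B" using ne by (auto simp: times_eq_iff)
  finally show ?thesis using A B by (simp add: radical_def)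
qed

lemma conjugates_Times: "conjugates F (A \<times> B) = {C \<times> D | C D. C \<in> conjugates F1 A \<and> D \<in> conjugates F2 B}"
proof (intro equalityI subsetI)
  fix Q assume "Q \<in> conjugates F (A \<times> B)"
  then obtain \<phi> where \<phi>: "\<phi> \<in> F (A \<times> B) Q" "\<phi> ` (A \<times> B) = Q" by (auto simp: conjugates_def)
  then obtain \<phi>1 \<phi>2 where f: "\<phi>1 \<in> F1 A (fst ` Q)" "\<phi>2 \<in> F2 B (snd ` Q)" "\<phi> = restrict (map_prod \<phi>1 \<phi>2) (A \<times> B)"
    unfolding prod_fusion_def Times_projections by blast
  have "Q = (\<phi>1 ` A) \<times> (\<phi>2 ` B)" using \<phi>(2) f(3) by force
  moreover have "\<phi>1 ` A \<in> conjugates F1 A" "\<phi>2 ` B \<in> conjugates F2 B"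
    using fusion_systemD(6)[OF F1.fusion_system f(1)] fusion_systemD(6)[OF F2.fusion_system f(2)]
    by (auto simp: conjugates_def)
  ultimately show "Q \<in> {C \<times> D | C D. C \<in> conjugates F1 A \<and> D \<in> conjugates F2 B}" by blast
next
  fix Q assume "Q \<in> {C \<times> D | C D. C \<in> conjugates F1 A \<and> D \<in> conjugates F2 B}"
  then obtain C D where CD: "Q = C \<times> D" "C \<in> conjugates F1 A" "D \<in> conjugates F2 B" by blast
  then obtain \<phi>1 \<phi>2 where f: "\<phi>1 \<in> F1 A C" "\<phi>1 ` A = C" "\<phi>2 \<in> F2 B D" "\<phi>2 ` B = D" by (auto simp: conjugates_def)
  have "pair_map (\<phi>1, \<phi>2) \<in> F (A \<times> B) (C \<times> D)"
    using morphisms_Times[OF F1.conjugates_subgroup[OF CD(2)] F2.conjugates_subgroup[OF CD(3)]] f by blast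
  moreover have "pair_map (\<phi>1, \<phi>2) ` (A \<times> B) = C \<times> D" using f(2,4) by (force simp: pair_map_def)
  ultimately show "Q \<in> conjugates F (A \<times> B)" using CD(1) by (auto simp: conjugates_def)
qed

lemma centric_Times_iff: "centric G F (A \<times> B) \<longleftrightarrow> centric G1 F1 A \<and> centric G2 F2 B"
proof -
  have iff: "centralizer G (C \<times> D) \<subseteq> C \<times> D \<longleftrightarrow> centralizer G1 C \<subseteq> C \<and> centralizer G2 D \<subseteq> D"
    if "C \<in> conjugates F1 A" "D \<in> conjugates F2 B" for C D
  proof -
    have s: "subgroup C G1" "subgroup D G2" using that F1.conjugates_subgroup F2.conjugates_subgroup by blast+
    then have "C \<noteq> {}" "D \<noteq> {}" using subgroup.one_closed by fastforce+
    moreover have "\<one>\<^bsub>G1\<^esub> \<in> centralizer G1 C" "\<one>\<^bsub>G2\<^esub> \<in> centralizer G2 D"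
      using subgroup.mem_carrier[OF s(1)] subgroup.mem_carrier[OF s(2)] by (auto simp: centralizer_def)
    ultimately show ?thesis using centralizer_DirProd[of C D G1 G2] by (auto simp: times_subset_iff)
  qed
  note self = F1.self_conjugate[OF A] F2.self_conjugate[OF B]
  have "centric G F (A \<times> B) \<longleftrightarrow>
      (\<forall>C\<in>conjugates F1 A. \<forall>D\<in>conjugates F2 B. centralizer G (C \<times> D) \<subseteq> C \<times> D)"
    unfolding centric_def conjugates_Times using Times_subgroup by auto
  also have "\<dots> \<longleftrightarrow> (\<forall>C\<in>conjugates F1 A. \<forall>D\<in>conjugates F2 B. centralizer G1 C \<subseteq> C \<and> centralizer G2 D \<subseteq> D)"
    using iff by simp
  also have "\<dots> \<longleftrightarrow> centric G1 F1 A \<and> centric G2 F2 B"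
    unfolding centric_def using A B self by auto
  finally show ?thesis .
qed

lemma centric_radical_Times_iff:
  "A \<times> B \<in> centric_radicals p G F \<longleftrightarrow> A \<in> centric_radicals p G1 F1 \<and> B \<in> centric_radicals p G2 F2"
  using radical_Times_iff centric_Times_iff by (auto simp: centric_radicals_def)

end

end

section \<open>The Sylow subgroup is centric radical\<close>

context locality
begin

text \<open>Restricting only the morphisms with domain \<open>S\<close> already gives a fusion system containing the
  generating conjugations, because every morphism starting at the finite group \<open>S\<close> is onto \<open>S\<close>.\<close>

lemma automorphisms_of_S:
  assumes "\<phi> \<in> fusion S S"
  shows "\<exists>g\<in>pg_normalizer L S. \<phi> = restrict (pconj L g) S"
proof -
  interpret S: group "group_of L S" by (rule group_group_of[OF S_subgroup])
  let ?G = "group_of L S"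
  let ?N = "pg_normalizer L S"
  define F where "F = (\<lambda>P Q. {\<phi> \<in> inj_homs ?G P Q. subgroup P ?G \<and> subgroup Q ?G \<and>
    (P = S \<longrightarrow> (\<exists>g\<in>?N. \<phi> = restrict (pconj L g) S))})"
  have U: "fusion_system ?G (\<lambda>P Q. {\<phi> \<in> inj_homs ?G P Q. subgroup P ?G \<and> subgroup Q ?G})"
    by (rule S.fusion_system_inj_homs)
  have finS: "finite S" using finite_carrier S_closed by (meson finite_subset subsetI)
  have N: "pg_subgroup L ?N" by (rule normalizer_subgroup[OF S_object])
  have conj_S: "pconj L g ` S = S" "S \<subseteq> conj_dom L g" if "g \<in> ?N" for g
    using that by (auto simp: pg_normalizer_def)
  have sub_S: "P \<subseteq> S" if "subgroup P ?G" for P using subgroup.subset[OF that] by simp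
  have "fusion_system ?G F"
  proof (rule fusion_systemI)
    fix P Q g assume P: "subgroup P ?G" "subgroup Q ?G" and g: "g \<in> carrier ?G" "conj_map ?G P g ` P \<subseteq> Q"
    have "g \<in> ?N" using g(1) subset_normalizer[OF S_object] by auto
    moreover have "conj_map ?G P g = restrict (pconj L g) P"
      using conj_map_group_of[OF S_subgroup _ sub_S[OF P(1)]] g(1) by simp
    moreover have "conj_map ?G P g \<in> inj_homs ?G P Q"
      using fusion_systemD(4)[OF U P g] by simp
    ultimately show "conj_map ?G P g \<in> F P Q" unfolding F_def using P by blast
  next
    fix \<phi> \<psi> P Q R assume \<phi>: "\<phi> \<in> F P Q" and \<psi>: "\<psi> \<in> F Q R"
    have i: "compose P \<psi> \<phi> \<in> inj_homs ?G P R"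
      using fusion_systemD(5)[OF U, of \<phi> P Q \<psi> R] \<phi> \<psi> by (simp add: F_def)
    have "\<exists>g\<in>?N. compose P \<psi> \<phi> = restrict (pconj L g) S" if PS: "P = S"
    proof -
      obtain g where g: "g \<in> ?N" "\<phi> = restrict (pconj L g) S" using \<phi> PS by (auto simp: F_def)
      have "S = \<phi> ` S" using conj_S[OF g(1)] g(2) by simp
      also have "\<dots> \<subseteq> Q" using \<phi> PS by (auto simp: F_def dest: inj_homsD(1))
      finally have "Q = S" using \<psi> sub_S[of Q] by (auto simp: F_def)
      then obtain h where h: "h \<in> ?N" "\<psi> = restrict (pconj L h) S" using \<psi> by (auto simp: F_def)
      have "compose P \<psi> \<phi> = restrict (pconj L (pprod L [g, h])) S"
        unfolding compose_def PS
      proof (rule restrict_ext)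
        fix x assume x: "x \<in> S"
        then have "pconj L g x \<in> S" using conj_S[OF g(1)] by blast
        then show "\<psi> (\<phi> x) = pconj L (pprod L [g, h]) x"
          using conj_normalizer_mult(2)[OF S_object g(1) h(1) x] x by (simp add: g(2) h(2))
      qed
      moreover have "pprod L [g, h] \<in> ?N" using pg_subgroupD(3)[OF N, of "[g, h]"] g(1) h(1) by simp
      ultimately show ?thesis by blast
    qed
    then show "compose P \<psi> \<phi> \<in> F P R" using i \<phi> \<psi> unfolding F_def by blast
  next
    fix \<phi> P Q assume \<phi>: "\<phi> \<in> F P Q"
    then have \<phi>U: "\<phi> \<in> {\<phi> \<in> inj_homs ?G P Q. subgroup P ?G \<and> subgroup Q ?G}" by (simp add: F_def)
    note inv = fusion_systemD(6,7)[OF U \<phi>U]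
    have inj: "inj_on \<phi> P" using \<phi> inj_homsD(3) unfolding F_def by blast
    have "\<exists>g\<in>?N. restrict (inv_into P \<phi>) (\<phi> ` P) = restrict (pconj L g) S" if im: "\<phi> ` P = S"
    proof -
      have "P \<subseteq> S" using \<phi> sub_S by (simp add: F_def)
      moreover have "card P = card S" using card_image[OF inj] im by simp
      ultimately have PS: "P = S" using finS card_subset_eq by blast
      then obtain g where g: "g \<in> ?N" "\<phi> = restrict (pconj L g) S" using \<phi> by (auto simp: F_def)
      have "restrict (inv_into P \<phi>) (\<phi> ` P) = restrict (pconj L (pinv L g)) S"
        unfolding im
      proof (rule restrict_ext)
        fix y assume "y \<in> S"
        then obtain x where x: "x \<in> S" "y = \<phi> x" using im PS by blast
        have "inv_into P \<phi> y = x" using x inj PS by simp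
        also have "x = pconj L (pinv L g) y"
          using conj_reverse(2)[of x g] conj_S(2)[OF g(1)] x g(2) by auto
        finally show "inv_into P \<phi> y = pconj L (pinv L g) y" .
      qed
      then show ?thesis using pg_subgroupD(4)[OF N g(1)] by blast
    qed
    then show "\<phi> \<in> F P (\<phi> ` P) \<and> restrict (inv_into P \<phi>) (\<phi> ` P) \<in> F (\<phi> ` P) P"
      using inv \<phi> unfolding F_def by blast
  qed (simp add: F_def)
  moreover have "contains_conj F"
    unfolding contains_conj_def
  proof (intro ballI impI)
    fix R g assume R: "R \<in> \<Delta>" and g: "g \<in> carrier L" and h: "R \<subseteq> conj_dom L g \<and> pconj L g ` R \<subseteq> S"
    have s: "subgroup R ?G" "subgroup (pconj L g ` R) ?G"
      using objectD[OF R] conj_subgroup(1)[OF objectD[OF R] g] h subgroup_group_of_iff[OF S_subgroup] by auto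
    have "g \<in> ?N" if "R = S"
    proof -
      have "inj_on (pconj L g) S" using inj_on_subset[OF inj_on_conj] h that by blast
      then have "pconj L g ` S = S" using endo_inj_surj[OF finS] h that by blast
      then show ?thesis using g h that by (simp add: pg_normalizer_def)
    qed
    then show "restrict (pconj L g) R \<in> F R (pconj L g ` R)"
      unfolding F_def using conj_inj_homs[OF R g] h s by blast
  qed
  ultimately have "\<phi> \<in> F S S" using locality_fusion_minimal assms by blast
  then show ?thesis by (simp add: F_def)
qed

lemma finite_fusion: "prime p \<Longrightarrow> finite_fusion (group_of L S) p fusion"
  using group_group_of[OF S_subgroup] fusion_system_locality_fusion S_p_subgroup
  by (simp add: finite_fusion_def finite_fusion_axioms_def pg_p_subgroup_def)

lemma object_normal:
  assumes P: "P \<in> \<Delta>"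
  shows "P \<lhd> group_of L (pg_normalizer L P)"
proof -
  let ?N = "pg_normalizer L P"
  let ?M = "group_of L ?N"
  have N: "pg_subgroup L ?N" by (rule normalizer_subgroup[OF P])
  interpret N: group "?M" by (rule group_group_of[OF N])
  show ?thesis
  proof (rule N.normal_invI)
    show "subgroup P (?M)"
      using subgroup_group_of_iff[OF N] objectD(1)[OF P] subset_normalizer[OF P] by blast
    fix x s assume x: "x \<in> carrier (?M)" and s: "s \<in> P"
    have i: "inv\<^bsub>?M\<^esub> x \<in> ?N" using N.inv_closed[OF x] by simp
    have "pconj L (inv\<^bsub>?M\<^esub> x) s = x \<otimes>\<^bsub>?M\<^esub> s \<otimes>\<^bsub>?M\<^esub> inv\<^bsub>?M\<^esub> x"
      using conj_in_subgroup(3)[OF N i] s subset_normalizer[OF P] N.inv_inv[OF x] by auto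
    moreover have "pconj L (inv\<^bsub>?M\<^esub> x) s \<in> P"
      using i s by (auto simp: pg_normalizer_def)
    ultimately show "x \<otimes>\<^bsub>?M\<^esub> s \<otimes>\<^bsub>?M\<^esub> inv\<^bsub>?M\<^esub> x \<in> P" by metis
  qed
qed

lemma object_card:
  assumes p: "prime p" and P: "P \<in> \<Delta>"
  shows "\<exists>n. card P = p ^ n"
proof -
  interpret F: finite_fusion "group_of L S" p fusion by (rule finite_fusion[OF p])
  show ?thesis using F.p_subgroup subgroup_group_of_iff[OF S_subgroup] objectD[OF P] by blast
qed

lemma finite_normalizer: "finite (carrier (group_of L (pg_normalizer L P)))"
  using finite_carrier by (auto simp: pg_normalizer_def)

lemma p_elements_of_normalizer:
  assumes p: "prime p" and h: "h \<in> pg_normalizer L S"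
    and pow: "h [^]\<^bsub>group_of L (pg_normalizer L S)\<^esub> (p ^ k :: nat) = \<one>\<^bsub>group_of L (pg_normalizer L S)\<^esub>"
  shows "h \<in> S"
proof -
  let ?N = "pg_normalizer L S"
  let ?M = "group_of L ?N"
  have N: "pg_subgroup L ?N" by (rule normalizer_subgroup[OF S_object])
  interpret N: group "?M" by (rule group_group_of[OF N])
  note fin = finite_normalizer[of S]
  let ?H = "generate (?M) {h}"
  have H: "subgroup ?H (?M)" using h by (intro N.generate_is_subgroup) simp
  have "card ?H = N.ord h" using N.generate_pow_card h by simp
  moreover have "N.ord h dvd p ^ k" using pow h N.pow_eq_id by simp
  ultimately obtain i where i: "card ?H = p ^ i" using p divides_primepow_nat by metis
  obtain n where n: "card S = p ^ n" using S_p_subgroup by (auto simp: pg_p_subgroup_def)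
  have T: "subgroup (S <#>\<^bsub>?M\<^esub> ?H) (?M)" "\<exists>n. card (S <#>\<^bsub>?M\<^esub> ?H) = p ^ n"
    using N.prime_power_card_set_mult[OF fin p object_normal[OF S_object] n H i] by blast+
  interpret SH: second_isomorphism_grp S "?M" ?H
    using object_normal[OF S_object] H by (simp add: second_isomorphism_grp_def second_isomorphism_grp_axioms_def)
  have "pg_p_subgroup p L (S <#>\<^bsub>?M\<^esub> ?H)"
    using T subgroup_group_of_iff[OF N] by (simp add: pg_p_subgroup_def)
  then have "S <#>\<^bsub>?M\<^esub> ?H = S" by (rule S_maximal) (rule SH.H_contained_in_set_mult)
  then show ?thesis using SH.S_contained_in_set_mult generate.incl[of h "{h}" "?M"] by blast
qed

lemma S_centric_radical:
  assumes p: "prime p"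
  shows "S \<in> centric_radicals p (group_of L S) fusion"
proof -
  let ?G = "group_of L S"
  let ?N = "pg_normalizer L S"
  let ?M = "group_of L ?N"
  let ?A = "Aut_group fusion S"
  interpret F: finite_fusion ?G p fusion by (rule finite_fusion[OF p])
  have SG: "subgroup S ?G" using F.subgroup_self by simp
  interpret A: group ?A by (rule F.group_Aut_group[OF SG])
  have N: "pg_subgroup L ?N" by (rule normalizer_subgroup[OF S_object])
  interpret N: group "?M" by (rule group_group_of[OF N])
  note finN = finite_normalizer[of S]
  have finA: "finite (carrier ?A)" using F.finite_automorphisms[OF SG] by simp
  have "centric ?G fusion S"
    unfolding centric_def
  proof (intro conjI ballI)
    fix Q assume "Q \<in> conjugates fusion S"
    then obtain \<phi> where \<phi>: "\<phi> \<in> fusion S Q" "\<phi> ` S = Q" by (auto simp: conjugates_def)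
    have "Q \<subseteq> S" using subgroup.subset[OF fusion_systemD(2)[OF F.fusion_system \<phi>(1)]] by simp
    moreover have "card Q = card S"
      using card_image inj_homsD(3)[OF fusion_systemD(3)[OF F.fusion_system \<phi>(1)]] \<phi>(2) by blast
    ultimately have "Q = S" using F.finite_G card_subset_eq[of S Q] by simp
    then show "centralizer ?G Q \<subseteq> Q" by (auto simp: centralizer_def)
  qed (rule SG)
  moreover have "p_core p ?A \<subseteq> Inn ?G S"
  proof
    fix \<alpha> assume \<alpha>: "\<alpha> \<in> p_core p ?A"
    have core: "p_core p ?A \<lhd> ?A" "\<exists>n. card (p_core p ?A) = p ^ n" using A.p_core_normal_p[OF finA p] by auto
    have \<alpha>A: "\<alpha> \<in> carrier ?A" using \<alpha> core(1) normal_imp_subgroup subgroup.subset by blast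
    obtain k :: nat where k: "\<alpha> [^]\<^bsub>?A\<^esub> (p ^ k) = \<one>\<^bsub>?A\<^esub>"
      using A.prime_power_card_iff[OF finA p normal_imp_subgroup[OF core(1)]] core(2) \<alpha> by blast
    obtain g where g: "g \<in> ?N" "\<alpha> = restrict (pconj L g) S" using automorphisms_of_S \<alpha>A by auto
    have gN: "g \<in> carrier (?M)" using g(1) by simp
    have pow: "\<alpha> [^]\<^bsub>?A\<^esub> j = restrict (pconj L (g [^]\<^bsub>?M\<^esub> j)) S" for j :: nat
    proof (induction j)
      case 0
      show ?case using conj_by_one(2) S_closed by (auto intro!: restrict_ext)
    next
      case (Suc j)
      let ?h = "g [^]\<^bsub>?M\<^esub> j"
      have h: "?h \<in> ?N" using N.nat_pow_closed[OF gN, of j] by simp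
      have \<alpha>j: "\<alpha> [^]\<^bsub>?A\<^esub> j \<in> fusion S S" using A.nat_pow_closed[OF \<alpha>A, of j] by simp
      have "\<alpha> [^]\<^bsub>?A\<^esub> Suc j = \<alpha> \<otimes>\<^bsub>?A\<^esub> \<alpha> [^]\<^bsub>?A\<^esub> j" by (rule A.nat_pow_Suc2[OF \<alpha>A])
      also have "\<dots> = compose S \<alpha> (\<alpha> [^]\<^bsub>?A\<^esub> j)" using F.Aut_group_mult[OF _ \<alpha>j] \<alpha>A by simp
      also have "\<dots> = restrict (pconj L (pprod L [?h, g])) S"
        unfolding compose_def
      proof (rule restrict_ext)
        fix x assume x: "x \<in> S"
        have "pconj L ?h x \<in> S" using h x by (auto simp: pg_normalizer_def)
        then show "\<alpha> ((\<alpha> [^]\<^bsub>?A\<^esub> j) x) = pconj L (pprod L [?h, g]) x"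
          using conj_normalizer_mult(2)[OF S_object h g(1) x] x unfolding Suc.IH by (simp add: g(2))
      qed
      finally show ?case by simp
    qed
    obtain a m :: nat where am: "(g [^]\<^bsub>?M\<^esub> (p ^ a)) [^]\<^bsub>?M\<^esub> m = \<one>\<^bsub>?M\<^esub>" "coprime m p"
      using N.p_regular_part[OF finN p gN] .
    have "\<exists>u. \<alpha> [^]\<^bsub>?A\<^esub> (m * u) = \<alpha>"
    proof (cases "p ^ k = 1")
      case True
      then have "\<alpha> [^]\<^bsub>?A\<^esub> (m * 0) = \<alpha>" using k \<alpha>A by (metis A.nat_pow_eone mult_0_right nat_pow_0)
      then show ?thesis by blast
    next
      case False
      have "coprime m (p ^ k)" using am(2) by simp
      then obtain x y where xy: "m * x = p ^ k * y + 1" using coprime_bezout_strong False by blast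
      have "\<alpha> [^]\<^bsub>?A\<^esub> (m * x) = (\<alpha> [^]\<^bsub>?A\<^esub> (p ^ k)) [^]\<^bsub>?A\<^esub> y \<otimes>\<^bsub>?A\<^esub> \<alpha>"
        using \<alpha>A unfolding xy by (simp add: A.nat_pow_pow flip: A.nat_pow_mult)
      then show ?thesis using k \<alpha>A A.nat_pow_one A.l_one by metis
    qed
    then obtain u where u: "\<alpha> [^]\<^bsub>?A\<^esub> (m * u) = \<alpha>" by blast
    let ?h = "g [^]\<^bsub>?M\<^esub> (m * u)"
    have hN: "?h \<in> ?N" using N.nat_pow_closed[OF gN, of "m * u"] by simp
    have "?h [^]\<^bsub>?M\<^esub> (p ^ a) = ((g [^]\<^bsub>?M\<^esub> (p ^ a)) [^]\<^bsub>?M\<^esub> m) [^]\<^bsub>?M\<^esub> u"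
      using gN by (simp add: N.nat_pow_pow ac_simps)
    then have "?h \<in> S" using p_elements_of_normalizer[OF p hN] am(1) N.nat_pow_one by metis
    moreover have "\<alpha> = restrict (pconj L ?h) S" using pow[of "m * u"] u by simp
    ultimately show "\<alpha> \<in> Inn ?G S"
      using conj_map_group_of[OF S_subgroup _ order_refl] by (auto simp: Inn_def)
  qed
  then have "radical p ?G fusion S" using F.Inn_subset_p_core[OF SG] SG by (auto simp: radical_def)
  ultimately show ?thesis by (simp add: centric_radicals_def)
qed

end

section \<open>Linking localities\<close>

context locality_pair
begin

lemma normalizer_projections:
  assumes P: "P \<in> \<Delta>"
  shows "pg_normalizer L P \<subseteq> pg_normalizer L1 (fst ` P) \<times> pg_normalizer L2 (snd ` P)"
proof
  fix g assume g: "g \<in> pg_normalizer L P"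
  obtain g1 g2 where g12: "g = (g1, g2)" by (cases g)
  have "fst ` pconj L g ` P = pconj L1 g1 ` fst ` P" "snd ` pconj L g ` P = pconj L2 g2 ` snd ` P"
    by (simp_all only: g12 pconj_pg_prod fst_snd_map_prod_image)
  then show "g \<in> pg_normalizer L1 (fst ` P) \<times> pg_normalizer L2 (snd ` P)"
    using g subset_conj_dom_pg_prod[of P L1 L2 g1 g2] by (simp add: pg_normalizer_def g12)
qed

lemma normalizer_Times:
  assumes P: "P1 \<in> \<Delta>1" "P2 \<in> \<Delta>2"
  shows "pg_normalizer L (P1 \<times> P2) = pg_normalizer L1 P1 \<times> pg_normalizer L2 P2"
proof
  have "fst ` (P1 \<times> P2) = P1" "snd ` (P1 \<times> P2) = P2"
    using L1.pg_subgroupD(3)[OF L1.objectD(1)[OF P(1)], of "[]"] L2.pg_subgroupD(3)[OF L2.objectD(1)[OF P(2)], of "[]"]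
    by auto
  then show "pg_normalizer L (P1 \<times> P2) \<subseteq> pg_normalizer L1 P1 \<times> pg_normalizer L2 P2"
    using normalizer_projections[OF Times_object[OF P]] by simp
  show "pg_normalizer L1 P1 \<times> pg_normalizer L2 P2 \<subseteq> pg_normalizer L (P1 \<times> P2)"
  proof clarify
    fix g1 g2 assume g: "g1 \<in> pg_normalizer L1 P1" "g2 \<in> pg_normalizer L2 P2"
    have "pconj L (g1, g2) ` (P1 \<times> P2) = (pconj L1 g1 ` P1) \<times> (pconj L2 g2 ` P2)"
      unfolding pconj_pg_prod by auto
    moreover have "P1 \<times> P2 \<subseteq> conj_dom L (g1, g2)"
      using g by (auto simp: pg_normalizer_def conj_dom_pg_prod)
    ultimately show "(g1, g2) \<in> pg_normalizer L (P1 \<times> P2)" using g by (simp add: pg_normalizer_def)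
  qed
qed

lemma characteristic_p_normalizer_Times:
  assumes P: "P1 \<in> \<Delta>1" "P2 \<in> \<Delta>2"
  shows "characteristic_p p (group_of L (pg_normalizer L (P1 \<times> P2))) \<longleftrightarrow>
    characteristic_p p (group_of L1 (pg_normalizer L1 P1)) \<and> characteristic_p p (group_of L2 (pg_normalizer L2 P2))"
  unfolding normalizer_Times[OF P] group_of_pg_prod
  by (rule characteristic_p_DirProd[OF L1.group_group_of[OF L1.normalizer_subgroup[OF P(1)]]
        L2.group_group_of[OF L2.normalizer_subgroup[OF P(2)]] L1.finite_normalizer L2.finite_normalizer prime_p])

lemma objective_char_p_factors:
  assumes "objective_char_p p L \<Delta>"
  shows "objective_char_p p L1 \<Delta>1" "objective_char_p p L2 \<Delta>2"
  using assms Times_object[OF _ L2.S_object] Times_object[OF L1.S_object]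
    characteristic_p_normalizer_Times[OF _ L2.S_object] characteristic_p_normalizer_Times[OF L1.S_object]
  unfolding objective_char_p_def by blast+

lemma objective_char_p_prod:
  assumes ch: "objective_char_p p L1 \<Delta>1" "objective_char_p p L2 \<Delta>2"
  shows "objective_char_p p L \<Delta>"
  unfolding objective_char_p_def
proof
  interpret L: locality p L \<Delta> S by (rule locality_prod)
  fix P assume P: "P \<in> \<Delta>"
  note P12 = object_projections[OF P]
  let ?N1 = "pg_normalizer L1 (fst ` P)" and ?N2 = "pg_normalizer L2 (snd ` P)" and ?N = "pg_normalizer L P"
  let ?G = "group_of L1 ?N1 \<times>\<times> group_of L2 ?N2"
  let ?M = "group_of L (?N1 \<times> ?N2)"
  have N1: "pg_subgroup L1 ?N1" and N2: "pg_subgroup L2 ?N2" and N: "pg_subgroup L ?N"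
    using L1.normalizer_subgroup[OF P12(1)] L2.normalizer_subgroup[OF P12(2)] L.normalizer_subgroup[OF P] .
  have N12: "pg_subgroup L (?N1 \<times> ?N2)" using pg_subgroup_Times[OF N1 N2] .
  interpret G1: group "group_of L1 ?N1" by (rule L1.group_group_of[OF N1])
  interpret G2: group "group_of L2 ?N2" by (rule L2.group_group_of[OF N2])
  interpret G: group "?M" by (rule L.group_group_of[OF N12])
  have GN: "?G\<lparr>carrier := ?N\<rparr> = group_of L ?N"
    unfolding group_of_pg_prod[symmetric] by (rule L.group_of_sel(4))
  obtain n where n: "card P = p ^ n" using L.object_card[OF prime_p P] by blast
  have "characteristic_p p (?G\<lparr>carrier := ?N\<rparr>)"
  proof (rule characteristic_p_subdirect[OF G1.is_group G2.is_group L1.finite_normalizer L2.finite_normalizer prime_p])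
    show "characteristic_p p (group_of L1 ?N1)" "characteristic_p p (group_of L2 ?N2)"
      using ch P12 unfolding objective_char_p_def by blast+
    show "subgroup ?N ?G"
      unfolding group_of_pg_prod[symmetric] L.subgroup_group_of_iff[OF N12]
      using N normalizer_projections[OF P] by blast
    show "P \<lhd> ?G\<lparr>carrier := ?N\<rparr>"
      unfolding GN by (rule L.object_normal[OF P])
    show "card P = p ^ n" by (rule n)
    show "fst ` P \<subseteq> p_core p (group_of L1 ?N1)"
      using G1.normal_p_subset_p_core[OF L1.object_normal[OF P12(1)]] L1.object_card[OF prime_p P12(1)] by blast
    show "snd ` P \<subseteq> p_core p (group_of L2 ?N2)"
      using G2.normal_p_subset_p_core[OF L2.object_normal[OF P12(2)]] L2.object_card[OF prime_p P12(2)] by blast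
    show "centralizer ?G P \<subseteq> ?N"
      unfolding group_of_pg_prod[symmetric]
    proof
      fix g assume g: "g \<in> centralizer (?M) P"
      then have gN: "g \<in> ?N1 \<times> ?N2" and gG: "g \<in> carrier (?M)" by (auto simp: centralizer_def)
      have PN: "P \<subseteq> ?N1 \<times> ?N2" using L.subset_normalizer[OF P] normalizer_projections[OF P] by blast
      have conj: "pconj L g x = x" if x: "x \<in> P" for x
      proof -
        have xG: "x \<in> carrier (?M)" using x PN by auto
        have c: "g \<otimes>\<^bsub>?M\<^esub> x = x \<otimes>\<^bsub>?M\<^esub> g"
          using g x by (auto simp: centralizer_def)
        have "pconj L g x = inv\<^bsub>?M\<^esub> g \<otimes>\<^bsub>?M\<^esub> x \<otimes>\<^bsub>?M\<^esub> g"
          using L.conj_in_subgroup(3)[OF N12 gN] x PN by blast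
        also have "\<dots> = inv\<^bsub>?M\<^esub> g \<otimes>\<^bsub>?M\<^esub> (g \<otimes>\<^bsub>?M\<^esub> x)"
          unfolding c by (rule G.m_assoc[OF G.inv_closed[OF gG] xG gG])
        also have "\<dots> = x" by (rule G.inv_mult_cancel(1)[OF gG xG])
        finally show ?thesis .
      qed
      have "P \<subseteq> conj_dom L g" using L.conj_in_subgroup(1)[OF N12 gN] PN by blast
      moreover have "pconj L g ` P = P" using conj by force
      moreover have "g \<in> carrier L" using L.pg_subgroupD(5)[OF N12 gN] .
      ultimately show "g \<in> ?N" by (simp add: pg_normalizer_def)
    qed
  qed
  then show "characteristic_p p (group_of L ?N)" unfolding GN .
qed

lemma linking_locality_prod_iff:
  "linking_locality p L \<Delta> S \<longleftrightarrow> linking_locality p L1 \<Delta>1 S1 \<and> linking_locality p L2 \<Delta>2 S2"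
proof -
  interpret FP: fusion_pair p G1 L1.fusion G2 L2.fusion
    using L1.finite_fusion[OF prime_p] L2.finite_fusion[OF prime_p] by (simp add: fusion_pair_def)
  let ?cr = "centric_radicals p (group_of L S) (locality_fusion L \<Delta> S)"
  let ?cr1 = "centric_radicals p G1 L1.fusion" and ?cr2 = "centric_radicals p G2 L2.fusion"
  have cr: "?cr = centric_radicals p (G1 \<times>\<times> G2) (prod_fusion G1 G2 L1.fusion L2.fusion)"
    unfolding group_of_pg_prod locality_fusion_pg_prod ..
  have cr_sub: "subgroup P G1" if "P \<in> ?cr1" for P using that by (simp add: centric_radicals_def centric_def)
  have cr_sub': "subgroup P G2" if "P \<in> ?cr2" for P using that by (simp add: centric_radicals_def centric_def)
  have S12: "S1 \<in> ?cr1" "S2 \<in> ?cr2"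
    using L1.S_centric_radical[OF prime_p] L2.S_centric_radical[OF prime_p] .
  have "?cr \<subseteq> \<Delta> \<longleftrightarrow> ?cr1 \<subseteq> \<Delta>1 \<and> ?cr2 \<subseteq> \<Delta>2"
  proof
    assume sub: "?cr \<subseteq> \<Delta>"
    have "P \<in> \<Delta>1" if P: "P \<in> ?cr1" for P
    proof -
      have "P \<times> S2 \<in> \<Delta>"
        using sub FP.centric_radical_Times_iff[OF cr_sub[OF P] cr_sub'[OF S12(2)]] P S12(2) unfolding cr by blast
      from object_projections(1)[OF this] show ?thesis
        using subgroup.one_closed[OF cr_sub'[OF S12(2)]] by (simp add: fst_image_times) (metis empty_iff)
    qed
    moreover have "P \<in> \<Delta>2" if P: "P \<in> ?cr2" for P
    proof -
      have "S1 \<times> P \<in> \<Delta>"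
        using sub FP.centric_radical_Times_iff[OF cr_sub[OF S12(1)] cr_sub'[OF P]] P S12(1) unfolding cr by blast
      from object_projections(2)[OF this] show ?thesis
        using subgroup.one_closed[OF cr_sub[OF S12(1)]] by (simp add: snd_image_times) (metis empty_iff)
    qed
    ultimately show "?cr1 \<subseteq> \<Delta>1 \<and> ?cr2 \<subseteq> \<Delta>2" by blast
  next
    assume sub: "?cr1 \<subseteq> \<Delta>1 \<and> ?cr2 \<subseteq> \<Delta>2"
    show "?cr \<subseteq> \<Delta>"
    proof
      fix P assume P: "P \<in> ?cr"
      then have eq: "P = fst ` P \<times> snd ` P" unfolding cr by (rule FP.centric_radical_eq_Times)
      have "subgroup P (G1 \<times>\<times> G2)" using P unfolding cr by (simp add: centric_radicals_def centric_def)
      note P12 = subgroup_DirProd_projections[OF group_factors this]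
      have "fst ` P \<times> snd ` P \<in> ?cr" using P eq by simp
      then have "fst ` P \<in> \<Delta>1" "snd ` P \<in> \<Delta>2"
        using FP.centric_radical_Times_iff[OF P12] sub unfolding cr by blast+
      then show "P \<in> \<Delta>" using Times_object eq by metis
    qed
  qed
  moreover have "objective_char_p p L \<Delta> \<longleftrightarrow> objective_char_p p L1 \<Delta>1 \<and> objective_char_p p L2 \<Delta>2"
    using objective_char_p_factors objective_char_p_prod by blast
  ultimately show ?thesis
    using locality_prod L1.locality_axioms L2.locality_axioms unfolding linking_locality_def by blast
qed

end

theorem lemma5p7:
  fixes L1 :: "'a partial_group" and L2 :: "'b partial_group"
    and \<Delta>1 :: "'a set set" and \<Delta>2 :: "'b set set"
    and S1 :: "'a set" and S2 :: "'b set" and p :: nat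
  assumes "prime p"
    and "locality p L1 \<Delta>1 S1"
    and "locality p L2 \<Delta>2 S2"
  shows "linking_locality p (pg_prod L1 L2) (prod_objects L1 \<Delta>1 S1 L2 \<Delta>2 S2) (S1 \<times> S2)
    \<longleftrightarrow> linking_locality p L1 \<Delta>1 S1 \<and> linking_locality p L2 \<Delta>2 S2"
proof -
  interpret locality_pair p L1 \<Delta>1 S1 L2 \<Delta>2 S2
    using assms by (simp add: locality_pair_def locality_pair_axioms_def)
  show ?thesis by (rule linking_locality_prod_iff)
qed

end
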